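(* Let $p$ be a prime and let $\mathbb{K}$ be a number field or a finite extension of $\mathbb{Q}_p$. Let $G$ be a linear algebraic group defined over $\mathbb{K}$. Let $H$ be a connected real Lie group and $\phi: H\to G(\mathbb{K})$ an abstract homomorphism. If $H$ is perfect then $\phi$ is trivial. In particular, if $H$ is real semisimple then $\phi: H\to G(\mathbb{K})$ is trivial.
   Context: $G(\mathbb{K})$ is the group of $\mathbb{K}$-rational points of $G$. An abstract homomorphism is a homomorphism of abstract groups (no continuity assumed). A group $H$ is perfect if $[H,H]=H$. *)

theory Defs
  imports
    "HOL-Analysis.Analysis"
    "HOL-Algebra.Generated_Groups"
    "HOL-Algebra.Algebraic_Closure_Type"
    "HOL-Computational_Algebra.Primes"
    "HOL-Library.Poly_Mapping"
begin

definition padic_abs :: "nat \<Rightarrow> rat \<Rightarrow> real" where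
  "padic_abs p x =
     (if x = 0 then 0
      else real p powi (int (multiplicity (int p) (snd (quotient_of x)))
                        - int (multiplicity (int p) (fst (quotient_of x)))))"

definition padic_cauchy :: "nat \<Rightarrow> (nat \<Rightarrow> rat) \<Rightarrow> bool" where
  "padic_cauchy p s \<longleftrightarrow> (\<forall>e>0. \<exists>N. \<forall>m\<ge>N. \<forall>n\<ge>N. padic_abs p (s m - s n) < e)"

definition padic_cauchy_ring :: "nat \<Rightarrow> (nat \<Rightarrow> rat) ring" where
  "padic_cauchy_ring p =
     \<lparr>carrier = {s. padic_cauchy p s},
      mult = (\<lambda>s t n. s n * t n), one = (\<lambda>n. 1),
      zero = (\<lambda>n. 0), add = (\<lambda>s t n. s n + t n)\<rparr>"

definition padic_null :: "nat \<Rightarrow> (nat \<Rightarrow> rat) set" where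
  "padic_null p = {s. (\<lambda>n. padic_abs p (s n)) \<longlonglongrightarrow> 0}"

text \<open>The field of \<open>p\<close>-adic numbers as the completion of the rationals: Cauchy sequences
  modulo null sequences.\<close>

definition Qp :: "nat \<Rightarrow> (nat \<Rightarrow> rat) set ring" where
  "Qp p = padic_cauchy_ring p Quot padic_null p"

definition is_finite_extension_of :: "'k::field itself \<Rightarrow> ('f, 'm) ring_scheme \<Rightarrow> bool" where
  "is_finite_extension_of _ F \<longleftrightarrow>
     (\<exists>\<iota> \<in> ring_hom F (ring_of_type_algebra :: 'k ring).
        ring.finite_dimension (ring_of_type_algebra :: 'k ring) (\<iota> ` carrier F) UNIV)"

definition number_field :: "'k::field itself \<Rightarrow> bool" where
  "number_field K \<longleftrightarrow> is_finite_extension_of K (ring_of_type_algebra :: rat ring)"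

definition GL :: "('a::field ^ 'n ^ 'n) monoid" where
  "GL = \<lparr>carrier = {A. invertible A}, mult = (**), one = mat 1\<rparr>"

text \<open>The polynomial ring in the variables \<open>'v\<close> over \<open>'a\<close>, with the convolution product of
  \<open>Poly_Mapping\<close>; a monomial is the finitely supported function of its exponents.\<close>

type_synonym ('v, 'a) polynomials = "('v \<Rightarrow>\<^sub>0 nat) \<Rightarrow>\<^sub>0 'a"

definition eval_poly :: "('v, 'a::comm_ring_1) polynomials \<Rightarrow> ('v \<Rightarrow> 'a) \<Rightarrow> 'a" where
  "eval_poly f x = (\<Sum>m\<in>Poly_Mapping.keys f. Poly_Mapping.lookup f m *
     (\<Prod>v\<in>Poly_Mapping.keys m. x v ^ Poly_Mapping.lookup m v))"

definition vanishes_at :: "('n \<times> 'n, 'a::field) polynomials \<Rightarrow> 'a ^ 'n ^ 'n \<Rightarrow> bool" where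
  "vanishes_at f A \<longleftrightarrow> eval_poly f (\<lambda>(i, j). A $ i $ j) = 0"

definition vanishing_ideal :: "('a::field ^ 'n ^ 'n) set \<Rightarrow> ('n \<times> 'n, 'a) polynomials set" where
  "vanishing_ideal G = {f. \<forall>A\<in>G. vanishes_at f A}"

definition zariski_closed_in_GL :: "('a::field ^ 'n ^ 'n) set \<Rightarrow> bool" where
  "zariski_closed_in_GL G \<longleftrightarrow> (\<exists>S. G = {A \<in> carrier GL. \<forall>f\<in>S. vanishes_at f A})"

text \<open>\<open>module.span (*) S\<close> is the ideal generated by \<open>S\<close>: the span of \<open>S\<close> in the polynomial
  ring regarded as a module over itself.\<close>

definition defined_over_base :: "('k::field alg_closure ^ 'n ^ 'n) set \<Rightarrow> bool" where
  "defined_over_base G \<longleftrightarrow>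
     (\<exists>S. (\<forall>f\<in>S. \<forall>m. Poly_Mapping.lookup f m \<in> range (to_ac :: 'k \<Rightarrow> 'k alg_closure)) \<and>
          vanishing_ideal G = module.span (*) S)"

text \<open>Linear algebraic groups over \<open>'k\<close> are given by their points over the algebraic closure.\<close>

definition linear_algebraic_group :: "('k::field alg_closure ^ 'n ^ 'n) set \<Rightarrow> bool" where
  "linear_algebraic_group G \<longleftrightarrow>
     subgroup G GL \<and> zariski_closed_in_GL G \<and> defined_over_base G"

definition rational_points :: "('k::field alg_closure ^ 'n ^ 'n) set \<Rightarrow> ('k ^ 'n ^ 'n) monoid" where
  "rational_points G = GL\<lparr>carrier := {A \<in> carrier GL. map_matrix to_ac A \<in> G}\<rparr>"

text \<open>Iterated directional derivatives; only used for open \<open>S\<close>.\<close>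

fun Ck_on :: "nat \<Rightarrow> 'a::real_normed_vector set \<Rightarrow> ('a \<Rightarrow> 'b::real_normed_vector) \<Rightarrow> bool" where
  "Ck_on 0 S f \<longleftrightarrow> continuous_on S f"
| "Ck_on (Suc k) S f \<longleftrightarrow>
     (\<forall>x\<in>S. f differentiable (at x)) \<and> (\<forall>v. Ck_on k S (\<lambda>x. frechet_derivative f (at x) v))"

definition smooth_on :: "'a::real_normed_vector set \<Rightarrow> ('a \<Rightarrow> 'b::real_normed_vector) \<Rightarrow> bool" where
  "smooth_on S f \<longleftrightarrow> (\<forall>k. Ck_on k S f)"

text \<open>A chart is a pair of its domain and the coordinate map; the latter is only meaningful on
  the domain.\<close>

type_synonym ('h, 'e) chart = "'h set \<times> ('h \<Rightarrow> 'e)"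

definition chart_inv :: "('h, 'e) chart \<Rightarrow> 'e \<Rightarrow> 'h" where
  "chart_inv c = inv_into (fst c) (snd c)"

definition is_chart :: "'h topology \<Rightarrow> ('h, 'e::euclidean_space) chart \<Rightarrow> bool" where
  "is_chart T c \<longleftrightarrow> openin T (fst c) \<and> open (snd c ` fst c) \<and>
     homeomorphic_map (subtopology T (fst c)) (top_of_set (snd c ` fst c)) (snd c)"

definition smooth_atlas :: "'h topology \<Rightarrow> ('h, 'e::euclidean_space) chart set \<Rightarrow> bool" where
  "smooth_atlas T \<A> \<longleftrightarrow>
     (\<forall>c\<in>\<A>. is_chart T c) \<and> (\<Union>c\<in>\<A>. fst c) = topspace T \<and>
     (\<forall>c\<in>\<A>. \<forall>d\<in>\<A>. smooth_on (snd c ` (fst c \<inter> fst d)) (snd d \<circ> chart_inv c))"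

text \<open>The smooth structure is the one determined by the (not necessarily maximal) atlas. Every
  type of class \<open>euclidean_space\<close> has positive dimension, so manifolds of dimension zero, i.e.
  discrete spaces, are represented separately, by the empty atlas.\<close>

definition smooth_manifold :: "'h topology \<Rightarrow> ('h, 'e::euclidean_space) chart set \<Rightarrow> bool" where
  "smooth_manifold T \<A> \<longleftrightarrow>
     Hausdorff_space T \<and> second_countable T \<and>
     (smooth_atlas T \<A> \<or> T = discrete_topology (topspace T) \<and> \<A> = {})"

definition lie_group ::
  "('h, 'm) monoid_scheme \<Rightarrow> 'h topology \<Rightarrow> ('h, 'e::euclidean_space) chart set \<Rightarrow> bool" where
  "lie_group H T \<A> \<longleftrightarrow>
     group H \<and> topspace T = carrier H \<and> smooth_manifold T \<A> \<and>
     continuous_map (prod_topology T T) T (\<lambda>(x, y). x \<otimes>\<^bsub>H\<^esub> y) \<and>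
     continuous_map T T (\<lambda>x. inv\<^bsub>H\<^esub> x) \<and>
     (\<forall>a\<in>\<A>. \<forall>b\<in>\<A>. \<forall>c\<in>\<A>.
        smooth_on {(x, y). x \<in> snd a ` fst a \<and> y \<in> snd b ` fst b \<and>
                           chart_inv a x \<otimes>\<^bsub>H\<^esub> chart_inv b y \<in> fst c}
          (\<lambda>(x, y). snd c (chart_inv a x \<otimes>\<^bsub>H\<^esub> chart_inv b y))) \<and>
     (\<forall>a\<in>\<A>. \<forall>c\<in>\<A>.
        smooth_on {x. x \<in> snd a ` fst a \<and> inv\<^bsub>H\<^esub> (chart_inv a x) \<in> fst c}
          (\<lambda>x. snd c (inv\<^bsub>H\<^esub> (chart_inv a x))))"

text \<open>A chart \<open>c\<close> around the identity identifies the tangent space there with \<open>'e\<close>.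
  In these coordinates \<open>Ad\<close> is the differential of conjugation at the identity, and the Lie
  bracket is \<open>[u, v] = ad u v\<close>, where \<open>ad\<close> is the differential of \<open>Ad\<close> at the identity.\<close>

definition lie_Ad ::
  "('h, 'm) monoid_scheme \<Rightarrow> ('h, 'e::euclidean_space) chart \<Rightarrow> 'h \<Rightarrow> 'e \<Rightarrow> 'e" where
  "lie_Ad H c g =
     frechet_derivative (\<lambda>x. snd c (g \<otimes>\<^bsub>H\<^esub> chart_inv c x \<otimes>\<^bsub>H\<^esub> inv\<^bsub>H\<^esub> g)) (at (snd c \<one>\<^bsub>H\<^esub>))"

definition lie_bracket ::
  "('h, 'm) monoid_scheme \<Rightarrow> ('h, 'e::euclidean_space) chart \<Rightarrow> 'e \<Rightarrow> 'e \<Rightarrow> 'e" where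
  "lie_bracket H c u v =
     frechet_derivative (\<lambda>x. lie_Ad H c (chart_inv c x) v) (at (snd c \<one>\<^bsub>H\<^esub>)) u"

definition lie_ideal :: "('e::real_vector \<Rightarrow> 'e \<Rightarrow> 'e) \<Rightarrow> 'e set \<Rightarrow> bool" where
  "lie_ideal br I \<longleftrightarrow> subspace I \<and> (\<forall>x. \<forall>y\<in>I. br x y \<in> I)"

definition lie_derived :: "('e::real_vector \<Rightarrow> 'e \<Rightarrow> 'e) \<Rightarrow> 'e set \<Rightarrow> 'e set" where
  "lie_derived br I = span {br x y | x y. x \<in> I \<and> y \<in> I}"

definition lie_solvable :: "('e::real_vector \<Rightarrow> 'e \<Rightarrow> 'e) \<Rightarrow> 'e set \<Rightarrow> bool" where
  "lie_solvable br I \<longleftrightarrow> (\<exists>n. (lie_derived br ^^ n) I = {0})"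

definition semisimple_lie_algebra :: "('e::real_vector \<Rightarrow> 'e \<Rightarrow> 'e) \<Rightarrow> bool" where
  "semisimple_lie_algebra br \<longleftrightarrow> (\<forall>I. lie_ideal br I \<and> lie_solvable br I \<longrightarrow> I = {0})"

text \<open>Up to isomorphism the Lie algebra does not depend on the chart \<open>c\<close>. For the empty atlas
  the Lie algebra is zero, hence semisimple.\<close>

definition semisimple_lie_group ::
  "('h, 'm) monoid_scheme \<Rightarrow> ('h, 'e::euclidean_space) chart set \<Rightarrow> bool" where
  "semisimple_lie_group H \<A> \<longleftrightarrow>
     (\<forall>c\<in>\<A>. \<one>\<^bsub>H\<^esub> \<in> fst c \<longrightarrow> semisimple_lie_algebra (lie_bracket H c))"

definition perfect_group :: "('h, 'm) monoid_scheme \<Rightarrow> bool" where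
  "perfect_group H \<longleftrightarrow> derived H (carrier H) = carrier H"

end

theory Submission
  imports Defs "HOL-Computational_Algebra.Fundamental_Theorem_Algebra"
begin

text \<open>The topology of a real Lie group makes its small elements divisible, whereas an invertible
  matrix over a number field or a \<open>p\<close>-adic field that has an infinite sequence of iterated
  roots of a suitable order is unipotent. This contrast restricts homomorphisms regardless
  of continuity. Let \<open>\<phi>\<close> be a representation of \<open>H\<close> by \<open>n \<times> n\<close> matrices over the field \<open>\<K>\<close>,
  and let \<open>m\<close> be at least two. In a chart, the map \<open>x \<mapsto> x\<^sup>m\<close> has the derivative \<open>m\<close> at the
  identity. By Brouwer's fixed point theorem every element of some neighbourhood of the
  identity therefore has an \<open>m\<close>-th root in the same neighbourhood, and hence an infinite
  sequence of iterated roots (\<open>divisible_neighbourhood\<close>).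

  Since \<open>\<K>\<close> is finite over \<open>\<rat>\<close> or \<open>\<rat>\<^sub>p\<close>, the matrices contain a \<open>p\<close>-adic lattice \<open>L\<close>
  (\<open>finite_extension_ring_lattice\<close>). Let \<open>q\<close> bound the number of residue classes modulo \<open>p\<close>,
  and take \<open>m = p q!\<close>. Let \<open>g\<close> be an invertible matrix with iterated \<open>m\<close>-th roots. By
  counting classes, a root \<open>h\<close> of sufficiently high order stabilises a lattice \<open>M\<close>, which
  depends on \<open>h\<close> (\<open>stable_lattice_exists\<close>). On \<open>M\<close>, the power \<open>h\<^bsup>q!\<^esup>\<close> is idempotent modulo
  \<open>p\<close>, and each further \<open>p\<close>-th power improves the congruence by a factor \<open>p\<close>. So \<open>y = g\<^sup>2 -
  g\<close> maps \<open>M\<close> into \<open>p\<^sup>j M\<close>, with arbitrarily large \<open>j\<close> for suitable \<open>M\<close>. The powers of \<open>y\<close>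
  thus decay faster than any exponential, which for a matrix means that \<open>y\<close> is nilpotent; so
  \<open>g\<close> is unipotent (\<open>divisible_imp_unipotent\<close>). Consequently \<open>\<phi>\<close> has the constant trace \<open>n\<close>
  near the identity.

  A connected group is generated by every neighbourhood of the identity. Therefore the linear
  span of \<open>\<phi>(H)\<close>, which is an algebra, is already spanned by the images of arbitrarily small
  elements (\<open>local_span_is_global\<close>), and the constancy of the trace puts all \<open>\<phi>(h) - 1\<close> into
  the radical of its trace form. In characteristic zero it follows that the augmentation
  ideal \<open>J\<close> spanned by them consists of nilpotent matrices (\<open>augmentation_nil\<close>). If \<open>H\<close> is
  perfect, then \<open>J\<close> equals its square, because the image of a commutator is congruent to one
  modulo \<open>J\<^sup>2\<close>; a nil algebra with this property is zero (\<open>perfect_imp_trivial\<close>).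

  It remains to see that a connected semisimple Lie group is perfect. The bracket in a chart
  obeys the Leibniz rule (\<open>bracket_leibniz\<close>). The squares \<open>[u, u]\<close> span an abelian ideal and
  thus vanish, and Cartan's criterion together with Engel's theorem shows that a semisimple
  Lie algebra is spanned by brackets (\<open>semisimple_imp_perfect\<close>). Brackets are limits of
  combinations of vectors \<open>Ad a w - w\<close>, which are the velocities of commutators of \<open>a\<close> with
  a curve. If these vectors span the tangent space, a product of such commutators has a
  surjective derivative, so commutators generate a neighbourhood of the identity and hence
  the group (\<open>derived_eq_carrier\<close>).\<close>

no_notation fps_nth (infixl \<open>$\<close> 75)

section \<open>Square matrices over a field\<close>

text \<open>The product of the type \<open>'a ^ 'n ^ 'n\<close> is componentwise. Matrices with the matrix product
  get a type of their own, so that they form an instance of \<open>ring_1\<close>.\<close>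
typedef ('a, 'n::finite) sqmat = "UNIV :: ('a ^ 'n ^ 'n) set"
  morphisms matrix_of sqmat_of ..

setup_lifting type_definition_sqmat

instantiation sqmat :: (comm_ring_1, finite) ring_1
begin
lift_definition zero_sqmat :: "('a, 'b) sqmat" is 0 .
lift_definition one_sqmat :: "('a, 'b) sqmat" is "mat 1" .
lift_definition plus_sqmat :: "('a, 'b) sqmat \<Rightarrow> ('a, 'b) sqmat \<Rightarrow> ('a, 'b) sqmat" is "(+)" .
lift_definition minus_sqmat :: "('a, 'b) sqmat \<Rightarrow> ('a, 'b) sqmat \<Rightarrow> ('a, 'b) sqmat" is "(-)" .
lift_definition uminus_sqmat :: "('a, 'b) sqmat \<Rightarrow> ('a, 'b) sqmat" is uminus .
lift_definition times_sqmat :: "('a, 'b) sqmat \<Rightarrow> ('a, 'b) sqmat \<Rightarrow> ('a, 'b) sqmat" is "(**)" .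
instance
proof
  fix a b c :: "('a, 'b) sqmat"
  show "a * b * c = a * (b * c)" by transfer (simp add: matrix_mul_assoc)
  show "1 * a = a" by transfer (rule matrix_mul_lid)
  show "a * 1 = a" by transfer (rule matrix_mul_rid)
  show "(a + b) * c = a * c + b * c"
    by transfer (simp add: matrix_matrix_mult_def vec_eq_iff sum.distrib distrib_right)
  show "a * (b + c) = a * b + a * c"
    by transfer (simp add: matrix_matrix_mult_def vec_eq_iff sum.distrib distrib_left)
  show "(0::('a, 'b) sqmat) \<noteq> 1" by transfer (simp add: vec_eq_iff mat_def)
qed (transfer, simp)+
end

lift_definition sq_scale :: "'a::comm_ring_1 \<Rightarrow> ('a, 'n::finite) sqmat \<Rightarrow> ('a, 'n) sqmat"
  is "\<lambda>c A. \<chi> i j. c * A $ i $ j" .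

lift_definition sq_trace :: "('a::comm_ring_1, 'n::finite) sqmat \<Rightarrow> 'a" is trace .

lift_definition sq_unit :: "'n::finite \<Rightarrow> 'n \<Rightarrow> ('a::comm_ring_1, 'n) sqmat"
  is "\<lambda>i j. \<chi> k l. if k = i \<and> l = j then 1 else 0" .

lift_definition sq_entry :: "('a::comm_ring_1, 'n::finite) sqmat \<Rightarrow> 'n \<Rightarrow> 'n \<Rightarrow> 'a"
  is "\<lambda>A i j. A $ i $ j" .

lemma sq_eqI: "(\<And>i j. sq_entry A i j = sq_entry B i j) \<Longrightarrow> A = B"
  by transfer (simp add: vec_eq_iff)

lemma sq_entry_simps [simp]:
  "sq_entry 0 i j = 0" "sq_entry (A + B) i j = sq_entry A i j + sq_entry B i j"
  "sq_entry (A - B) i j = sq_entry A i j - sq_entry B i j"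
  "sq_entry (sq_scale c A) i j = c * sq_entry A i j"
  "sq_entry (sq_unit k l) i j = (if i = k \<and> j = l then 1 else 0)"
  "sq_entry 1 i j = (if i = j then 1 else 0)"
  by (transfer; simp add: mat_def)+

lemma sq_entry_sum [simp]: "sq_entry (sum f I) i j = (\<Sum>x\<in>I. sq_entry (f x) i j)"
  by (induction I rule: infinite_finite_induct) auto

lemma sq_entry_mult: "sq_entry (A * B) i j = (\<Sum>k\<in>UNIV. sq_entry A i k * sq_entry B k j)"
  by transfer (simp add: matrix_matrix_mult_def)

lemma sq_trace_entries: "sq_trace A = (\<Sum>i\<in>UNIV. sq_entry A i i)"
  by transfer (simp add: trace_def)

lemma sq_scale_mult [simp]: "sq_scale c A * B = sq_scale c (A * B)" "A * sq_scale c B = sq_scale c (A * B)"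
  by (rule sq_eqI, simp add: sq_entry_mult sum_distrib_left mult_ac)+

lemma sq_trace_simps [simp]: "sq_trace 0 = 0" "sq_trace (A + B) = sq_trace A + sq_trace B"
  "sq_trace (A - B) = sq_trace A - sq_trace B" "sq_trace (sq_scale c A) = c * sq_trace A"
  by (simp_all add: sq_trace_entries sum.distrib sum_subtractf sum_distrib_left)

lemma sq_trace_sum: "sq_trace (sum f I) = (\<Sum>x\<in>I. sq_trace (f x))"
  by (induction I rule: infinite_finite_induct) auto

lemma sq_trace_commute: "sq_trace (A * B) = sq_trace (B * A)"
  by transfer (rule trace_mul_sym)

lemma sq_vector_space: "vector_space (sq_scale :: 'a::field \<Rightarrow> ('a, 'n::finite) sqmat \<Rightarrow> _)"
  by unfold_locales (auto intro!: sq_eqI simp: algebra_simps)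

global_interpretation sq: finite_dimensional_vector_space
  "sq_scale :: 'a::field \<Rightarrow> ('a, 'n::finite) sqmat \<Rightarrow> _" "range (\<lambda>(i, j). sq_unit i j)"
proof -
  interpret vector_space "sq_scale :: 'a \<Rightarrow> ('a, 'n) sqmat \<Rightarrow> _" by (rule sq_vector_space)
  let ?B = "range (\<lambda>(i, j). sq_unit i j) :: ('a, 'n) sqmat set"
  have inj: "inj (\<lambda>(i, j). sq_unit i j :: ('a, 'n) sqmat)"
  proof (rule injI, clarify)
    fix i j k l :: 'n assume "(sq_unit i j :: ('a, 'n) sqmat) = sq_unit k l"
    then have "sq_entry (sq_unit i j :: ('a, 'n) sqmat) i j = sq_entry (sq_unit k l) i j" by simp
    then show "i = k \<and> j = l" by (simp split: if_splits)
  qed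
  have expand: "A = (\<Sum>x\<in>UNIV. sq_scale (sq_entry A (fst x) (snd x)) (sq_unit (fst x) (snd x)))"
    for A :: "('a, 'n) sqmat"
  proof (rule sq_eqI)
    fix i j
    have "(\<Sum>x\<in>UNIV. sq_entry A (fst x) (snd x) * (if i = fst x \<and> j = snd x then 1 else 0))
        = (\<Sum>x\<in>UNIV. if x = (i, j) then sq_entry A i j else 0)"
      by (rule sum.cong) auto
    then show "sq_entry A i j = sq_entry (\<Sum>x\<in>UNIV. sq_scale (sq_entry A (fst x) (snd x)) (sq_unit (fst x) (snd x))) i j"
      by simp
  qed
  have ind: "independent ?B"
  proof
    assume "dependent ?B"
    then obtain u where u: "\<exists>v\<in>?B. u v \<noteq> 0" "(\<Sum>v\<in>?B. sq_scale (u v) v) = 0"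
      using dependent_finite[of ?B] by auto
    then obtain i j where ij: "u (sq_unit i j) \<noteq> 0" by auto
    have "(\<Sum>v\<in>?B. sq_scale (u v) v) = (\<Sum>x\<in>UNIV. sq_scale (u (sq_unit (fst x) (snd x))) (sq_unit (fst x) (snd x)))"
      by (subst sum.reindex[OF inj]) (simp add: case_prod_beta)
    then have "0 = sq_entry (\<Sum>x\<in>UNIV. sq_scale (u (sq_unit (fst x) (snd x))) (sq_unit (fst x) (snd x) :: ('a, 'n) sqmat)) i j"
      using u by simp
    also have "\<dots> = (\<Sum>x\<in>UNIV. if x = (i, j) then u (sq_unit i j) else 0)"
      unfolding sq_entry_sum by (rule sum.cong) auto
    finally have "0 = u (sq_unit i j)" by simp
    then show False using ij by simp
  qed
  have sp: "span ?B = UNIV"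
  proof (intro equalityI subset_UNIV subsetI)
    fix A :: "('a, 'n) sqmat"
    show "A \<in> span ?B" by (subst expand) (intro span_sum span_scale span_base, auto)
  qed
  show "finite_dimensional_vector_space (sq_scale :: 'a \<Rightarrow> ('a, 'n) sqmat \<Rightarrow> _) ?B"
    by unfold_locales (auto simp: ind sp)
qed

section \<open>Traces of idempotent and nilpotent matrices\<close>

text \<open>With respect to the basis \<open>B\<close> the diagonal entries of \<open>A\<close> are the \<open>c b\<close>, and the trace is
  invariant under conjugation.\<close>
lemma trace_via_basis:
  fixes A :: "'a::field ^ 'n ^ 'n"
  assumes B: "vec.independent B" "vec.span B = UNIV"
    and c: "\<And>b. b \<in> B \<Longrightarrow> A *v b - c b *s b \<in> vec.span (B - {b})"
  shows "trace A = (\<Sum>b\<in>B. c b)"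
proof -
  have finB: "finite B" using vec.independent_bound_general[OF B(1)] by blast
  have "card B = vec.dim (UNIV :: ('a ^ 'n) set)"
    using vec.dim_eq_card[OF _ B(1), of UNIV] B(2) by simp
  then have "card B = CARD('n)" using vec_dim_card by metis
  then obtain f where f: "bij_betw f (UNIV :: 'n set) B"
    using finite_same_card_bij[OF finite_class.finite_UNIV finB] by metis
  define P :: "'a ^ 'n ^ 'n" where "P = (\<chi> i j. f j $ i)"
  have col: "column j P = f j" for j by (simp add: column_def P_def vec_eq_iff)
  then have "columns P = B" using f by (auto simp: columns_def bij_betw_def)
  then obtain Q where PQ: "P ** Q = mat 1" using matrix_right_invertible_span_columns[of P] B by auto
  then have QP: "Q ** P = mat 1" using matrix_left_right_inverse by blast
  define M where "M = Q ** (A ** P)"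
  have AP: "A ** P = P ** M" by (simp add: M_def matrix_mul_assoc PQ)
  have Af: "A *v f j = (\<Sum>i\<in>UNIV. M $ i $ j *s f i)" for j
  proof -
    have "A *v f j = column j (A ** P)"
      by (simp add: col[symmetric] column_def matrix_matrix_mult_def matrix_vector_mult_def vec_eq_iff)
    also have "\<dots> = (\<Sum>i\<in>UNIV. M $ i $ j *s f i)"
      unfolding AP by (simp add: column_def matrix_matrix_mult_def vec_eq_iff P_def mult.commute)
    finally show ?thesis .
  qed
  have injf: "inj f" and fB: "f j \<in> B" for j using f by (auto simp: bij_betw_def)
  have diag: "M $ j $ j = c (f j)" for j
  proof (rule ccontr)
    assume ne: "M $ j $ j \<noteq> c (f j)"
    have "(\<Sum>i\<in>UNIV - {j}. M $ i $ j *s f i) \<in> vec.span (B - {f j})"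
      using injf fB by (intro vec.span_sum vec.span_scale vec.span_base) (auto dest: injD)
    moreover have "A *v f j = M $ j $ j *s f j + (\<Sum>i\<in>UNIV - {j}. M $ i $ j *s f i)"
      unfolding Af by (subst sum.remove[of _ j]) auto
    ultimately have "(M $ j $ j - c (f j)) *s f j \<in> vec.span (B - {f j})"
      using vec.span_diff[OF c[OF fB] ] by (fastforce simp: algebra_simps)
    from vec.span_scale[OF this, of "inverse (M $ j $ j - c (f j))"]
    have "f j \<in> vec.span (B - {f j})" using ne by (simp only: vec.scale_scale) simp
    then show False using B(1) fB by (auto simp: vec.dependent_def)
  qed
  have "trace A = trace (A ** (P ** Q))" by (simp add: PQ)
  also have "\<dots> = trace M" by (simp add: M_def matrix_mul_assoc[symmetric] trace_mul_sym[of Q])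
  also have "\<dots> = (\<Sum>j\<in>UNIV. c (f j))" by (simp add: trace_def diag)
  also have "\<dots> = (\<Sum>b\<in>B. c b)" using f by (rule sum.reindex_bij_betw)
  finally show ?thesis .
qed

text \<open>In a basis of the image, extended to a basis of the whole space, the diagonal entries of a
  projection are one on the image and zero elsewhere. So the trace is the rank, as an
  element of the field.\<close>
lemma trace_idempotent:
  fixes E :: "'a::field ^ 'n ^ 'n"
  assumes E: "E ** E = E"
  shows "\<exists>r::nat. trace E = of_nat r \<and> (E \<noteq> 0 \<longrightarrow> r > 0)"
proof -
  obtain B1 where B1: "B1 \<subseteq> range ((*v) E)" "vec.independent B1" "range ((*v) E) \<subseteq> vec.span B1"
    by (rule vec.basis_exists[of "range ((*v) E)"])
  obtain B where B: "B1 \<subseteq> B" "vec.independent B" "UNIV \<subseteq> vec.span B"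
    by (rule vec.maximal_independent_subset_extend[OF subset_UNIV B1(2)])
  then have B: "B1 \<subseteq> B" "vec.independent B" "vec.span B = UNIV" by (simp_all add: top.extremum_unique)
  have finB: "finite B" using vec.independent_bound_general[OF B(2)] by blast
  define c :: "'a ^ 'n \<Rightarrow> 'a" where "c b = (if b \<in> B1 then 1 else 0)" for b
  have "E *v b - c b *s b \<in> vec.span (B - {b})" if b: "b \<in> B" for b
  proof (cases "b \<in> B1")
    case True
    then obtain v where "b = E *v v" using B1 by blast
    then have "E *v b = b" by (simp add: matrix_vector_mul_assoc E)
    then show ?thesis using True by (simp add: c_def vec.span_zero)
  next
    case False
    have "E *v b \<in> vec.span B1" using B1 by blast
    moreover have "B1 \<subseteq> B - {b}" using B(1) False by blast
    ultimately show ?thesis using False vec.span_mono by (auto simp: c_def)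
  qed
  from trace_via_basis[OF B(2,3) this] have "trace E = (\<Sum>b\<in>B. c b)" .
  also have "\<dots> = (\<Sum>b\<in>B1. 1)"
    unfolding c_def using B(1) finB by (subst sum.inter_restrict[symmetric]) (auto simp: Int_absorb1)
  finally have "trace E = of_nat (card B1)" by simp
  moreover have "card B1 > 0" if "E \<noteq> 0"
  proof -
    have "B1 \<noteq> {}"
    proof
      assume "B1 = {}"
      then have z: "E *v v = 0" for v using B1(3) by auto
      have "E = 0"
      proof -
        have "E $ i $ j = 0" for i j
          using arg_cong[OF z[of "axis j 1"], of "\<lambda>v. v $ i"]
          by (simp add: matrix_vector_mult_def axis_def if_distrib[of "(*) _"] cong: if_cong)
        then show ?thesis by (simp add: vec_eq_iff)
      qed
      with that show False by simp
    qed
    then show ?thesis using finB B(1) by (simp add: card_gt_0_iff finite_subset)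
  qed
  ultimately show ?thesis by blast
qed

text \<open>The basis is built from the image of the highest power of \<open>A\<close> downwards. Since \<open>A\<close> maps the
  image of a power into the image of the next one, it maps each new vector into the span of
  the vectors that were chosen before.\<close>
lemma nilpotent_adapted_basis:
  fixes A :: "'a::field ^ 'n ^ 'n"
  assumes nil: "\<And>v. ((*v) A ^^ k) v = 0"
  shows "\<exists>B. vec.independent B \<and> vec.span B = UNIV \<and> (\<forall>b\<in>B. A *v b \<in> vec.span (B - {b}))"
proof -
  let ?R = "\<lambda>i. range ((*v) A ^^ i)"
  have "\<exists>B. vec.independent B \<and> vec.span B = ?R (k - i) \<and> (\<forall>b\<in>B. A *v b \<in> vec.span (B - {b}))"
    if "i \<le> k" for i using that
  proof (induction i)
    case 0
    have "?R k = {0}" using nil by auto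
    then show ?case by (intro exI[of _ "{}"]) (auto simp: vec.dependent_def)
  next
    case (Suc i)
    then obtain B where B: "vec.independent B" "vec.span B = ?R (k - i)"
      "\<And>b. b \<in> B \<Longrightarrow> A *v b \<in> vec.span (B - {b})" by auto
    define j where "j = k - Suc i"
    have j: "k - i = Suc j" using Suc.prems by (simp add: j_def)
    have lin: "Vector_Spaces.linear (*s) (*s) ((*v) A ^^ j)"
    proof (induction j)
      case 0
      show ?case using vec.linear_id by (simp add: id_def)
    next
      case (Suc j)
      then show ?case
        using Vector_Spaces.linear_compose[OF Suc matrix_vector_mul_linear_gen[of A]] by (simp add: o_def)
    qed
    have sub: "vec.subspace (?R j)"
      using vec.linear_subspace_image[OF lin vec.subspace_UNIV] .
    have step: "A *v x \<in> vec.span B" if "x \<in> ?R j" for x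
      using that unfolding B(2) j by auto
    have le: "vec.span B \<subseteq> ?R j"
      unfolding B(2) j using funpow_swap1[of "(*v) A" j] by (auto simp del: funpow.simps simp: funpow_Suc_right)
    have "B \<subseteq> ?R j" using le vec.span_superset[of B] by (rule subset_trans[rotated])
    then obtain B' where B': "B \<subseteq> B'" "B' \<subseteq> ?R j" "vec.independent B'" "?R j \<subseteq> vec.span B'"
      by (rule vec.maximal_independent_subset_extend[OF _ B(1)])
    have "vec.span B' = ?R j" using vec.span_minimal[OF B'(2) sub] B'(4) by (rule subset_antisym)
    moreover have "A *v b \<in> vec.span (B' - {b})" if "b \<in> B'" for b
    proof (cases "b \<in> B")
      case True
      then show ?thesis using B(3) vec.span_mono[of "B - {b}" "B' - {b}"] B'(1) by blast
    next
      case False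
      then have "B \<subseteq> B' - {b}" using B'(1) by blast
      then show ?thesis using step[of b] vec.span_mono that B'(2) by blast
    qed
    ultimately show ?case using B'(3) unfolding j_def[symmetric] by blast
  qed
  from this[of k] show ?thesis by simp
qed

lemma sq_idempotent_trace:
  fixes e :: "('a::field, 'n::finite) sqmat"
  assumes "e * e = e"
  shows "\<exists>r::nat. sq_trace e = of_nat r \<and> (e \<noteq> 0 \<longrightarrow> r > 0)"
  using assms by transfer (rule trace_idempotent)

lemma sq_power_apply: "matrix_of (x ^ k) *v v = ((*v) (matrix_of x) ^^ k) v"
  by (induction k arbitrary: v)
    (auto simp: one_sqmat.rep_eq times_sqmat.rep_eq matrix_vector_mul_assoc[symmetric])

lemma sq_nilpotent_trace:
  fixes x :: "('a::field, 'n::finite) sqmat"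
  assumes "x ^ k = 0"
  shows "sq_trace x = 0"
proof -
  have "((*v) (matrix_of x) ^^ k) v = 0" for v
    using sq_power_apply[of x k v] assms by (simp add: zero_sqmat.rep_eq)
  from nilpotent_adapted_basis[OF this] obtain B where
    B: "vec.independent B" "vec.span B = UNIV" "\<And>b. b \<in> B \<Longrightarrow> matrix_of x *v b \<in> vec.span (B - {b})" by blast
  have "trace (matrix_of x) = (\<Sum>b\<in>B. 0)"
    by (rule trace_via_basis[OF B(1,2)]) (use B(3) in simp)
  then show ?thesis by (simp add: sq_trace.rep_eq)
qed

section \<open>Fitting idempotents and nil algebras of matrices\<close>

text \<open>The powers of \<open>y\<close> satisfy a linear relation, and such a relation can be solved for the
  lowest power that occurs in it.\<close>
lemma sq_power_eventually_divisible:
  fixes y :: "('a::field, 'n::finite) sqmat"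
  shows "\<exists>a>0. \<exists>w. y ^ a = y ^ Suc a * w \<and> w \<in> sq.span (range ((^) y))"
proof -
  have "\<exists>a w. y ^ a = y ^ Suc a * w \<and> w \<in> sq.span (range ((^) y))"
  proof (cases "inj ((^) y)")
    case False
    then obtain i j where ij: "i < j" "y ^ i = y ^ j" by (metis injI nat_neq_iff)
    then have "y ^ i = y ^ Suc i * y ^ (j - Suc i)" by (simp add: power_add[symmetric] del: power_Suc)
    then show ?thesis by (intro exI[of _ i] exI[of _ "y ^ (j - Suc i)"]) (auto intro: sq.span_base)
  next
    case True
    have "infinite (range ((^) y))" using True finite_imageD by blast
    then have "sq.dependent (range ((^) y))" using sq.independent_bound_general by blast
    then obtain S u v where S: "finite S" "S \<subseteq> range ((^) y)" "(\<Sum>x\<in>S. sq_scale (u x) x) = 0"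
      "v \<in> S" "u v \<noteq> 0" unfolding sq.dependent_explicit by blast
    define I where "I = {i. y ^ i \<in> S \<and> u (y ^ i) \<noteq> 0}"
    have "finite I" unfolding I_def using finite_vimageI[OF S(1) True] by (rule finite_subset[rotated]) auto
    moreover have "I \<noteq> {}" using S by (auto simp: I_def)
    ultimately have a: "Min I \<in> I" "\<And>i. i \<in> I \<Longrightarrow> Min I \<le> i" by auto
    define a where "a = Min I"
    define c where "c i = u (y ^ i)" for i
    have "0 = (\<Sum>x\<in>(^) y ` I. sq_scale (u x) x)"
      unfolding S(3)[symmetric] by (rule sum.mono_neutral_right) (use S(1,2) in \<open>auto simp: I_def\<close>)
    also have "\<dots> = (\<Sum>i\<in>I. sq_scale (c i) (y ^ i))"
      using True by (subst sum.reindex) (auto simp: c_def inj_on_def)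
    also have "\<dots> = sq_scale (c a) (y ^ a) + (\<Sum>i\<in>I - {a}. sq_scale (c i) (y ^ i))"
      using \<open>finite I\<close> a by (subst sum.remove[of _ a]) (auto simp: a_def)
    also have "(\<Sum>i\<in>I - {a}. sq_scale (c i) (y ^ i)) = y ^ Suc a * (\<Sum>i\<in>I - {a}. sq_scale (c i) (y ^ (i - Suc a)))"
      unfolding sum_distrib_left
    proof (rule sum.cong[OF refl])
      fix i assume "i \<in> I - {a}"
      then have "i = Suc a + (i - Suc a)" using a(2)[of i] by (auto simp: a_def)
      then have "y ^ i = y ^ Suc a * y ^ (i - Suc a)" by (metis power_add)
      then show "sq_scale (c i) (y ^ i) = y ^ Suc a * sq_scale (c i) (y ^ (i - Suc a))" by simp
    qed
    finally have rel: "sq_scale (c a) (y ^ a) + y ^ Suc a * (\<Sum>i\<in>I - {a}. sq_scale (c i) (y ^ (i - Suc a))) = 0"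
      (is "_ + _ * ?s = 0") by simp
    have ca: "c a \<noteq> 0" using a(1) by (simp add: a_def c_def I_def)
    have "sq_scale (c a) (y ^ a) = - (y ^ Suc a * ?s)" using rel by (simp add: eq_neg_iff_add_eq_0)
    then have "sq_scale (inverse (c a)) (sq_scale (c a) (y ^ a)) = sq_scale (inverse (c a)) (- (y ^ Suc a * ?s))"
      by simp
    then have "y ^ a = y ^ Suc a * sq_scale (- inverse (c a)) ?s" using ca by (simp del: power_Suc)
    moreover have "sq_scale (- inverse (c a)) ?s \<in> sq.span (range ((^) y))"
      by (intro sq.span_scale sq.span_sum sq.span_base) auto
    ultimately show ?thesis by blast
  qed
  then obtain a w where aw: "y ^ a = y ^ Suc a * w" "w \<in> sq.span (range ((^) y))" by blast
  have "y ^ Suc a = y ^ Suc (Suc a) * w"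
    using arg_cong[OF aw(1), of "\<lambda>z. y * z"] unfolding power_Suc mult.assoc .
  then show ?thesis using aw(2) by blast
qed

lemma sq_span_powers_commute:
  fixes y z :: "('a::field, 'n::finite) sqmat"
  assumes "w \<in> sq.span (range ((^) y))" and "y * z = z * y"
  shows "w * z = z * w"
  using assms(1)
proof (induction rule: sq.span_induct_alt)
  case (step c x w)
  then obtain k where "x = y ^ k" by auto
  then have "x * z = z * x" using power_commuting_commutes[OF assms(2)] by simp
  then show ?case using step by (simp add: distrib_left distrib_right)
qed auto

text \<open>The projection onto the eventual image of \<open>y\<close>, on which \<open>w\<close> inverts \<open>y\<close>.\<close>
lemma sq_power_idempotent:
  fixes y :: "('a::field, 'n::finite) sqmat"
  obtains a w where "a > 0" "w \<in> sq.span (range ((^) y))"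
    "(y ^ a * w ^ a) * (y ^ a * w ^ a) = y ^ a * w ^ a" "(y ^ a * w ^ a) * y ^ a = y ^ a"
proof -
  obtain a w where aw: "a > 0" "y ^ a = y ^ Suc a * w" "w \<in> sq.span (range ((^) y))"
    using sq_power_eventually_divisible[of y] by blast
  have comm: "w * y = y * w" by (rule sq_span_powers_commute[OF aw(3)]) simp
  have commp: "w ^ i * y ^ j = y ^ j * w ^ i" for i j
    by (metis comm power_commuting_commutes)
  have red: "y ^ a = y ^ (a + i) * w ^ i" for i
  proof (induction i)
    case (Suc i)
    have "y ^ (a + Suc i) = y ^ i * y ^ Suc a" by (metis add.commute add_Suc_shift power_add)
    then have "y ^ (a + Suc i) * w ^ Suc i = y ^ i * (y ^ Suc a * w) * w ^ i"
      by (simp only: power_Suc[of w] mult.assoc)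
    also have "\<dots> = y ^ (a + i) * w ^ i"
      unfolding aw(2)[symmetric] by (simp only: power_add[symmetric] add.commute)
    finally show ?case using Suc by simp
  qed simp
  have 1: "(y ^ a * w ^ a) * y ^ a = y ^ a"
  proof -
    have "(y ^ a * w ^ a) * y ^ a = y ^ (a + a) * w ^ a" by (simp add: mult.assoc commp power_add)
    then show ?thesis using red[of a] by simp
  qed
  then have "(y ^ a * w ^ a) * (y ^ a * w ^ a) = y ^ a * w ^ a" by (metis mult.assoc)
  then show ?thesis using that aw(1,3) 1 by blast
qed

text \<open>The projection onto the eventual image of \<open>x\<close> is a polynomial in \<open>x\<close> without constant term,
  so its trace vanishes. In characteristic zero a projection of trace zero is zero.\<close>
lemma sq_nil_of_trace_zero:
  fixes x :: "('a::field, 'n::finite) sqmat"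
  assumes char0: "\<And>r::nat. r > 0 \<Longrightarrow> of_nat r \<noteq> (0::'a)"
    and tr: "\<And>y. y \<in> sq.span (range ((^) x)) \<Longrightarrow> sq_trace (x * y) = 0"
  shows "\<exists>k. x ^ k = 0"
proof -
  obtain a w where aw: "a > 0" "w \<in> sq.span (range ((^) x))"
    "(x ^ a * w ^ a) * (x ^ a * w ^ a) = x ^ a * w ^ a" "(x ^ a * w ^ a) * x ^ a = x ^ a"
    using sq_power_idempotent[of x] by blast
  have mem: "x ^ i * w ^ j \<in> sq.span (range ((^) x))" for i j
  proof (induction j)
    case 0
    show ?case by (auto intro: sq.span_base)
  next
    case (Suc j)
    have "u * v \<in> sq.span (range ((^) x))" if "u \<in> sq.span (range ((^) x))" "v \<in> sq.span (range ((^) x))" for u v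
      using that(2)
    proof (induction rule: sq.span_induct_alt)
      case base then show ?case by (simp add: sq.span_zero)
    next
      case (step c b v)
      then obtain k where k: "b = x ^ k" by auto
      have "u * x ^ k \<in> sq.span (range ((^) x))" using that(1)
      proof (induction rule: sq.span_induct_alt)
        case base then show ?case by (simp add: sq.span_zero)
      next
        case (step c' b' u')
        then obtain l where "b' = x ^ l" by auto
        then have "b' * x ^ k = x ^ (l + k)" by (simp add: power_add)
        then have "b' * x ^ k \<in> sq.span (range ((^) x))" by (auto intro: sq.span_base)
        then show ?case unfolding distrib_right sq_scale_mult using step
          by (intro sq.span_add sq.span_scale)
      qed
      then show ?case unfolding distrib_left sq_scale_mult k using step
        by (intro sq.span_add sq.span_scale)
    qed
    then have "(x ^ i * w ^ j) * w \<in> sq.span (range ((^) x))" using Suc aw(2) by blast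
    then show ?case by (simp add: mult.assoc power_commutes)
  qed
  have "x ^ a * w ^ a = x * (x ^ (a - 1) * w ^ a)"
    using aw(1) by (cases a) (simp_all add: mult.assoc)
  then have "sq_trace (x ^ a * w ^ a) = 0" using tr mem by simp
  then have "x ^ a * w ^ a = 0" using sq_idempotent_trace[OF aw(3)] char0 by metis
  then show ?thesis using aw(4) by (metis mult_zero_left)
qed

text \<open>Let \<open>F\<close> be a maximal proper subspace of \<open>J\<close> with \<open>J F \<subseteq> F\<close>, and let \<open>v\<close> be an element of \<open>J\<close>
  outside \<open>F\<close>. Then \<open>F + J v\<close> does not contain \<open>v\<close>: from \<open>v = f + y v\<close> one obtains \<open>v \<in> F +
  y\<^sup>k v\<close> for all \<open>k\<close>, although \<open>y\<close> is nilpotent. By maximality \<open>J v \<subseteq> F\<close>. So all products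
  lie in the proper subspace \<open>F\<close>.\<close>
lemma sq_idempotent_nil_space:
  fixes J :: "('a::field, 'n::finite) sqmat set"
  assumes J: "sq.subspace J" and mult: "\<And>x y. x \<in> J \<Longrightarrow> y \<in> J \<Longrightarrow> x * y \<in> J"
    and nil: "\<And>x. x \<in> J \<Longrightarrow> \<exists>k. x ^ k = 0"
    and square: "J \<subseteq> sq.span {x * y | x y. x \<in> J \<and> y \<in> J}"
  shows "J = {0}"
proof (rule ccontr)
  assume "J \<noteq> {0}"
  define good where "good F \<longleftrightarrow> sq.subspace F \<and> F \<subseteq> J \<and> F \<noteq> J \<and> (\<forall>x\<in>J. \<forall>y\<in>F. x * y \<in> F)" for F
  have "good {0}" using \<open>J \<noteq> {0}\<close> J by (auto simp: good_def sq.subspace_0)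
  then obtain F where F: "good F" and max: "\<And>G. good G \<Longrightarrow> sq.dim G \<le> sq.dim F"
    using ex_has_greatest_nat[of good "{0}" sq.dim "Suc (sq.dim (UNIV :: ('a, 'n) sqmat set))"]
      sq.dim_subset[OF subset_UNIV] by (metis less_Suc_eq_le)
  have F': "sq.subspace F" "F \<subseteq> J" "F \<noteq> J" "\<And>x y. x \<in> J \<Longrightarrow> y \<in> F \<Longrightarrow> x * y \<in> F"
    using F by (auto simp: good_def)
  have JF: "x * v \<in> F" if x: "x \<in> J" and v: "v \<in> J" "v \<notin> F" for x v
  proof -
    let ?G = "{f + y * v | f y. f \<in> F \<and> y \<in> J}"
    have subG: "sq.subspace ?G"
      unfolding sq.subspace_def
    proof (intro conjI ballI allI)
      show "0 \<in> ?G" using F'(1) J by (force intro: exI[of _ 0] simp: sq.subspace_0)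
      fix a assume "a \<in> ?G"
      then obtain f y where a: "a = f + y * v" "f \<in> F" "y \<in> J" by blast
      show "sq_scale c a \<in> ?G" for c
      proof -
        have "sq_scale c a = sq_scale c f + sq_scale c y * v" by (simp add: a sq.scale_right_distrib)
        then show ?thesis using sq.subspace_scale[OF F'(1) a(2)] sq.subspace_scale[OF J a(3)] by blast
      qed
      fix b assume "b \<in> ?G"
      then obtain f' y' where b: "b = f' + y' * v" "f' \<in> F" "y' \<in> J" by blast
      have "a + b = (f + f') + (y + y') * v" by (simp add: a b algebra_simps)
      then show "a + b \<in> ?G" using a b F'(1) J by (blast intro: sq.subspace_add)
    qed
    have FG: "F \<subseteq> ?G"
    proof
      fix f assume "f \<in> F"
      then show "f \<in> ?G" using sq.subspace_0[OF J] by (force intro: exI[of _ f] exI[of _ 0])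
    qed
    have "v \<notin> ?G"
    proof
      assume "v \<in> ?G"
      then obtain f y where fy: "v = f + y * v" "f \<in> F" "y \<in> J" by blast
      have it: "\<exists>f'\<in>F. v = f' + y ^ k * v" for k
      proof (induction k)
        case 0 then show ?case using sq.subspace_0[OF F'(1)] by (intro bexI[of _ 0]) auto
      next
        case (Suc k)
        then obtain f' where f': "f' \<in> F" "v = f' + y ^ k * v" by blast
        have "y * v = y * f' + y ^ Suc k * v" using arg_cong[OF f'(2), of "\<lambda>z. y * z"]
          by (simp add: distrib_left mult.assoc)
        with fy(1) have "v = (f + y * f') + y ^ Suc k * v" by (simp add: add.assoc)
        moreover have "f + y * f' \<in> F" using fy f' F' by (blast intro: sq.subspace_add)
        ultimately show ?case by blast
      qed
      obtain k where "y ^ k = 0" using nil fy by blast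
      then show False using it[of k] v by auto
    qed
    then have "?G \<noteq> J" using v by blast
    moreover have "?G \<subseteq> J" using F'(2) v mult J by (blast intro: sq.subspace_add)
    moreover have "z * a \<in> ?G" if z: "z \<in> J" "a \<in> ?G" for z a
    proof -
      obtain f y where a: "a = f + y * v" "f \<in> F" "y \<in> J" using z by blast
      have "z * a = z * f + (z * y) * v" by (simp add: a distrib_left mult.assoc)
      then show ?thesis using a z F'(4) mult by blast
    qed
    ultimately have "good ?G" using subG unfolding good_def by blast
    then have "sq.dim ?G \<le> sq.dim F" by (rule max)
    then have "F = ?G" using sq.subspace_dim_equal[OF F'(1) subG FG] by simp
    moreover have "x * v \<in> ?G" using x sq.subspace_0[OF F'(1)] by (force intro: exI[of _ 0])
    ultimately show ?thesis by simp
  qed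
  have "sq.span {x * y | x y. x \<in> J \<and> y \<in> J} \<subseteq> F"
    by (rule sq.span_minimal[OF _ F'(1)]) (use JF F'(4) in blast)
  then show False using square F'(2,3) by blast
qed

section \<open>Representations of perfect groups with locally constant trace\<close>

lemma sq_span_mult:
  fixes A B :: "('a::field, 'n::finite) sqmat set"
  assumes "x \<in> sq.span A" "y \<in> sq.span B"
    and "\<And>a b. a \<in> A \<Longrightarrow> b \<in> B \<Longrightarrow> a * b \<in> S" and S: "sq.subspace S"
  shows "x * y \<in> S"
  using assms(2)
proof (induction rule: sq.span_induct_alt)
  case base
  then show ?case using sq.subspace_0[OF S] by simp
next
  case (step c b y)
  have "x * b \<in> S" using assms(1)
  proof (induction rule: sq.span_induct_alt)
    case base
    then show ?case using sq.subspace_0[OF S] by simp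
  next
    case (step c' a x)
    then show ?case unfolding distrib_right sq_scale_mult
      using assms(3) \<open>b \<in> B\<close> by (intro sq.subspace_add[OF S] sq.subspace_scale[OF S])
  qed
  then show ?case unfolding distrib_left sq_scale_mult
    using step by (intro sq.subspace_add[OF S] sq.subspace_scale[OF S])
qed

text \<open>The family \<open>\<U>\<close> stands for the neighbourhoods of the identity in a topological group.
  Connectedness enters in the form that every neighbourhood generates the group.\<close>
locale neighbourhood_representation = group H for H :: "('h, 'm) monoid_scheme" (structure) +
  fixes \<phi> :: "'h \<Rightarrow> ('k::field, 'n::finite) sqmat" and \<U> :: "'h set set"
  assumes hom_mult: "x \<in> carrier H \<Longrightarrow> y \<in> carrier H \<Longrightarrow> \<phi> (x \<otimes> y) = \<phi> x * \<phi> y"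
    and hom_one: "\<phi> \<one> = 1"
    and char0: "\<And>r::nat. r > 0 \<Longrightarrow> of_nat r \<noteq> (0::'k)"
    and nbhd_subset: "U \<in> \<U> \<Longrightarrow> U \<subseteq> carrier H"
    and nbhd_one: "U \<in> \<U> \<Longrightarrow> \<one> \<in> U"
    and nbhd_Int: "U \<in> \<U> \<Longrightarrow> V \<in> \<U> \<Longrightarrow> U \<inter> V \<in> \<U>"
    and nbhd_mult: "U \<in> \<U> \<Longrightarrow> \<exists>V\<in>\<U>. \<forall>x\<in>V. \<forall>y\<in>V. x \<otimes> y \<in> U"
    and nbhd_inv: "U \<in> \<U> \<Longrightarrow> \<exists>V\<in>\<U>. \<forall>x\<in>V. inv x \<in> U"
    and nbhd_generates: "U \<in> \<U> \<Longrightarrow> subgroup S H \<Longrightarrow> U \<subseteq> S \<Longrightarrow> S = carrier H"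
begin

lemma hom_inv: "x \<in> carrier H \<Longrightarrow> \<phi> x * \<phi> (inv x) = 1" "x \<in> carrier H \<Longrightarrow> \<phi> (inv x) * \<phi> x = 1"
  using hom_mult[of x "inv x"] hom_mult[of "inv x" x] hom_one by simp_all

lemma subgroup_of_mult_closed:
  assumes "\<one> \<in> S" "S \<subseteq> carrier H" "\<And>x y. x \<in> S \<Longrightarrow> y \<in> S \<Longrightarrow> x \<otimes> y \<in> S"
    "\<And>x. x \<in> S \<Longrightarrow> inv x \<in> S"
  shows "subgroup S H"
  using assms by unfold_locales auto

text \<open>Choose \<open>U\<close> such that the span \<open>W\<close> of its image has minimal dimension; passing to smaller
  neighbourhoods does not change the span any more. Since products of small elements lie in
  \<open>U\<close>, the space \<open>W\<close> is closed under multiplication. Hence the elements that \<open>\<phi>\<close> maps into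
  \<open>W\<close> together with their inverses form a subgroup, which contains a neighbourhood of the
  identity.\<close>
lemma local_span_is_global:
  assumes "U0 \<in> \<U>"
  obtains U where "U \<in> \<U>" "\<forall>V\<in>\<U>. \<phi> ` U \<subseteq> sq.span (\<phi> ` V)"
    "\<phi> ` carrier H \<subseteq> sq.span (\<phi> ` U)"
proof -
  obtain U where U: "U \<in> \<U>" and min: "\<And>V. V \<in> \<U> \<Longrightarrow> sq.dim (\<phi> ` U) \<le> sq.dim (\<phi> ` V)"
    using ex_has_least_nat[of "\<lambda>U. U \<in> \<U>" U0 "\<lambda>U. sq.dim (\<phi> ` U)"] assms by blast
  have small: "\<phi> ` U \<subseteq> sq.span (\<phi> ` V)" if V: "V \<in> \<U>" for V
  proof -
    have "sq.span (\<phi> ` (U \<inter> V)) = sq.span (\<phi> ` U)"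
      by (rule sq.dim_eq_span) (use min[OF nbhd_Int[OF U V]] in auto)
    moreover have "sq.span (\<phi> ` (U \<inter> V)) \<subseteq> sq.span (\<phi> ` V)" by (rule sq.span_mono) auto
    ultimately show ?thesis using sq.span_superset[of "\<phi> ` U"] by simp
  qed
  let ?W = "sq.span (\<phi> ` U)"
  obtain V where V: "V \<in> \<U>" "\<And>x y. x \<in> V \<Longrightarrow> y \<in> V \<Longrightarrow> x \<otimes> y \<in> U" using nbhd_mult[OF U] by blast
  have W_sub: "?W \<subseteq> sq.span (\<phi> ` V)" by (rule sq.span_minimal[OF small[OF V(1)]]) simp
  have W_mult: "x * y \<in> ?W" if "x \<in> ?W" "y \<in> ?W" for x y
  proof (rule sq_span_mult)
    show "x \<in> sq.span (\<phi> ` V)" "y \<in> sq.span (\<phi> ` V)" using that W_sub by auto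
    fix a b assume "a \<in> \<phi> ` V" "b \<in> \<phi> ` V"
    then obtain v w where vw: "v \<in> V" "w \<in> V" "a = \<phi> v" "b = \<phi> w" by blast
    then have "a * b = \<phi> (v \<otimes> w)" using hom_mult[OF subsetD[OF nbhd_subset[OF V(1)] vw(1)] subsetD[OF nbhd_subset[OF V(1)] vw(2)]] by simp
    then show "a * b \<in> ?W" using V(2)[OF vw(1,2)] by (auto intro: sq.span_base)
  qed simp
  obtain V' where V': "V' \<in> \<U>" "\<And>x. x \<in> V' \<Longrightarrow> inv x \<in> U" using nbhd_inv[OF U] by blast
  let ?S = "{h \<in> carrier H. \<phi> h \<in> ?W \<and> \<phi> (inv h) \<in> ?W}"
  have UV': "U \<inter> V' \<subseteq> ?S" using V'(2) nbhd_subset[OF U] by (auto intro: sq.span_base)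
  have one: "1 \<in> ?W" using nbhd_one[OF U] hom_one by (metis imageI sq.span_base)
  have "subgroup ?S H"
  proof (rule subgroup_of_mult_closed)
    show "x \<otimes> y \<in> ?S" if "x \<in> ?S" "y \<in> ?S" for x y
      using that W_mult by (auto simp: hom_mult inv_mult_group)
  qed (use one hom_one in auto)
  then have "?S = carrier H" using nbhd_generates[OF nbhd_Int[OF U V'(1)]] UV' by blast
  then have "\<phi> ` carrier H \<subseteq> ?W" by blast
  then show ?thesis using that U small by blast
qed

text \<open>Let \<open>W\<close> be the algebra spanned by the image of \<open>\<phi>\<close>, and \<open>N\<close> the radical of its trace form.
  For small \<open>u\<close> and \<open>v\<close> the matrices \<open>\<phi> u * \<phi> v\<close> and \<open>\<phi> v\<close> have the same trace, and small
  \<open>v\<close> suffice to span \<open>W\<close>; so \<open>\<phi> u - 1\<close> belongs to \<open>N\<close>. As \<open>N\<close> is a left ideal, the elements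
  with this property form a subgroup. In characteristic zero all elements of \<open>N\<close> are
  nilpotent.\<close>
lemma augmentation_nil:
  assumes B: "B \<in> \<U>" "\<And>u. u \<in> B \<Longrightarrow> sq_trace (\<phi> u) = sq_trace (1 :: ('k, 'n) sqmat)"
    and x: "x \<in> sq.span ((\<lambda>h. \<phi> h - 1) ` carrier H)"
  shows "\<exists>k. x ^ k = 0"
proof -
  obtain U where U: "U \<in> \<U>" "\<forall>V\<in>\<U>. \<phi> ` U \<subseteq> sq.span (\<phi> ` V)"
    "\<phi> ` carrier H \<subseteq> sq.span (\<phi> ` U)" by (rule local_span_is_global[OF B(1)])
  define W where "W = sq.span (\<phi> ` carrier H)"
  have subW: "sq.subspace W" by (simp add: W_def)
  have phiW: "\<phi> h \<in> W" if "h \<in> carrier H" for h using that by (auto simp: W_def intro: sq.span_base)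
  have one: "1 \<in> W" using phiW[of \<one>] hom_one by simp
  have W_mult: "x * y \<in> W" if "x \<in> W" "y \<in> W" for x y
  proof (rule sq_span_mult[OF that[unfolded W_def] _ subW])
    fix a b assume "a \<in> \<phi> ` carrier H" "b \<in> \<phi> ` carrier H"
    then obtain v w where vw: "v \<in> carrier H" "w \<in> carrier H" "a = \<phi> v" "b = \<phi> w" by blast
    then have "a * b = \<phi> (v \<otimes> w)" using hom_mult[of v w] by auto
    then show "a * b \<in> W" using vw phiW by simp
  qed
  have W_small: "W \<subseteq> sq.span (\<phi> ` V)" if "V \<in> \<U>" for V
    unfolding W_def using bspec[OF U(2) that] U(3)
    by (metis sq.span_minimal sq.subspace_span subset_trans)
  define N where "N = {x \<in> W. \<forall>y\<in>W. sq_trace (x * y) = 0}"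
  have subN: "sq.subspace N"
    unfolding sq.subspace_def N_def
    using sq.subspace_0[OF subW] sq.subspace_add[OF subW] sq.subspace_scale[OF subW]
    by (auto simp: distrib_right)
  have N_left: "w * x \<in> N" if "w \<in> W" "x \<in> N" for w x
  proof -
    have "sq_trace (w * x * y) = 0" if y: "y \<in> W" for y
    proof -
      have "sq_trace (w * x * y) = sq_trace (x * (y * w))"
        using sq_trace_commute[of w "x * y"] by (simp add: mult.assoc)
      then show ?thesis using \<open>x \<in> N\<close> W_mult[OF y \<open>w \<in> W\<close>] by (simp add: N_def)
    qed
    then show ?thesis using W_mult that by (simp add: N_def)
  qed
  obtain V where V: "V \<in> \<U>" "\<And>x y. x \<in> V \<Longrightarrow> y \<in> V \<Longrightarrow> x \<otimes> y \<in> B"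
    using nbhd_mult[OF B(1)] by blast
  have local: "\<phi> u - 1 \<in> N" if u: "u \<in> V \<inter> B" for u
  proof -
    have uH: "u \<in> carrier H" using u nbhd_subset[OF B(1)] by blast
    have "sq_trace ((\<phi> u - 1) * y) = 0" if "y \<in> W" for y
    proof -
      have "y \<in> sq.span (\<phi> ` (V \<inter> B))" using W_small[OF nbhd_Int[OF V(1) B(1)]] that by blast
      then show ?thesis
      proof (induction rule: sq.span_induct_alt)
        case (step c b y)
        then obtain v where v: "v \<in> V \<inter> B" "b = \<phi> v" by blast
        have vH: "v \<in> carrier H" using v nbhd_subset[OF B(1)] by blast
        have "(\<phi> u - 1) * b = \<phi> (u \<otimes> v) - \<phi> v"
          using v hom_mult[OF uH vH] by (simp add: left_diff_distrib)
        then have "sq_trace ((\<phi> u - 1) * b) = 0"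
          using B(2)[of v] B(2)[OF V(2)[of u v]] u v by simp
        then show ?case using step by (simp add: distrib_left)
      qed simp
    qed
    then show ?thesis using phiW[OF uH] one sq.subspace_diff[OF subW] by (simp add: N_def)
  qed
  let ?S = "{h \<in> carrier H. \<phi> h - 1 \<in> N}"
  have "subgroup ?S H"
  proof (rule subgroup_of_mult_closed)
    show "x \<otimes> y \<in> ?S" if xy: "x \<in> ?S" "y \<in> ?S" for x y
    proof -
      have "\<phi> (x \<otimes> y) - 1 = \<phi> x * (\<phi> y - 1) + (\<phi> x - 1)"
        using xy by (simp add: hom_mult right_diff_distrib)
      moreover have "\<dots> \<in> N" using xy by (intro sq.subspace_add[OF subN] N_left phiW) auto
      ultimately have "\<phi> (x \<otimes> y) - 1 \<in> N" by (simp only:)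
      then show ?thesis using xy by simp
    qed
    show "inv x \<in> ?S" if x: "x \<in> ?S" for x
    proof -
      have "\<phi> (inv x) - 1 = - (\<phi> (inv x) * (\<phi> x - 1))"
        using x hom_inv by (simp add: right_diff_distrib)
      then show ?thesis using x N_left phiW sq.subspace_neg[OF subN] by simp
    qed
  qed (use sq.subspace_0[OF subN] hom_one in auto)
  moreover have "V \<inter> B \<subseteq> ?S" using local nbhd_subset[OF B(1)] by blast
  ultimately have "?S = carrier H" using nbhd_generates[OF nbhd_Int[OF V(1) B(1)]] by blast
  then have "(\<lambda>h. \<phi> h - 1) ` carrier H \<subseteq> N" by blast
  then have "x \<in> N" using x sq.span_minimal[OF _ subN] by blast
  moreover have "y \<in> W" if "y \<in> sq.span (range ((^) x))" for y
  proof -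
    have "x ^ k \<in> W" for k using \<open>x \<in> N\<close> one W_mult by (induction k) (auto simp: N_def)
    then show ?thesis using that sq.span_minimal[OF _ subW, of "range ((^) x)"] by blast
  qed
  ultimately show ?thesis by (intro sq_nil_of_trace_zero[OF char0]) (auto simp: N_def)
qed

text \<open>With \<open>a = \<phi> g - 1\<close> and \<open>b = \<phi> h - 1\<close>, the matrix of the commutator of \<open>g\<close> and \<open>h\<close> minus one
  is \<open>(a b - b a) \<phi>(g)\<^sup>-\<^sup>1 \<phi>(h)\<^sup>-\<^sup>1\<close>, a combination of products of two elements of the
  augmentation ideal \<open>J\<close>. So if commutators generate the group, \<open>J\<close> equals its square, and
  being nil it vanishes.\<close>
theorem perfect_imp_trivial:
  assumes B: "B \<in> \<U>" "\<And>u. u \<in> B \<Longrightarrow> sq_trace (\<phi> u) = sq_trace (1 :: ('k, 'n) sqmat)"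
    and perfect: "derived H (carrier H) = carrier H" and h: "h \<in> carrier H"
  shows "\<phi> h = 1"
proof -
  let ?A = "(\<lambda>h. \<phi> h - 1) ` carrier H"
  define J where "J = sq.span ?A"
  have subJ: "sq.subspace J" by (simp add: J_def)
  have A_J: "\<phi> h - 1 \<in> J" if "h \<in> carrier H" for h using that by (auto simp: J_def intro: sq.span_base)
  have J_left: "\<phi> g * x \<in> J" if g: "g \<in> carrier H" and x: "x \<in> J" for g x
  proof (rule sq_span_mult[OF _ x[unfolded J_def] _ subJ])
    show "\<phi> g \<in> sq.span {\<phi> g}" by (auto intro: sq.span_base)
    fix a b assume "a \<in> {\<phi> g}" "b \<in> ?A"
    then obtain h where h: "h \<in> carrier H" "b = \<phi> h - 1" "a = \<phi> g" by blast
    then have "a * b = (\<phi> (g \<otimes> h) - 1) - (\<phi> g - 1)" using g by (simp add: hom_mult right_diff_distrib)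
    then show "a * b \<in> J" using sq.subspace_diff[OF subJ A_J[of "g \<otimes> h"] A_J[OF g]] g h by simp
  qed
  have J_right: "x * \<phi> g \<in> J" if g: "g \<in> carrier H" and x: "x \<in> J" for g x
  proof (rule sq_span_mult[OF x[unfolded J_def] _ _ subJ])
    show "\<phi> g \<in> sq.span {\<phi> g}" by (auto intro: sq.span_base)
    fix a b assume "a \<in> ?A" "b \<in> {\<phi> g}"
    then obtain h where h: "h \<in> carrier H" "a = \<phi> h - 1" "b = \<phi> g" by blast
    then have "a * b = (\<phi> (h \<otimes> g) - 1) - (\<phi> g - 1)" using g by (simp add: hom_mult left_diff_distrib)
    then show "a * b \<in> J" using sq.subspace_diff[OF subJ A_J[of "h \<otimes> g"] A_J[OF g]] g h by simp
  qed
  have J_mult: "x * y \<in> J" if "x \<in> J" "y \<in> J" for x y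
  proof (rule sq_span_mult[OF that(1)[unfolded J_def] _ _ subJ])
    show "y \<in> sq.span {y}" by (auto intro: sq.span_base)
    fix a b assume "a \<in> ?A" "b \<in> {y}"
    then obtain h where "h \<in> carrier H" "a = \<phi> h - 1" "b = y" by blast
    then show "a * b \<in> J" using sq.subspace_diff[OF subJ J_left[of h y] that(2)] that(2)
      by (simp add: left_diff_distrib)
  qed
  define J2 where "J2 = sq.span {x * y | x y. x \<in> J \<and> y \<in> J}"
  have subJ2: "sq.subspace J2" by (simp add: J2_def)
  have JJ: "x * y \<in> J2" if "x \<in> J" "y \<in> J" for x y
    unfolding J2_def by (rule sq.span_base) (use that in blast)
  have J2_left: "\<phi> g * x \<in> J2" if g: "g \<in> carrier H" and x: "x \<in> J2" for g x
  proof (rule sq_span_mult[OF _ x[unfolded J2_def] _ subJ2])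
    show "\<phi> g \<in> sq.span {\<phi> g}" by (auto intro: sq.span_base)
    fix a b assume "a \<in> {\<phi> g}" "b \<in> {x * y | x y. x \<in> J \<and> y \<in> J}"
    then obtain y z where "a = \<phi> g" "b = y * z" "y \<in> J" "z \<in> J" by blast
    then show "a * b \<in> J2" using JJ[OF J_left[OF g]] by (simp add: mult.assoc[symmetric])
  qed
  let ?S = "{h \<in> carrier H. \<phi> h - 1 \<in> J2}"
  have S: "subgroup ?S H"
  proof (rule subgroup_of_mult_closed)
    show "x \<otimes> y \<in> ?S" if xy: "x \<in> ?S" "y \<in> ?S" for x y
    proof -
      have "\<phi> (x \<otimes> y) - 1 = \<phi> x * (\<phi> y - 1) + (\<phi> x - 1)"
        using xy by (simp add: hom_mult right_diff_distrib)
      moreover have "\<dots> \<in> J2" using xy by (intro sq.subspace_add[OF subJ2] J2_left) auto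
      ultimately have "\<phi> (x \<otimes> y) - 1 \<in> J2" by (simp only:)
      then show ?thesis using xy by simp
    qed
    show "inv x \<in> ?S" if x: "x \<in> ?S" for x
    proof -
      have "\<phi> (inv x) - 1 = - (\<phi> (inv x) * (\<phi> x - 1))"
        using x hom_inv by (simp add: right_diff_distrib)
      then show ?thesis using x J2_left sq.subspace_neg[OF subJ2] by simp
    qed
  qed (use sq.subspace_0[OF subJ2] hom_one in auto)
  have "derived_set H (carrier H) \<subseteq> ?S"
  proof
    fix c assume "c \<in> derived_set H (carrier H)"
    then obtain g h where gh: "g \<in> carrier H" "h \<in> carrier H" "c = g \<otimes> h \<otimes> inv g \<otimes> inv h" by blast
    define a b where "a = \<phi> g - 1" and "b = \<phi> h - 1"
    have ab: "a \<in> J" "b \<in> J" using A_J gh by (auto simp: a_def b_def)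
    have "\<phi> c = \<phi> g * \<phi> h * \<phi> (inv g) * \<phi> (inv h)" using gh by (simp add: hom_mult)
    moreover have "\<phi> h * \<phi> g * \<phi> (inv g) * \<phi> (inv h) = 1"
      using gh hom_inv(1)[of g] hom_inv(1)[of h] by (simp add: mult.assoc)
    ultimately have "\<phi> c - 1 = (\<phi> g * \<phi> h - \<phi> h * \<phi> g) * \<phi> (inv g) * \<phi> (inv h)"
      by (simp add: left_diff_distrib)
    also have "\<phi> g * \<phi> h - \<phi> h * \<phi> g = a * b - b * a" by (simp add: a_def b_def algebra_simps)
    also have "(a * b - b * a) * \<phi> (inv g) * \<phi> (inv h) =
        a * (b * \<phi> (inv g) * \<phi> (inv h)) - b * (a * \<phi> (inv g) * \<phi> (inv h))"
      by (simp add: left_diff_distrib mult.assoc)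
    also have "\<dots> \<in> J2"
      using gh ab by (intro sq.subspace_diff[OF subJ2] JJ J_right) auto
    finally show "c \<in> ?S" using gh by simp
  qed
  then have "derived H (carrier H) \<subseteq> ?S" unfolding derived_def
    by (rule generate_subgroup_incl[OF _ S])
  then have "?A \<subseteq> J2" using perfect by blast
  then have "J \<subseteq> J2" unfolding J_def by (rule sq.span_minimal[OF _ subJ2])
  then have "J = {0}"
    using sq_idempotent_nil_space[OF subJ J_mult] augmentation_nil[OF B] unfolding J2_def J_def by blast
  then show ?thesis using A_J[OF h] by simp
qed

end

section \<open>Divisible elements of rings with a lattice\<close>

text \<open>The intended ring consists of the matrices over a finite extension of \<open>\<rat>\<close> or \<open>\<rat>\<^sub>p\<close>, and \<open>L\<close>
  of the matrices with entries in a lattice of this field. The set \<open>T\<close> represents the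
  residue classes of \<open>L\<close> modulo \<open>p\<close>. Multiplication by a fixed element preserves \<open>L\<close> only up
  to a power of \<open>p\<close>, which depends on this element.\<close>
locale ring_lattice =
  fixes p :: nat and L T :: "'r::ring_1 set" and ip :: 'r
  assumes p_inverse: "ip * of_nat p = 1"
    and L_diff: "x \<in> L \<Longrightarrow> y \<in> L \<Longrightarrow> x - y \<in> L"
    and T_finite: "finite T"
    and L_cover: "x \<in> L \<Longrightarrow> \<exists>t\<in>T. \<exists>z\<in>L. x = t + of_nat p * z"
    and L_separated: "(\<And>c. \<exists>z\<in>L. x = of_nat p ^ c * z) \<Longrightarrow> x = 0"
    and L_bounded: "\<exists>c. \<forall>y\<in>L. of_nat p ^ c * (x * y) \<in> L"
    and L_unit: "\<exists>u\<in>L. \<exists>u'. u * u' = 1"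
begin

abbreviation P :: 'r where "P \<equiv> of_nat p"

abbreviation q :: nat where "q \<equiv> card T"

lemma P_commute: "P * x = x * P"
  by (rule mult_of_nat_commute)

lemma P_power_commute: "P ^ c * x = x * P ^ c"
  by (metis mult_of_nat_commute of_nat_power)

lemma P_left_commute: "x * (P * y) = P * (x * y)"
  using P_commute[of x] by (simp add: mult.assoc[symmetric])

lemma P_power_left_commute: "x * (P ^ c * y) = P ^ c * (x * y)"
  using P_power_commute[of c x] by (simp add: mult.assoc[symmetric])

lemma P_ip: "P * ip = 1"
  using p_inverse P_commute by simp

lemma ip_P_power: "ip ^ c * P ^ c = 1"
  by (metis P_commute left_right_inverse_power p_inverse)

lemma P_ip_power: "P ^ c * ip ^ c = 1"
  by (metis P_power_commute ip_P_power)

lemma P_cancel: "P ^ c * x = P ^ c * y \<longleftrightarrow> x = y"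
  by (metis mult.assoc mult_1 ip_P_power)

lemma P_ip_power_cancel: "P ^ c * (ip ^ c * x) = x"
  by (metis mult.assoc mult_1 P_ip_power)

lemma zero_in_L: "0 \<in> L"
  using L_unit L_diff by fastforce

lemma q_pos: "q > 0"
  using L_cover[OF zero_in_L] T_finite card_gt_0_iff by blast

definition additive :: "'r set \<Rightarrow> bool" where
  "additive M \<longleftrightarrow> 0 \<in> M \<and> (\<forall>x\<in>M. \<forall>y\<in>M. x - y \<in> M)"

lemma additive_zero: "additive M \<Longrightarrow> 0 \<in> M"
  and additive_diff: "additive M \<Longrightarrow> x \<in> M \<Longrightarrow> y \<in> M \<Longrightarrow> x - y \<in> M"
  by (auto simp: additive_def)

lemma additive_uminus: "additive M \<Longrightarrow> x \<in> M \<Longrightarrow> - x \<in> M"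
  using additive_diff[of M 0 x] additive_zero by simp

lemma additive_add: "additive M \<Longrightarrow> x \<in> M \<Longrightarrow> y \<in> M \<Longrightarrow> x + y \<in> M"
  using additive_diff[of M x "- y"] additive_uminus by simp

lemma additive_sum: "additive M \<Longrightarrow> (\<And>i. i \<in> I \<Longrightarrow> f i \<in> M) \<Longrightarrow> sum f I \<in> M"
  by (induction I rule: infinite_finite_induct) (auto simp: additive_zero additive_add)

lemma additive_of_nat_mult: "additive M \<Longrightarrow> x \<in> M \<Longrightarrow> of_nat k * x \<in> M"
  by (induction k) (auto simp: additive_zero additive_add algebra_simps)

lemma additive_P_power: "additive M \<Longrightarrow> x \<in> M \<Longrightarrow> P ^ c * x \<in> M"
  by (metis additive_of_nat_mult of_nat_power)

lemma additive_L: "additive L"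
  by (auto simp: additive_def zero_in_L L_diff)

text \<open>The lattice \<open>p\<^sup>-\<^sup>c L\<close>.\<close>
definition enlarged :: "nat \<Rightarrow> 'r set" where
  "enlarged c = {x. P ^ c * x \<in> L}"

lemma enlarged_mono: "c \<le> d \<Longrightarrow> enlarged c \<subseteq> enlarged d"
proof -
  assume "c \<le> d"
  then obtain e where d: "d = e + c" by (metis add.commute le_iff_add)
  show ?thesis unfolding enlarged_def d power_add mult.assoc
    using additive_P_power[OF additive_L] by auto
qed

text \<open>Each division by \<open>p\<close> multiplies the number of classes modulo \<open>L\<close> by at most \<open>q\<close>.\<close>
lemma enlarged_cover: "\<exists>F. finite F \<and> card F \<le> q ^ c \<and> (\<forall>x\<in>enlarged c. \<exists>t\<in>F. x - t \<in> L)"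
proof (induction c)
  case 0
  show ?case by (rule exI[of _ "{0}"]) (auto simp: enlarged_def)
next
  case (Suc c)
  then obtain F where F: "finite F" "card F \<le> q ^ c" "\<And>x. x \<in> enlarged c \<Longrightarrow> \<exists>t\<in>F. x - t \<in> L"
    by blast
  let ?G = "(\<lambda>(t, s). ip * (t + s)) ` (F \<times> T)"
  have "card ?G \<le> card (F \<times> T)" using F T_finite by (intro card_image_le) auto
  also have "\<dots> \<le> q ^ Suc c" using F by (simp add: card_cartesian_product mult.commute)
  finally have "card ?G \<le> q ^ Suc c" .
  moreover have "\<exists>t\<in>?G. x - t \<in> L" if "x \<in> enlarged (Suc c)" for x
  proof -
    have "P * x \<in> enlarged c"
      using that by (simp add: enlarged_def mult.assoc power_Suc2 del: power_Suc)
    then obtain t where t: "t \<in> F" "P * x - t \<in> L" using F by blast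
    then obtain s z where s: "s \<in> T" "z \<in> L" "P * x - t = s + P * z" using L_cover by blast
    have "x = ip * (P * x)" by (simp add: mult.assoc[symmetric] p_inverse)
    also have "P * x = t + s + P * z" using s by (simp add: algebra_simps)
    also have "ip * \<dots> = ip * (t + s) + z"
      by (simp add: distrib_left mult.assoc[symmetric] p_inverse)
    finally have "x - ip * (t + s) = z" by simp
    then show ?thesis using t s by force
  qed
  ultimately show ?case using F T_finite by (intro exI[of _ ?G]) auto
qed

lemma card_separated_le:
  assumes "XX \<subseteq> enlarged c" and sep: "\<And>x y. x \<in> XX \<Longrightarrow> y \<in> XX \<Longrightarrow> x - y \<in> L \<Longrightarrow> x = y"
  shows "finite XX \<and> card XX \<le> q ^ c"
proof -
  obtain F where F: "finite F" "card F \<le> q ^ c" "\<forall>x\<in>enlarged c. \<exists>t\<in>F. x - t \<in> L"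
    using enlarged_cover[of c] by blast
  have "\<forall>x\<in>XX. \<exists>t. t \<in> F \<and> x - t \<in> L" using assms(1) F(3) by blast
  from bchoice[OF this] obtain f where f: "\<And>x. x \<in> XX \<Longrightarrow> f x \<in> F \<and> x - f x \<in> L" by blast
  have "inj_on f XX"
  proof (rule inj_onI)
    fix x y assume xy: "x \<in> XX" "y \<in> XX" "f x = f y"
    have "(x - f x) - (y - f y) \<in> L" using f[OF xy(1)] f[OF xy(2)] by (blast intro: L_diff)
    then show "x = y" using sep[OF xy(1,2)] xy(3) by simp
  qed
  moreover have sub: "f ` XX \<subseteq> F" using f by blast
  ultimately have "finite XX" "card XX \<le> card F"
    using F(1) by (auto intro: card_inj_on_le inj_on_finite)
  then show ?thesis using F(2) by simp
qed

text \<open>Each strict inclusion at least doubles the number of classes modulo \<open>L\<close>, since a proper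
  subgroup has index at least two.\<close>
lemma strict_chain_length:
  assumes add: "\<And>i. additive (M i)" and L: "L \<subseteq> M 0" and mono: "\<And>i. M i \<subseteq> M (Suc i)"
    and strict: "\<And>i. i < k \<Longrightarrow> M i \<noteq> M (Suc i)" and le: "M k \<subseteq> enlarged c"
  shows "2 ^ k \<le> q ^ c"
proof -
  have LM: "L \<subseteq> M i" for i
  proof (induction i)
    case (Suc i)
    then show ?case using mono[of i] by blast
  qed (rule L)
  have "\<exists>XX. finite XX \<and> card XX = 2 ^ j \<and> XX \<subseteq> M j \<and> (\<forall>x\<in>XX. \<forall>y\<in>XX. x - y \<in> L \<longrightarrow> x = y)"
    if "j \<le> k" for j using that
  proof (induction j)
    case 0
    show ?case using additive_zero[OF add] by (intro exI[of _ "{0}"]) auto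
  next
    case (Suc j)
    then have "j \<le> k" by simp
    from Suc.IH[OF this] obtain XX where XX': "finite XX \<and> card XX = 2 ^ j \<and> XX \<subseteq> M j
        \<and> (\<forall>x\<in>XX. \<forall>y\<in>XX. x - y \<in> L \<longrightarrow> x = y)"
      by (rule exE)
    then have XX: "finite XX" "card XX = 2 ^ j" "XX \<subseteq> M j"
      "\<And>x y. x \<in> XX \<Longrightarrow> y \<in> XX \<Longrightarrow> x - y \<in> L \<Longrightarrow> x = y"
      by simp_all
    have "M j \<noteq> M (Suc j)" using strict[of j] Suc.prems by simp
    then obtain a where a: "a \<in> M (Suc j)" "a \<notin> M j" using mono[of j] by blast
    have no: "a + x - y \<notin> L" if "x \<in> XX" "y \<in> XX" for x y
    proof
      assume "a + x - y \<in> L"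
      then have "a + x - y \<in> M j" using LM[of j] by blast
      moreover have "x - y \<in> M j" by (rule additive_diff[OF add]) (use that XX(3) in auto)
      ultimately have "a + x - y - (x - y) \<in> M j" by (rule additive_diff[OF add])
      then show False using a by simp
    qed
    have no': "y - (a + x) \<notin> L" if "x \<in> XX" "y \<in> XX" for x y
      using no[OF that] additive_uminus[OF additive_L, of "y - (a + x)"] by auto
    let ?Y = "XX \<union> (+) a ` XX"
    have "a + x \<notin> XX" if "x \<in> XX" for x using no[OF that, of "a + x"] zero_in_L by auto
    then have "XX \<inter> (+) a ` XX = {}" by blast
    then have "card ?Y = 2 ^ Suc j" using XX by (simp add: card_Un_disjoint card_image)
    moreover have "?Y \<subseteq> M (Suc j)"
      using XX(3) mono[of j] a(1) by (auto intro!: additive_add[OF add])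
    moreover have "x = y" if "x \<in> ?Y" "y \<in> ?Y" "x - y \<in> L" for x y
      using that
    proof (elim UnE imageE)
      fix x' y' assume "x = a + x'" "x' \<in> XX" "y = a + y'" "y' \<in> XX"
      then show ?thesis using XX(4)[of x' y'] that(3) by simp
    next
      fix y' assume "x \<in> XX" "y = a + y'" "y' \<in> XX"
      then show ?thesis using no'[of y' x] that(3) by simp
    next
      fix x' assume "x = a + x'" "x' \<in> XX" "y \<in> XX"
      then show ?thesis using no[of x' y] that(3) by simp
    next
      assume "x \<in> XX" "y \<in> XX"
      then show ?thesis using XX(4) that(3) by blast
    qed
    then have "\<forall>x\<in>?Y. \<forall>y\<in>?Y. x - y \<in> L \<longrightarrow> x = y" by blast
    moreover have "finite ?Y" using XX(1) by simp
    ultimately show ?case by (intro exI[of _ ?Y] conjI) assumption+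
  qed
  from this[OF order_refl] obtain XX where XX': "finite XX \<and> card XX = 2 ^ k \<and> XX \<subseteq> M k
      \<and> (\<forall>x\<in>XX. \<forall>y\<in>XX. x - y \<in> L \<longrightarrow> x = y)"
    by (rule exE)
  then have XX: "card XX = 2 ^ k" "XX \<subseteq> M k" "\<forall>x\<in>XX. \<forall>y\<in>XX. x - y \<in> L \<longrightarrow> x = y"
    by simp_all
  have "card XX \<le> q ^ c"
    by (rule conjunct2[OF card_separated_le[OF subset_trans[OF XX(2) le]]]) (use XX(3) in blast)
  then show ?thesis using XX(1) by simp
qed

lemma exponential_growth_contradiction:
  fixes a b C :: nat
  assumes "\<And>s. a ^ s \<le> C * b ^ s" and "b > 0"
  shows "a \<le> b"
proof (rule ccontr)
  assume "\<not> a \<le> b"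
  then have gt: "1 < real a / real b" using assms(2) by simp
  obtain s where s: "real C < (real a / real b) ^ s" using real_arch_pow[OF gt] by blast
  have "real (a ^ s) \<le> real (C * b ^ s)" using assms(1) of_nat_mono by blast
  then have "(real a / real b) ^ s \<le> real C"
    using assms(2) by (simp add: power_divide divide_le_eq)
  then show False using s by simp
qed

lemma power_bounded_upto: "\<exists>c. \<forall>t\<le>N. \<forall>y\<in>L. P ^ c * (h ^ t * y) \<in> L"
proof (induction N)
  case 0
  show ?case by (rule exI[of _ 0]) auto
next
  case (Suc N)
  then obtain c where c: "\<And>t y. t \<le> N \<Longrightarrow> y \<in> L \<Longrightarrow> P ^ c * (h ^ t * y) \<in> L" by blast
  obtain d where d: "\<And>y. y \<in> L \<Longrightarrow> P ^ d * (h ^ Suc N * y) \<in> L" using L_bounded by blast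
  have "P ^ (c + d) * (h ^ t * y) \<in> L" if "t \<le> Suc N" "y \<in> L" for t y
  proof (cases "t = Suc N")
    case True
    then show ?thesis using additive_P_power[OF additive_L d[OF that(2)], of c]
      by (simp only: power_add mult.assoc True)
  next
    case False
    then have "P ^ d * (P ^ c * (h ^ t * y)) \<in> L"
      using that c additive_P_power[OF additive_L] by simp
    then show ?thesis by (simp only: power_add mult.assoc add.commute[of c d])
  qed
  then show ?case by blast
qed

lemma bounded_pow:
  assumes A: "\<And>y. y \<in> L \<Longrightarrow> P ^ a * (g * y) \<in> L" and y: "y \<in> L"
  shows "P ^ (a * s) * (g ^ s * y) \<in> L"
proof (induction s)
  case 0 then show ?case using y by simp
next
  case (Suc s)
  have "P ^ a * (g * (P ^ (a * s) * (g ^ s * y))) \<in> L" using A Suc by blast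
  moreover have "P ^ (a * Suc s) * (g ^ Suc s * y) = P ^ a * (g * (P ^ (a * s) * (g ^ s * y)))"
    by (metis (no_types, lifting) P_power_commute mult.assoc mult_Suc_right power_Suc power_add)
  ultimately show ?case by simp
qed

text \<open>The group \<open>L + h L + \<dots> + h\<^sup>k L\<close>.\<close>
fun krylov :: "'r \<Rightarrow> nat \<Rightarrow> 'r set" where
  "krylov h 0 = L"
| "krylov h (Suc k) = {l + h * x | l x. l \<in> L \<and> x \<in> krylov h k}"

declare krylov.simps(2) [simp del]

lemma krylov_SucI: "l \<in> L \<Longrightarrow> x \<in> krylov h k \<Longrightarrow> l + h * x \<in> krylov h (Suc k)"
  by (auto simp: krylov.simps)

lemma krylov_SucE:
  assumes "x \<in> krylov h (Suc k)"
  obtains l y where "l \<in> L" "y \<in> krylov h k" "x = l + h * y"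
  using assms by (auto simp: krylov.simps)

lemma additive_krylov: "additive (krylov h k)"
proof (induction k)
  case 0 then show ?case by (simp add: additive_L)
next
  case (Suc k)
  show ?case unfolding additive_def
  proof (intro conjI ballI)
    show "0 \<in> krylov h (Suc k)"
      using krylov_SucI[OF zero_in_L additive_zero[OF Suc]] by simp
  next
    fix x y assume "x \<in> krylov h (Suc k)" "y \<in> krylov h (Suc k)"
    then obtain l x' l' y' where *: "l \<in> L" "l' \<in> L" "x' \<in> krylov h k" "y' \<in> krylov h k"
      "x = l + h * x'" "y = l' + h * y'" by (auto elim!: krylov_SucE)
    have "x - y = (l - l') + h * (x' - y')" by (simp add: * algebra_simps)
    moreover have "(l - l') + h * (x' - y') \<in> krylov h (Suc k)"
      by (intro krylov_SucI L_diff additive_diff[OF Suc] *)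
    ultimately show "x - y \<in> krylov h (Suc k)" by simp
  qed
qed

lemma krylov_mono: "krylov h k \<subseteq> krylov h (Suc k)"
proof (induction k)
  case 0
  show ?case
  proof
    fix x assume "x \<in> krylov h 0"
    then show "x \<in> krylov h (Suc 0)" using krylov_SucI[of x 0 h 0] zero_in_L by simp
  qed
next
  case (Suc k)
  then show ?case by (blast intro: krylov_SucI elim: krylov_SucE)
qed

lemma krylov_subset:
  assumes "additive M" and "\<And>i y. i \<le> k \<Longrightarrow> y \<in> L \<Longrightarrow> h ^ i * y \<in> M"
  shows "krylov h k \<subseteq> M"
proof -
  have "\<forall>i x. i + j \<le> k \<longrightarrow> x \<in> krylov h j \<longrightarrow> h ^ i * x \<in> M" for j
  proof (induction j)
    case 0 then show ?case using assms by simp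
  next
    case (Suc j)
    show ?case
    proof (intro allI impI)
      fix i x assume *: "i + Suc j \<le> k" "x \<in> krylov h (Suc j)"
      then obtain l y where y: "l \<in> L" "y \<in> krylov h j" "x = l + h * y" by (auto elim: krylov_SucE)
      have "h ^ i * x = h ^ i * l + h ^ Suc i * y"
        by (simp add: y distrib_left mult.assoc[symmetric] power_Suc2 del: power_Suc)
      moreover have "h ^ i * l \<in> M" using assms * y by simp
      moreover have "h ^ Suc i * y \<in> M" using Suc[rule_format, of "Suc i" y] * y by simp
      ultimately show "h ^ i * x \<in> M" using additive_add[OF assms(1)] by simp
    qed
  qed
  from this[of k] show ?thesis by (metis add_0 mult_1 order_refl power_0 subsetI)
qed

lemma additive_enlarged: "additive (enlarged c)"
  by (auto simp: additive_def enlarged_def zero_in_L L_diff right_diff_distrib)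

text \<open>As \<open>g = h\<^sup>N\<close>, the group \<open>L + h L + \<dots> + h\<^bsup>N s\<^esup> L\<close> is contained in \<open>p\<^bsup>-(C + a s)\<^esup> L\<close> for some
  constant \<open>C\<close> and all \<open>s\<close>. If all the inclusions in this chain were strict, it would have
  at least \<open>2\<^bsup>N s\<^esup>\<close> classes modulo \<open>L\<close>, but there are no more than \<open>q\<^bsup>C + a s\<^esup>\<close>. For roots
  \<open>h\<close> of high order, \<open>2\<^sup>N\<close> exceeds \<open>q\<^sup>a\<close>. Then the chain becomes stationary, and its limit
  is invariant under \<open>h\<close>.\<close>
theorem stable_lattice_exists:
  assumes g: "g = h ^ N" and A: "\<And>y. y \<in> L \<Longrightarrow> P ^ a * (g * y) \<in> L" and N: "q ^ a < 2 ^ N"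
  shows "\<exists>M c. additive M \<and> L \<subseteq> M \<and> M \<subseteq> enlarged c \<and> (\<forall>x\<in>M. h * x \<in> M)"
proof -
  obtain C where C: "\<And>t y. t \<le> N \<Longrightarrow> y \<in> L \<Longrightarrow> P ^ C * (h ^ t * y) \<in> L"
    using power_bounded_upto[of N h] by blast
  have bound: "krylov h (N * s) \<subseteq> enlarged (C + a * s)" for s
  proof (rule krylov_subset[OF additive_enlarged])
    fix i y assume i: "i \<le> N * s" and y: "y \<in> L"
    have N0: "N > 0" using N q_pos by (cases N) auto
    define s' t where "s' = i div N" and "t = i mod N"
    have "s' \<le> s" unfolding s'_def using i N0
      by (metis div_le_mono nonzero_mult_div_cancel_left not_gr_zero)
    have i_eq: "i = t + N * s'" by (simp add: s'_def t_def)
    have "t \<le> N" using N0 by (simp add: t_def less_imp_le)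
    have "h ^ i * y = h ^ t * (g ^ s' * y)" by (simp add: i_eq g power_add power_mult mult.assoc)
    moreover have "P ^ (a * s') * (g ^ s' * y) \<in> L" using bounded_pow A y by blast
    then have "P ^ C * (h ^ t * (P ^ (a * s') * (g ^ s' * y))) \<in> L" using C \<open>t \<le> N\<close> by blast
    then have "P ^ (C + a * s') * (h ^ t * (g ^ s' * y)) \<in> L"
      by (metis (no_types, lifting) P_power_commute mult.assoc power_add)
    ultimately have "h ^ i * y \<in> enlarged (C + a * s')" by (simp add: enlarged_def)
    then show "h ^ i * y \<in> enlarged (C + a * s)"
      using enlarged_mono[of "C + a * s'" "C + a * s"] \<open>s' \<le> s\<close> by auto
  qed
  have "\<exists>k. krylov h k = krylov h (Suc k)"
  proof (rule ccontr)
    assume no: "\<nexists>k. krylov h k = krylov h (Suc k)"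
    have "(2 ^ N) ^ s \<le> q ^ C * (q ^ a) ^ s" for s
    proof -
      have "2 ^ (N * s) \<le> q ^ (C + a * s)"
        using strict_chain_length[of "krylov h" "N * s" "C + a * s"] no bound additive_krylov krylov_mono
        by auto
      then show ?thesis by (simp add: power_mult power_add)
    qed
    then have "(2::nat) ^ N \<le> q ^ a" by (rule exponential_growth_contradiction) (use q_pos in simp)
    then show False using N by simp
  qed
  then obtain k where k: "krylov h k = krylov h (Suc k)" by blast
  have hk: "h * x \<in> krylov h k" if "x \<in> krylov h k" for x
    using krylov_SucI[OF zero_in_L that] k by simp
  have km: "krylov h i \<subseteq> krylov h j" if "i \<le> j" for i j
    using that lift_Suc_mono_le[of "krylov h"] krylov_mono by blast
  have L: "L \<subseteq> krylov h k" using km[of 0 k] by simp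
  have N0: "N > 0" using N q_pos by (cases N) auto
  then have "krylov h k \<subseteq> krylov h (N * k)" by (intro km) simp
  then have "krylov h k \<subseteq> enlarged (C + a * k)" using bound by blast
  then show ?thesis using additive_krylov L hk by blast
qed

text \<open>The bound \<open>q\<close> for the number of residue classes of \<open>L\<close> modulo \<open>p\<close> holds for every lattice
  \<open>M\<close> between \<open>L\<close> and \<open>p\<^sup>-\<^sup>c L\<close>. Indeed the expansions \<open>x\<^sub>0 + p x\<^sub>1 + \<dots>\<close> of length \<open>s\<close> with
  digits in \<open>XX\<close> are incongruent modulo \<open>p\<^sup>s M\<close>. Divided by \<open>p\<^sup>s\<close> they are incongruent
  modulo \<open>L\<close> and lie in \<open>p\<^bsup>-(c + s)\<^esup> L\<close>. So \<open>(card XX)\<^sup>s \<le> q\<^bsup>c + s\<^esup>\<close> for all \<open>s\<close>.\<close>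
lemma card_residues_le:
  assumes M: "additive M" "L \<subseteq> M" "M \<subseteq> enlarged c" and XX: "finite XX" "XX \<subseteq> M"
    and sep: "\<And>x y z. x \<in> XX \<Longrightarrow> y \<in> XX \<Longrightarrow> z \<in> M \<Longrightarrow> x - y = P * z \<Longrightarrow> x = y"
  shows "card XX \<le> q"
proof -
  have "\<exists>Y. finite Y \<and> card Y = card XX ^ s \<and> Y \<subseteq> M \<and>
      (\<forall>x\<in>Y. \<forall>y\<in>Y. \<forall>z\<in>M. x - y = P ^ s * z \<longrightarrow> x = y)" for s
  proof (induction s)
    case 0
    show ?case using additive_zero[OF M(1)] by (intro exI[of _ "{0}"]) auto
  next
    case (Suc s)
    from Suc.IH obtain Y where "finite Y \<and> card Y = card XX ^ s \<and> Y \<subseteq> M \<and>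
        (\<forall>x\<in>Y. \<forall>y\<in>Y. \<forall>z\<in>M. x - y = P ^ s * z \<longrightarrow> x = y)" by (rule exE)
    then have Y: "finite Y" "card Y = card XX ^ s" "Y \<subseteq> M"
      "\<And>x y z. x \<in> Y \<Longrightarrow> y \<in> Y \<Longrightarrow> z \<in> M \<Longrightarrow> x - y = P ^ s * z \<Longrightarrow> x = y" by blast+
    let ?f = "\<lambda>(x, y). x + P * y"
    have key: "x = x' \<and> y = y'" if "x \<in> XX" "x' \<in> XX" "y \<in> Y" "y' \<in> Y" "z \<in> M"
      "x + P * y - (x' + P * y') = P ^ Suc s * z" for x x' y y' z
    proof -
      have "x - x' = P * (P ^ s * z - y + y')" using that(6) by (simp add: algebra_simps)
      moreover have "P ^ s * z - y + y' \<in> M"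
        using that Y(3) by (intro additive_add[OF M(1)] additive_diff[OF M(1)] additive_P_power[OF M(1)]) auto
      ultimately have x: "x = x'" using sep[OF that(1,2)] by blast
      then have "P ^ 1 * (y - y') = P ^ 1 * (P ^ s * z)" using that(6) by (simp add: algebra_simps)
      then have "y - y' = P ^ s * z" using P_cancel by blast
      then show ?thesis using x Y(4)[OF that(3-5)] by blast
    qed
    have "inj_on ?f (XX \<times> Y)"
    proof (rule inj_onI, clarify)
      fix a b a' b' assume "a \<in> XX" "b \<in> Y" "a' \<in> XX" "b' \<in> Y" "a + P * b = a' + P * b'"
      then show "a = a' \<and> b = b'" using key[of a a' b b' 0] additive_zero[OF M(1)] by simp
    qed
    then have "card (?f ` (XX \<times> Y)) = card XX ^ Suc s"
      by (simp add: card_image card_cartesian_product Y)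
    moreover have "?f ` (XX \<times> Y) \<subseteq> M"
      using XX(2) Y(3) by (auto intro!: additive_add[OF M(1)] additive_of_nat_mult[OF M(1)])
    moreover have "\<forall>x\<in>?f ` (XX \<times> Y). \<forall>y\<in>?f ` (XX \<times> Y). \<forall>z\<in>M. x - y = P ^ Suc s * z \<longrightarrow> x = y"
      using key by fastforce
    ultimately show ?case using XX Y by (intro exI[of _ "?f ` (XX \<times> Y)"]) auto
  qed
  note Yex = this
  have "card XX ^ s \<le> q ^ c * q ^ s" for s
  proof -
    from Yex[of s] obtain Y where "finite Y \<and> card Y = card XX ^ s \<and> Y \<subseteq> M \<and>
        (\<forall>x\<in>Y. \<forall>y\<in>Y. \<forall>z\<in>M. x - y = P ^ s * z \<longrightarrow> x = y)" by (rule exE)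
    then have Y: "finite Y" "card Y = card XX ^ s" "Y \<subseteq> M"
      "\<And>x y z. x \<in> Y \<Longrightarrow> y \<in> Y \<Longrightarrow> z \<in> M \<Longrightarrow> x - y = P ^ s * z \<Longrightarrow> x = y" by blast+
    let ?Z = "(\<lambda>y. ip ^ s * y) ` Y"
    have "inj_on (\<lambda>y. ip ^ s * y) Y" by (rule inj_onI) (metis P_ip_power_cancel)
    then have "card ?Z = card XX ^ s" by (simp add: card_image Y)
    moreover have "?Z \<subseteq> enlarged (c + s)"
    proof -
      have "P ^ (c + s) * (ip ^ s * y) = P ^ c * y" for y
        by (simp add: power_add mult.assoc P_ip_power_cancel)
      then show ?thesis using Y(3) M(3) by (auto simp: enlarged_def)
    qed
    moreover have "x = y" if "x \<in> ?Z" "y \<in> ?Z" "x - y \<in> L" for x y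
    proof -
      obtain x' y' where xy: "x' \<in> Y" "y' \<in> Y" "x = ip ^ s * x'" "y = ip ^ s * y'" using \<open>x \<in> ?Z\<close> \<open>y \<in> ?Z\<close> by auto
      have "x' - y' = P ^ s * (x - y)" by (simp add: xy right_diff_distrib P_ip_power_cancel)
      then show ?thesis using Y(4) xy M(2) that by blast
    qed
    ultimately show ?thesis using card_separated_le[of ?Z "c + s"] by (simp add: power_add)
  qed
  then show ?thesis by (rule exponential_growth_contradiction) (use q_pos in simp)
qed

definition multipliers :: "'r set \<Rightarrow> 'r set" where
  "multipliers M = {x. \<forall>y\<in>M. x * y \<in> M}"

lemma multipliersI: "(\<And>y. y \<in> M \<Longrightarrow> x * y \<in> M) \<Longrightarrow> x \<in> multipliers M"
  and multipliersD: "x \<in> multipliers M \<Longrightarrow> y \<in> M \<Longrightarrow> x * y \<in> M"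
  by (auto simp: multipliers_def)

lemma multipliers_mult: "x \<in> multipliers M \<Longrightarrow> y \<in> multipliers M \<Longrightarrow> x * y \<in> multipliers M"
  by (auto simp: multipliers_def mult.assoc)

lemma multipliers_one: "1 \<in> multipliers M"
  by (auto simp: multipliers_def)

lemma multipliers_power: "x \<in> multipliers M \<Longrightarrow> x ^ k \<in> multipliers M"
  by (induction k) (auto simp: multipliers_one multipliers_mult)

lemma additive_multipliers: "additive M \<Longrightarrow> additive (multipliers M)"
  unfolding additive_def multipliers_def by (simp add: left_diff_distrib)

text \<open>For \<open>x \<in> M\<close>, two of the \<open>q + 1\<close> elements \<open>x, h x, \<dots>, h\<^sup>q x\<close> are congruent modulo \<open>p\<close>. From
  there on the sequence \<open>h\<^sup>i x\<close> is periodic modulo \<open>p\<close>. The preperiod and the period depend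
  on \<open>x\<close> but are at most \<open>q\<close>, so that \<open>q!\<close> is at least the former and a multiple of the
  latter.\<close>
lemma idempotent_mod_p:
  assumes M: "additive M" "L \<subseteq> M" "M \<subseteq> enlarged c" and h: "h \<in> multipliers M"
  defines "e \<equiv> h ^ fact q"
  shows "\<exists>z\<in>multipliers M. e * e - e = P * z"
proof -
  have main: "\<exists>z\<in>M. (e * e - e) * x = P * z" if x: "x \<in> M" for x
  proof -
    have hx: "h ^ i * x \<in> M" for i using multipliers_power[OF h] x multipliersD by blast
    have "\<exists>i j. i < j \<and> j \<le> q \<and> (\<exists>z\<in>M. h ^ i * x - h ^ j * x = P * z)"
    proof (rule ccontr)
      assume no: "\<not> ?thesis"
      let ?XX = "(\<lambda>i. h ^ i * x) ` {..q}"
      have no': "i = j" if ij: "i \<le> q" "j \<le> q" "z \<in> M" "h ^ i * x - h ^ j * x = P * z" for i j z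
      proof (rule ccontr)
        assume "i \<noteq> j"
        moreover have "h ^ j * x - h ^ i * x = P * (- z)"
          using ij(4) by (metis minus_diff_eq mult_minus_right)
        ultimately show False using no ij additive_uminus[OF M(1) ij(3)] by (metis nat_neq_iff)
      qed
      have "inj_on (\<lambda>i. h ^ i * x) {..q}"
        by (rule inj_onI) (use no'[where z = 0] additive_zero[OF M(1)] in auto)
      then have "card ?XX = Suc q" by (simp add: card_image)
      moreover have "card ?XX \<le> q"
      proof (rule card_residues_le[OF M])
        show "?XX \<subseteq> M" using hx by blast
        show "a = b" if "a \<in> ?XX" "b \<in> ?XX" "z \<in> M" "a - b = P * z" for a b z
          using that no' by auto
      qed auto
      ultimately show False by simp
    qed
    then obtain i j z where ij: "i < j" "j \<le> q" "z \<in> M" "h ^ i * x - h ^ j * x = P * z" by blast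
    define d where "d = j - i"
    have step: "\<exists>z\<in>M. h ^ n * x - h ^ (n + d) * x = P * z" if "i \<le> n" for n
    proof -
      define r where "r = n - i"
      have r: "n = r + i" "n + d = r + j" using that ij(1) by (auto simp: r_def d_def)
      have "h ^ n * x - h ^ (n + d) * x = h ^ r * (h ^ i * x - h ^ j * x)"
        unfolding r(2) unfolding r(1) by (simp only: power_add right_diff_distrib mult.assoc)
      also have "\<dots> = P * (h ^ r * z)" by (simp only: ij(4) P_left_commute)
      finally show ?thesis using multipliersD[OF multipliers_power[OF h] ij(3)] by blast
    qed
    have steps: "\<exists>z\<in>M. h ^ n * x - h ^ (n + d * t) * x = P * z" if le: "i \<le> n" for n t
    proof (induction t)
      case 0 then show ?case using additive_zero[OF M(1)] by (intro bexI[of _ 0]) auto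
    next
      case (Suc t)
      then obtain z where z: "z \<in> M" "h ^ n * x - h ^ (n + d * t) * x = P * z" by blast
      obtain z' where z': "z' \<in> M" "h ^ (n + d * t) * x - h ^ (n + d * t + d) * x = P * z'"
        using step[OF trans_le_add1[OF le]] by blast
      have "h ^ n * x - h ^ (n + d * Suc t) * x = P * (z + z')"
        using z(2) z'(2) by (simp add: distrib_left algebra_simps)
      then show ?case using additive_add[OF M(1) z(1) z'(1)] by blast
    qed
    have "d dvd fact q" by (rule dvd_fact) (use ij in \<open>auto simp: d_def\<close>)
    then obtain t where t: "fact q = d * t" by blast
    have "i \<le> fact q" using ij fact_ge_self[of q] by linarith
    from steps[OF this, of t] obtain z where z: "z \<in> M"
      "h ^ fact q * x - h ^ (fact q + fact q) * x = P * z" by (auto simp: t[symmetric])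
    have "(e * e - e) * x = - (h ^ fact q * x - h ^ (fact q + fact q) * x)"
      by (simp add: e_def left_diff_distrib power_add)
    then have "(e * e - e) * x = P * (- z)" by (simp add: z(2))
    then show ?thesis using additive_uminus[OF M(1) z(1)] by blast
  qed
  have "ip * (e * e - e) \<in> multipliers M"
  proof (rule multipliersI)
    fix y assume "y \<in> M"
    then obtain z where "z \<in> M" "(e * e - e) * y = P * z" using main by blast
    then show "ip * (e * e - e) * y \<in> M" by (metis mult.assoc mult_1 p_inverse)
  qed
  moreover have "e * e - e = P * (ip * (e * e - e))" by (metis P_ip mult.assoc mult_1)
  ultimately show ?thesis by blast
qed

lemma power_diff_factor:
  fixes x y :: 'r
  assumes "x * y = y * x"
  shows "x ^ n - y ^ n = (x - y) * (\<Sum>i<n. x ^ i * y ^ (n - Suc i))"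
proof (induction n)
  case 0 then show ?case by simp
next
  case (Suc n)
  have "(\<Sum>i<Suc n. x ^ i * y ^ (Suc n - Suc i)) = (\<Sum>i<n. x ^ i * y ^ (n - Suc i)) * y + x ^ n"
    by (simp add: sum_distrib_right mult.assoc power_Suc2[symmetric] Suc_diff_Suc del: power_Suc)
  then have "(x - y) * (\<Sum>i<Suc n. x ^ i * y ^ (Suc n - Suc i)) = (x ^ n - y ^ n) * y + (x - y) * x ^ n"
    by (simp add: distrib_left mult.assoc[symmetric] Suc)
  also have "\<dots> = x ^ Suc n - y ^ Suc n"
    using power_commuting_commutes[OF assms, of n] by (simp add: algebra_simps power_Suc2[symmetric] del: power_Suc) (simp add: power_commutes)
  finally show ?case by simp
qed

text \<open>In \<open>x\<^sup>p - y\<^sup>p = (x - y) (x\<^bsup>p - 1\<^esup> + \<dots> + y\<^bsup>p - 1\<^esup>)\<close> all \<open>p\<close> summands of the second factor are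
  congruent to \<open>y\<^bsup>p - 1\<^esup>\<close> modulo \<open>p\<close>, so their sum is divisible by \<open>p\<close>.\<close>
lemma congruence_power_p:
  assumes M: "additive M" and x: "x \<in> multipliers M" and y: "y \<in> multipliers M"
    and comm: "x * y = y * x" and z: "z \<in> multipliers M" "x - y = P ^ Suc i * z"
  shows "\<exists>w\<in>multipliers M. x ^ p - y ^ p = P ^ Suc (Suc i) * w"
proof -
  note add = additive_multipliers[OF M]
  have pw: "\<exists>w\<in>multipliers M. x ^ j - y ^ j = P * w" for j
  proof -
    have "(\<Sum>i<j. x ^ i * y ^ (j - Suc i)) \<in> multipliers M"
      by (intro additive_sum[OF add] multipliers_mult multipliers_power x y)
    moreover have "x ^ j - y ^ j = P * ((P ^ i * z) * (\<Sum>i<j. x ^ i * y ^ (j - Suc i)))"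
      by (simp add: power_diff_factor[OF comm] z mult.assoc)
    moreover have "P ^ i * z \<in> multipliers M" using additive_P_power[OF add] z by blast
    ultimately show ?thesis using multipliers_mult by blast
  qed
  have summand: "\<exists>w\<in>multipliers M. x ^ i * y ^ (p - Suc i) - y ^ (p - 1) = P * w" if i: "i < p" for i
  proof -
    obtain w where w: "w \<in> multipliers M" "x ^ i - y ^ i = P * w" using pw by blast
    have "x ^ i * y ^ (p - Suc i) - y ^ (p - 1) = (x ^ i - y ^ i) * y ^ (p - Suc i)"
      using i by (simp add: left_diff_distrib power_add[symmetric])
    also have "\<dots> = P * (w * y ^ (p - Suc i))" by (simp add: w mult.assoc)
    finally show ?thesis using multipliers_mult[OF w(1) multipliers_power[OF y]] by blast
  qed
  then obtain w where w: "\<And>i. i < p \<Longrightarrow> w i \<in> multipliers M \<and> x ^ i * y ^ (p - Suc i) - y ^ (p - 1) = P * w i"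
    by metis
  have "(\<Sum>i<p. x ^ i * y ^ (p - Suc i)) = (\<Sum>i<p. y ^ (p - 1) + P * w i)"
    using w by (intro sum.cong) (auto simp: algebra_simps)
  also have "\<dots> = P * (y ^ (p - 1) + (\<Sum>i<p. w i))"
    by (simp add: sum.distrib distrib_left sum_distrib_left)
  finally have "x ^ p - y ^ p = P ^ Suc i * z * (P * (y ^ (p - 1) + (\<Sum>i<p. w i)))"
    by (simp add: power_diff_factor[OF comm] z)
  also have "\<dots> = P ^ Suc (Suc i) * (z * (y ^ (p - 1) + (\<Sum>i<p. w i)))"
    by (simp only: power_Suc2[of _ "Suc i"] mult.assoc P_left_commute)
  finally show ?thesis
  proof (rule bexI)
    show "z * (y ^ (p - 1) + (\<Sum>i<p. w i)) \<in> multipliers M"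
      by (intro multipliers_mult z(1) additive_add[OF add] multipliers_power[OF y] additive_sum[OF add])
         (use w in blast)
  qed
qed

lemma power_p_idempotent:
  assumes M: "additive M" and x: "x \<in> multipliers M" and z: "z \<in> multipliers M" "x * x - x = P * z"
  shows "\<exists>w\<in>multipliers M. x ^ p ^ j * x ^ p ^ j - x ^ p ^ j = P ^ Suc j * w"
proof (induction j)
  case 0 then show ?case using z by auto
next
  case (Suc j)
  then obtain w where w: "w \<in> multipliers M" "x ^ p ^ j * x ^ p ^ j - x ^ p ^ j = P ^ Suc j * w" by blast
  let ?y = "x ^ p ^ j"
  have "\<exists>w\<in>multipliers M. (?y * ?y) ^ p - ?y ^ p = P ^ Suc (Suc j) * w"
    by (rule congruence_power_p[OF M _ _ _ w]) (auto intro: multipliers_mult multipliers_power x simp: mult.assoc)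
  moreover have "?y ^ p = x ^ p ^ Suc j" by (simp add: power_mult[symmetric] mult.commute)
  moreover have "(?y * ?y) ^ p = ?y ^ p * ?y ^ p"
    by (simp add: power_mult[symmetric] power_add[symmetric] algebra_simps)
  ultimately show ?case by simp
qed

lemma idempotent_power:
  assumes M: "additive M" and e: "e \<in> multipliers M" and z: "z \<in> multipliers M" "e * e - e = P * z"
  shows "\<exists>w\<in>multipliers M. e ^ Suc s - e = P * w"
proof (induction s)
  case 0 then show ?case using additive_zero[OF additive_multipliers[OF M]] by (intro bexI[of _ 0]) auto
next
  case (Suc s)
  then obtain w where w: "w \<in> multipliers M" "e ^ Suc s - e = P * w" by blast
  have "e ^ Suc (Suc s) - e = (e ^ Suc s - e) * e + (e * e - e)"
    by (simp add: algebra_simps power_commutes)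
  also have "\<dots> = P * (w * e + z)" by (simp only: w(2) z(2) distrib_left mult.assoc)
  finally show ?case
    using additive_add[OF additive_multipliers[OF M] multipliers_mult[OF w(1) e] z(1)] by blast
qed

text \<open>The factor \<open>q!\<close> produces idempotents modulo \<open>p\<close>, the factor \<open>p\<close> improves congruences.\<close>
definition m :: nat where "m = p * fact q"

text \<open>The exponent \<open>m\<^bsup>j + 1\<^esup>\<close> is \<open>q! \<cdot> q!\<^sup>j \<cdot> p\<^bsup>j + 1\<^esup>\<close>. The first two factors lead to an element
  \<open>x\<close> that is idempotent modulo \<open>p\<close>, and the last one turns this into a congruence modulo a
  higher power.\<close>
lemma divisible_contraction:
  assumes M: "additive M" "L \<subseteq> M" "M \<subseteq> enlarged c" and h: "h \<in> multipliers M"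
    and g: "g = h ^ (m ^ Suc j)"
  shows "\<exists>w\<in>multipliers M. g * g - g = P ^ Suc j * w"
proof -
  define e where "e = h ^ fact q"
  obtain z where z: "z \<in> multipliers M" "e * e - e = P * z"
    using idempotent_mod_p[OF M h] unfolding e_def by blast
  have e: "e \<in> multipliers M" unfolding e_def using multipliers_power h by blast
  note add = additive_multipliers[OF M(1)]
  define s where "s = fact q ^ j - (1::nat)"
  have s: "Suc s = fact q ^ j" by (simp add: s_def)
  define x where "x = e ^ Suc s"
  have x: "x \<in> multipliers M" unfolding x_def using multipliers_power e by blast
  have "Suc s + Suc s = Suc (Suc (2 * s))" by simp
  then have "x * x = e ^ Suc (Suc (2 * s))" unfolding x_def by (metis power_add)
  then have "\<exists>w\<in>multipliers M. x * x - e = P * w" using idempotent_power[OF M(1) e z, of "Suc (2 * s)"] by simp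
  moreover have "\<exists>w\<in>multipliers M. x - e = P * w"
    unfolding x_def by (rule idempotent_power[OF M(1) e z])
  ultimately obtain w1 w2 where w: "w1 \<in> multipliers M" "w2 \<in> multipliers M"
    "x * x - e = P * w1" "x - e = P * w2" by blast
  have "x * x - x = P * (w1 - w2)" using w(3,4) by (simp add: right_diff_distrib algebra_simps)
  then obtain w where w: "w \<in> multipliers M"
      "x ^ p ^ Suc j * x ^ p ^ Suc j - x ^ p ^ Suc j = P ^ Suc (Suc j) * w"
    using power_p_idempotent[OF M(1) x additive_diff[OF add w(1,2)]] by blast
  have "x ^ p ^ Suc j = g"
    by (simp add: x_def e_def g m_def s power_mult[symmetric] power_mult_distrib del: power_Suc)
       (simp add: algebra_simps)
  then have "g * g - g = P ^ Suc j * (P * w)" using w by (simp add: P_power_commute mult.assoc)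
  then show ?thesis using w additive_of_nat_mult[OF add] by blast
qed

text \<open>The recurrence gives \<open>y\<^sup>a = y\<^sup>i w\<^sup>i y\<^sup>a\<close> for all \<open>i\<close>. The denominators of \<open>w\<^sup>i\<close> grow at most
  like \<open>p\<^bsup>d i\<^esup>\<close>, whereas \<open>y\<^sup>i\<close> is divisible by \<open>p\<^bsup>(d + 1) i\<^esup>\<close> up to a constant factor. So
  \<open>y\<^sup>a\<close> is divisible by every power of \<open>p\<close>.\<close>
lemma fast_decay_nilpotent:
  assumes decay: "\<And>j. \<exists>c. \<forall>i. \<forall>l\<in>L. \<exists>z\<in>L. P ^ c * (y ^ i * l) = P ^ (j * i) * z"
    and rec: "y ^ a = y ^ Suc a * w" and comm: "w * y = y * w"
  shows "y ^ a = 0"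
proof -
  have rec': "y ^ a = y ^ i * (w ^ i * y ^ a)" for i
  proof (induction i)
    case 0 then show ?case by simp
  next
    case (Suc i)
    have "y ^ a * w = w * y ^ a" by (rule power_commuting_commutes) (rule comm[symmetric])
    then have "y ^ Suc a * w = y * (w * y ^ a)" by (simp add: mult.assoc)
    then have "y ^ a = y * (w * y ^ a)" using rec by (rule trans[rotated])
    then have "w ^ i * y ^ a = w ^ i * (y * (w * y ^ a))" by (rule arg_cong)
    also have "\<dots> = y * (w ^ i * (w * y ^ a))"
      using power_commuting_commutes[OF comm, of i] by (simp add: mult.assoc[symmetric])
    finally have "y ^ i * (w ^ i * y ^ a) = y ^ i * (y * (w ^ i * (w * y ^ a)))" by (rule arg_cong)
    with Suc have "y ^ a = y ^ i * (y * (w ^ i * (w * y ^ a)))" by (rule trans)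
    also have "\<dots> = y ^ Suc i * (w ^ Suc i * y ^ a)" by (simp only: mult.assoc power_Suc2)
    finally show ?case .
  qed
  obtain d where d: "\<And>l. l \<in> L \<Longrightarrow> P ^ d * (w * l) \<in> L" using L_bounded by blast
  obtain b where b: "\<And>l. l \<in> L \<Longrightarrow> P ^ b * (y ^ a * l) \<in> L" using L_bounded by blast
  obtain c where c: "\<And>i l. l \<in> L \<Longrightarrow> \<exists>z\<in>L. P ^ c * (y ^ i * l) = P ^ (Suc d * i) * z"
    using decay[of "Suc d"] by blast
  have "y ^ a * l = 0" if l: "l \<in> L" for l
  proof (rule L_separated)
    fix s
    define i where "i = c + b + s"
    have "P ^ (d * i) * (w ^ i * (P ^ b * (y ^ a * l))) \<in> L"
      using bounded_pow[OF d] b l by blast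
    then obtain z where z: "z \<in> L"
      "P ^ c * (y ^ i * (P ^ (d * i) * (w ^ i * (P ^ b * (y ^ a * l))))) = P ^ (Suc d * i) * z"
      using c by blast
    have "P ^ c * (y ^ i * (P ^ (d * i) * (w ^ i * (P ^ b * (y ^ a * l)))))
        = P ^ (d * i) * (P ^ c * (P ^ b * (y ^ i * (w ^ i * (y ^ a * l)))))"
      by (simp only: P_power_left_commute[of "y ^ i"] P_power_left_commute[of "w ^ i"]
            P_power_left_commute[of "P ^ c" "d * i"])
    also have "y ^ i * (w ^ i * (y ^ a * l)) = y ^ a * l" using arg_cong[OF rec'[of i], of "\<lambda>r. r * l"] by (simp only: mult.assoc)
    finally have "P ^ (d * i) * (P ^ c * (P ^ b * (y ^ a * l))) = P ^ (d * i) * (P ^ i * z)"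
      using z(2) by (simp add: power_add mult.assoc add.commute P_power_commute[of i])
    then have "P ^ c * (P ^ b * (y ^ a * l)) = P ^ i * z" using P_cancel by blast
    then have "P ^ (c + b) * (y ^ a * l) = P ^ (c + b) * (P ^ s * z)"
      by (simp add: i_def power_add mult.assoc)
    then have "y ^ a * l = P ^ s * z" using P_cancel by blast
    then show "\<exists>z\<in>L. y ^ a * l = P ^ s * z" using z by blast
  qed
  then show ?thesis using L_unit by (metis mult.assoc mult_1_right mult_zero_left)
qed

text \<open>Let \<open>y = g\<^sup>2 - g\<close> with \<open>g = g\<^sub>0\<close>. For every \<open>j\<close> a root of \<open>g\<close> of high order stabilises a
  lattice \<open>M\<close> with \<open>y M \<subseteq> p\<^sup>j M\<close>. The lattice depends on \<open>j\<close>, but it is squeezed between \<open>L\<close>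
  and some \<open>p\<^sup>-\<^sup>c L\<close>, so that with respect to \<open>L\<close> the powers of \<open>y\<close> decay faster than any
  exponential. Hence \<open>y = g (g - 1)\<close> is nilpotent, and as \<open>g\<close> is invertible, so is \<open>g - 1\<close>.\<close>
theorem divisible_imp_unipotent:
  fixes g :: "nat \<Rightarrow> 'r"
  assumes roots: "\<And>j. g (Suc j) ^ m = g j" and p: "p > 1"
    and inv: "g 0 * v = 1"
    and algebraic: "\<And>y :: 'r. \<exists>a w. y ^ a = y ^ Suc a * w \<and> w * y = y * w"
  shows "\<exists>a. (g 0 - 1) ^ a = 0"
proof -
  have roots': "g (k + j) ^ (m ^ j) = g k" for k j
  proof (induction j)
    case 0 then show ?case by simp
  next
    case (Suc j)
    have "g (k + Suc j) ^ (m ^ Suc j) = (g (Suc (k + j)) ^ m) ^ (m ^ j)"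
      by (simp add: power_mult)
    then show ?case using roots Suc by simp
  qed
  obtain a where a: "\<And>y. y \<in> L \<Longrightarrow> P ^ a * (g 0 * y) \<in> L" using L_bounded by blast
  have m2: "m \<ge> 2" using p fact_ge_1[of q] unfolding m_def
    by (metis One_nat_def Suc_1 Suc_leI fact_gt_zero less_le_trans mult_le_mono1 nat_mult_1_right mult_le_mono le_refl Suc_leI)
  obtain J where J: "q ^ a < 2 ^ J" using less_exp[of "q ^ a"] by blast
  define y where "y = g 0 * g 0 - g 0"
  have decay: "\<exists>c. \<forall>i. \<forall>l\<in>L. \<exists>z\<in>L. P ^ c * (y ^ i * l) = P ^ (j * i) * z" for j
  proof -
    \<comment> \<open>The summand \<open>J\<close> makes the root of order \<open>m\<^sup>n\<close> stabilise a lattice, the summand \<open>j\<close> gives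
      the divisibility by \<open>p\<^sup>j\<close>.\<close>
    define n where "n = Suc (J + j)"
    define h where "h = g n"
    have gh: "g 0 = h ^ (m ^ n)" using roots'[of 0 n] by (simp add: h_def)
    have "J \<le> m ^ n"
    proof -
      have "n \<le> 2 ^ n" using less_exp[of n] by simp
      also have "\<dots> \<le> m ^ n" by (rule power_mono) (use m2 in auto)
      finally show ?thesis by (simp add: n_def)
    qed
    then have "(2::nat) ^ J \<le> 2 ^ (m ^ n)" by simp
    then have "q ^ a < 2 ^ (m ^ n)" using J by linarith
    from stable_lattice_exists[OF gh a this]
    obtain M c where M: "additive M" "L \<subseteq> M" "M \<subseteq> enlarged c" "\<And>x. x \<in> M \<Longrightarrow> h * x \<in> M" by blast
    have h: "h \<in> multipliers M" using M by (simp add: multipliers_def)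
    obtain w where w: "w \<in> multipliers M" "y = P ^ n * w"
      using divisible_contraction[OF M(1-3) h, of "g 0" "J + j"] gh unfolding y_def n_def by blast
    have yi: "y ^ i = P ^ (n * i) * w ^ i" for i
      by (induction i) (simp_all add: w(2) power_add mult.assoc P_power_left_commute[of w])
    have "\<exists>z\<in>L. P ^ c * (y ^ i * l) = P ^ (j * i) * z" if "l \<in> L" for i l
    proof -
      have "w ^ i * l \<in> M" using multipliersD[OF multipliers_power[OF w(1)]] M that by blast
      then have 1: "P ^ c * (w ^ i * l) \<in> L" using M by (auto simp: enlarged_def)
      have "n * i = j * i + Suc J * i" by (simp add: n_def algebra_simps)
      then have "P ^ c * (y ^ i * l) = P ^ (j * i) * (P ^ (Suc J * i) * (P ^ c * (w ^ i * l)))"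
        by (simp only: yi power_add mult.assoc P_power_left_commute[of "P ^ c"])
      then show ?thesis using additive_P_power[OF additive_L 1] by blast
    qed
    then show ?thesis by blast
  qed
  obtain b w where bw: "y ^ b = y ^ Suc b * w" "w * y = y * w" using algebraic by blast
  have 0: "y ^ b = 0" using fast_decay_nilpotent[OF decay bw] .
  have "y = g 0 * (g 0 - 1)" by (simp add: y_def right_diff_distrib)
  moreover have "(g 0 * (g 0 - 1)) ^ b = (g 0 - 1) ^ b * g 0 ^ b"
  proof -
    have "(g 0 - 1) * g 0 = g 0 * (g 0 - 1)" by (simp add: algebra_simps)
    then show ?thesis
    proof (induction b)
      case (Suc b)
      then show ?case
        by (metis (no_types, lifting) mult.assoc power_Suc2 power_commuting_commutes)
    qed simp
  qed
  ultimately have "(g 0 - 1) ^ b * g 0 ^ b = 0" using 0 by simp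
  moreover have "g 0 ^ b * v ^ b = 1" using inv left_right_inverse_power[of "g 0" v] by simp
  ultimately have "(g 0 - 1) ^ b = 0" by (metis mult.assoc mult_1_right mult_zero_left)
  then show ?thesis by blast
qed

end

section \<open>Lattices in finite extensions of a valued field\<close>

text \<open>Here \<open>F\<close> is the image of \<open>\<rat>\<close> or \<open>\<rat>\<^sub>p\<close> in an extension field, and \<open>\<O>\<close> that of its valuation
  ring.\<close>
locale valued_subfield =
  fixes p :: nat and F \<O> :: "'k::field set"
  assumes p_nonzero: "of_nat p \<noteq> (0::'k)"
    and F_closed: "1 \<in> F" "x \<in> F \<Longrightarrow> y \<in> F \<Longrightarrow> x - y \<in> F" "x \<in> F \<Longrightarrow> y \<in> F \<Longrightarrow> x * y \<in> F"
      "x \<in> F \<Longrightarrow> inverse x \<in> F"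
    and O_subset: "\<O> \<subseteq> F"
    and O_closed: "1 \<in> \<O>" "x \<in> \<O> \<Longrightarrow> y \<in> \<O> \<Longrightarrow> x - y \<in> \<O>" "x \<in> \<O> \<Longrightarrow> y \<in> \<O> \<Longrightarrow> x * y \<in> \<O>"
    and O_fractions: "x \<in> F \<Longrightarrow> \<exists>c. of_nat p ^ c * x \<in> \<O>"
    and O_residues: "x \<in> \<O> \<Longrightarrow> \<exists>i<p. \<exists>z\<in>\<O>. x = of_nat i + of_nat p * z"
    and O_separated: "(\<And>c. \<exists>z\<in>\<O>. x = of_nat p ^ c * z) \<Longrightarrow> x = 0"
begin

abbreviation P :: 'k where "P \<equiv> of_nat p"

definition submodule :: "'k set \<Rightarrow> 'k set \<Rightarrow> bool" where
  "submodule A M \<longleftrightarrow> 0 \<in> M \<and> (\<forall>x\<in>M. \<forall>y\<in>M. x - y \<in> M) \<and> (\<forall>a\<in>A. \<forall>x\<in>M. a * x \<in> M)"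

lemma submoduleD:
  assumes "submodule A M"
  shows "0 \<in> M" "x \<in> M \<Longrightarrow> y \<in> M \<Longrightarrow> x - y \<in> M" "a \<in> A \<Longrightarrow> x \<in> M \<Longrightarrow> a * x \<in> M"
    "x \<in> M \<Longrightarrow> - x \<in> M" "x \<in> M \<Longrightarrow> y \<in> M \<Longrightarrow> x + y \<in> M"
proof -
  have 0: "0 \<in> M" and d: "\<And>x y. x \<in> M \<Longrightarrow> y \<in> M \<Longrightarrow> x - y \<in> M"
    using assms by (auto simp: submodule_def)
  have m: "- x \<in> M" if "x \<in> M" for x using d[OF 0 that] by simp
  show "0 \<in> M" by (rule 0)
  show "x \<in> M \<Longrightarrow> y \<in> M \<Longrightarrow> x - y \<in> M" by (rule d)
  show "a \<in> A \<Longrightarrow> x \<in> M \<Longrightarrow> a * x \<in> M" using assms by (auto simp: submodule_def)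
  show "x \<in> M \<Longrightarrow> - x \<in> M" by (rule m)
  show "x \<in> M \<Longrightarrow> y \<in> M \<Longrightarrow> x + y \<in> M" using d[OF _ m, of x y] by simp
qed

lemma submodule_self: "submodule \<O> \<O>" "submodule F F"
  unfolding submodule_def using O_closed F_closed by (metis diff_self)+

lemma P_in_O: "P ^ c \<in> \<O>"
proof -
  have "of_nat n \<in> \<O>" for n
    by (induction n) (use O_closed submoduleD[OF submodule_self(1)] in auto)
  from this[of "p ^ c"] show ?thesis by simp
qed

lemma P_power_submodule: "submodule \<O> M \<Longrightarrow> x \<in> M \<Longrightarrow> P ^ c * x \<in> M"
  using submoduleD(3) P_in_O by blast

text \<open>The last conjunct is finite generation over \<open>\<O>\<close>, in terms of the submodules that contain the
  generators.\<close>
definition lattice_in :: "'k set \<Rightarrow> 'k set \<Rightarrow> bool" where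
  "lattice_in E R \<longleftrightarrow> submodule \<O> R \<and> R \<subseteq> E \<and> (\<forall>x\<in>E. \<exists>c. P ^ c * x \<in> R)
    \<and> (\<exists>T. finite T \<and> (\<forall>x\<in>R. \<exists>t\<in>T. \<exists>z\<in>R. x = t + P * z))
    \<and> (\<forall>x. (\<forall>c. \<exists>z\<in>R. x = P ^ c * z) \<longrightarrow> x = 0)
    \<and> (\<exists>B. finite B \<and> (\<forall>S. submodule \<O> S \<longrightarrow> B \<subseteq> S \<longrightarrow> R \<subseteq> S))"

lemma lattice_inD:
  assumes "lattice_in E R"
  shows "submodule \<O> R" "R \<subseteq> E" "x \<in> E \<Longrightarrow> \<exists>c. P ^ c * x \<in> R"
    "(\<And>c. \<exists>z\<in>R. x = P ^ c * z) \<Longrightarrow> x = 0"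
    "\<exists>T. finite T \<and> (\<forall>x\<in>R. \<exists>t\<in>T. \<exists>z\<in>R. x = t + P * z)"
    "\<exists>B. finite B \<and> (\<forall>S. submodule \<O> S \<longrightarrow> B \<subseteq> S \<longrightarrow> R \<subseteq> S)"
proof -
  note R = assms[unfolded lattice_in_def]
  from R show "submodule \<O> R" by (elim conjE)
  from R show "R \<subseteq> E" by (elim conjE)
  from R show "\<exists>T. finite T \<and> (\<forall>x\<in>R. \<exists>t\<in>T. \<exists>z\<in>R. x = t + P * z)" by (elim conjE)
  from R show "\<exists>B. finite B \<and> (\<forall>S. submodule \<O> S \<longrightarrow> B \<subseteq> S \<longrightarrow> R \<subseteq> S)" by (elim conjE)
  from R have frac: "\<forall>x\<in>E. \<exists>c. P ^ c * x \<in> R" by (elim conjE)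
  from R have sep: "\<forall>x. (\<forall>c. \<exists>z\<in>R. x = P ^ c * z) \<longrightarrow> x = 0" by (elim conjE)
  show "x \<in> E \<Longrightarrow> \<exists>c. P ^ c * x \<in> R" using frac by (rule bspec)
  show "(\<And>c. \<exists>z\<in>R. x = P ^ c * z) \<Longrightarrow> x = 0" using sep by simp
qed

lemma lattice_in_zero: "lattice_in {0} {0}"
  unfolding lattice_in_def by (auto simp: submodule_def intro: exI[of _ "{0}"])

text \<open>The direct sum of \<open>R\<close> and \<open>\<O> v\<close>: as \<open>v\<close> is not in \<open>E\<close>, the coordinates are unique, and all
  the properties can be checked coordinatewise.\<close>
lemma lattice_in_extend:
  assumes E: "submodule F E" and R: "lattice_in E R" and v: "v \<notin> E"
  shows "lattice_in {k * v + e | k e. k \<in> F \<and> e \<in> E} {a * v + r | a r. a \<in> \<O> \<and> r \<in> R}"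
    (is "lattice_in ?E ?R")
proof -
  have R': "submodule \<O> R" "R \<subseteq> E" "\<And>x. x \<in> E \<Longrightarrow> \<exists>c. P ^ c * x \<in> R"
    and sep: "\<And>x. (\<And>c. \<exists>z\<in>R. x = P ^ c * z) \<Longrightarrow> x = 0"
    by (fact lattice_inD[OF R])+
  obtain T where T: "finite T" "\<And>x. x \<in> R \<Longrightarrow> \<exists>t\<in>T. \<exists>z\<in>R. x = t + P * z"
    using lattice_inD(5)[OF R] by blast
  obtain B where B: "finite B" "\<And>S. submodule \<O> S \<Longrightarrow> B \<subseteq> S \<Longrightarrow> R \<subseteq> S"
    using lattice_inD(6)[OF R] by blast
  note OM = submoduleD[OF submodule_self(1)] and RM = submoduleD[OF R'(1)] and EM = submoduleD[OF E]
  have coeff: "a = b \<and> r = s" if "a \<in> F" "b \<in> F" "r \<in> E" "s \<in> E" "a * v + r = b * v + s" for a b r s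
  proof -
    have "a = b"
    proof (rule ccontr)
      assume "a \<noteq> b"
      have "(a - b) * v = s - r" using that(5) by (simp add: algebra_simps)
      then have "v = inverse (a - b) * (s - r)" using \<open>a \<noteq> b\<close> by (simp add: field_simps)
      moreover have "inverse (a - b) * (s - r) \<in> E" using that F_closed EM by simp
      ultimately show False using v by simp
    qed
    then show ?thesis using that by simp
  qed
  have 1: "submodule \<O> ?R"
    unfolding submodule_def
  proof (intro conjI ballI)
    show "0 \<in> ?R" using OM(1) RM(1) by force
    fix x assume "x \<in> ?R"
    then obtain a r where x: "x = a * v + r" "a \<in> \<O>" "r \<in> R" by blast
    show "b * x \<in> ?R" if b: "b \<in> \<O>" for b
    proof -
      have "b * x = (b * a) * v + b * r" by (simp add: x algebra_simps)
      then show ?thesis using x b O_closed(3) RM(3) by blast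
    qed
    fix y assume "y \<in> ?R"
    then obtain a' r' where y: "y = a' * v + r'" "a' \<in> \<O>" "r' \<in> R" by blast
    have "x - y = (a - a') * v + (r - r')" by (simp add: x y algebra_simps)
    then show "x - y \<in> ?R" using x y O_closed(2) RM(2) by blast
  qed
  have 2: "?R \<subseteq> ?E" using O_subset R'(2) by blast
  have 3: "\<exists>c. P ^ c * x \<in> ?R" if xE: "x \<in> ?E" for x
  proof -
    obtain k e where x: "x = k * v + e" "k \<in> F" "e \<in> E" using xE by blast
    obtain c d where cd: "P ^ c * k \<in> \<O>" "P ^ d * e \<in> R" using O_fractions R'(3) x by blast
    have "P ^ (c + d) * x = (P ^ d * (P ^ c * k)) * v + P ^ c * (P ^ d * e)"
      by (simp add: x power_add algebra_simps)
    moreover have "P ^ d * (P ^ c * k) \<in> \<O>" "P ^ c * (P ^ d * e) \<in> R"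
      using cd P_power_submodule submodule_self R'(1) by blast+
    ultimately show ?thesis by blast
  qed
  have 4: "\<exists>T. finite T \<and> (\<forall>x\<in>?R. \<exists>t\<in>T. \<exists>z\<in>?R. x = t + P * z)"
  proof (intro exI conjI ballI)
    show "finite ((\<lambda>(i, t). of_nat i * v + t) ` ({..<p} \<times> T))" using T by simp
    fix x assume "x \<in> ?R"
    then obtain a r where x: "x = a * v + r" "a \<in> \<O>" "r \<in> R" by blast
    obtain i z where i: "i < p" "z \<in> \<O>" "a = of_nat i + P * z" using O_residues x by blast
    obtain t z' where t: "t \<in> T" "z' \<in> R" "r = t + P * z'" using T(2) x by blast
    have "x = (of_nat i * v + t) + P * (z * v + z')" by (simp add: x i t algebra_simps)
    then show "\<exists>t\<in>(\<lambda>(i, t). of_nat i * v + t) ` ({..<p} \<times> T). \<exists>z\<in>?R. x = t + P * z"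
      using i t by (intro bexI[of _ "of_nat i * v + t"] bexI[of _ "z * v + z'"]) auto
  qed
  have 5: "x = 0" if x: "\<And>c. \<exists>z\<in>?R. x = P ^ c * z" for x
  proof -
    obtain a r where ar: "x = a * v + r" "a \<in> \<O>" "r \<in> R" using x[of 0] by auto
    have "(\<exists>z\<in>\<O>. a = P ^ c * z) \<and> (\<exists>z\<in>R. r = P ^ c * z)" for c
    proof -
      obtain a' r' where ar': "x = P ^ c * (a' * v + r')" "a' \<in> \<O>" "r' \<in> R" using x[of c] by blast
      have "P ^ c * a' \<in> \<O>" "P ^ c * r' \<in> R" using ar' P_power_submodule submodule_self R'(1) by blast+
      moreover have "a * v + r = (P ^ c * a') * v + P ^ c * r'" using ar(1) ar'(1) by (simp add: algebra_simps)
      ultimately have "a = P ^ c * a' \<and> r = P ^ c * r'"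
        using ar ar' O_subset R'(2) by (intro coeff) auto
      then show ?thesis using ar' by blast
    qed
    then show ?thesis using O_separated[of a] sep[of r] ar(1) by simp
  qed
  have 6: "\<exists>B. finite B \<and> (\<forall>S. submodule \<O> S \<longrightarrow> B \<subseteq> S \<longrightarrow> ?R \<subseteq> S)"
  proof (intro exI conjI allI impI subsetI)
    show "finite (insert v B)" using B by simp
    fix S x assume S: "submodule \<O> S" "insert v B \<subseteq> S" and "x \<in> ?R"
    then obtain a r where x: "x = a * v + r" "a \<in> \<O>" "r \<in> R" by blast
    have "r \<in> S" using B(2)[OF S(1)] S(2) x by blast
    then show "x \<in> S" unfolding x(1) using S(2) x(2) by (intro submoduleD(5)[OF S(1)] submoduleD(3)[OF S(1)]) auto
  qed
  show ?thesis unfolding lattice_in_def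
    by (intro conjI allI ballI impI 1 2 4 6) (use 3 5 in blast)+
qed

lemma dimension_imp_lattice:
  assumes "ring.dimension (ring_of_type_algebra :: 'k ring) n F E"
  shows "submodule F E \<and> (\<exists>R. lattice_in E R)"
proof -
  interpret A: ring "ring_of_type_algebra :: 'k ring" by (rule ring_from_type_algebra)
  define K where "K = F"
  from assms have "A.dimension n K E" by (simp add: K_def)
  then show ?thesis using K_def
  proof (induction rule: A.dimension.induct)
    case zero_dim
    have "\<zero>\<^bsub>(ring_of_type_algebra :: 'k ring)\<^esub> = 0" by (simp add: ring_of_type_algebra_def)
    then show ?case using lattice_in_zero by (auto simp: submodule_def)
  next
    case (Suc_dim v E n K)
    have K: "K = F" by fact
    have eq: "A.line_extension F v E = {k * v + e | k e. k \<in> F \<and> e \<in> E}"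
      unfolding A.line_extension_def by (auto simp: set_add_def set_mult_def r_coset_def ring_of_type_algebra_def)
    have E: "submodule F E" using Suc_dim by blast
    note EM = submoduleD[OF E] and FM = submoduleD[OF submodule_self(2)]
    have "submodule F {k * v + e | k e. k \<in> F \<and> e \<in> E}"
      unfolding submodule_def
    proof (intro conjI ballI)
      show "0 \<in> {k * v + e | k e. k \<in> F \<and> e \<in> E}" using EM(1) FM(1) by force
      fix x assume "x \<in> {k * v + e | k e. k \<in> F \<and> e \<in> E}"
      then obtain a r where x: "x = a * v + r" "a \<in> F" "r \<in> E" by blast
      show "b * x \<in> {k * v + e | k e. k \<in> F \<and> e \<in> E}" if b: "b \<in> F" for b
      proof -
        have "b * x = (b * a) * v + b * r" by (simp add: x algebra_simps)
        then show ?thesis using x b F_closed(3) EM(3) by blast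
      qed
      fix y assume "y \<in> {k * v + e | k e. k \<in> F \<and> e \<in> E}"
      then obtain a' r' where y: "y = a' * v + r'" "a' \<in> F" "r' \<in> E" by blast
      have "x - y = (a - a') * v + (r - r')" by (simp add: x y algebra_simps)
      then show "x - y \<in> {k * v + e | k e. k \<in> F \<and> e \<in> E}" using x y F_closed(2) EM(2) by blast
    qed
    then show ?case unfolding K eq using lattice_in_extend[OF E] Suc_dim by blast
  qed
qed

text \<open>For fixed \<open>c\<close> the \<open>y\<close> with \<open>p\<^sup>c x y \<in> R\<close> form a submodule, so it suffices to clear the
  denominators of the products of \<open>x\<close> with finitely many generators.\<close>
lemma lattice_multiplication_bounded:
  assumes R: "lattice_in UNIV R"
  shows "\<exists>c. \<forall>y\<in>R. P ^ c * (x * y) \<in> R"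
proof -
  have RO: "submodule \<O> R" using R by (simp add: lattice_in_def)
  obtain B where B: "finite B" "\<And>S. submodule \<O> S \<Longrightarrow> B \<subseteq> S \<Longrightarrow> R \<subseteq> S"
    using lattice_inD(6)[OF R] by blast
  have "\<exists>c. \<forall>b\<in>B. P ^ c * (x * b) \<in> R" using B(1)
  proof (induction B rule: finite_induct)
    case (insert b B)
    then obtain c where c: "\<forall>b\<in>B. P ^ c * (x * b) \<in> R" by blast
    obtain d where d: "P ^ d * (x * b) \<in> R" using lattice_inD(3)[OF R] by blast
    have "P ^ (c + d) * (x * b') \<in> R" if "b' \<in> insert b B" for b'
    proof (cases "b' = b")
      case True
      then show ?thesis using P_power_submodule[OF RO d, of c] by (simp add: power_add mult.assoc)
    next
      case False
      then have "P ^ c * (x * b') \<in> R" using c that by blast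
      then have "P ^ d * (P ^ c * (x * b')) \<in> R" by (rule P_power_submodule[OF RO])
      moreover have "P ^ (c + d) * (x * b') = P ^ d * (P ^ c * (x * b'))"
        by (simp add: power_add algebra_simps)
      ultimately show ?thesis by (simp only:)
    qed
    then show ?case by blast
  qed simp
  then obtain c where c: "\<forall>b\<in>B. P ^ c * (x * b) \<in> R" by blast
  have "submodule \<O> {y. P ^ c * (x * y) \<in> R}"
    unfolding submodule_def using submoduleD[OF RO]
    by (auto simp: right_diff_distrib mult.left_commute)
  from B(2)[OF this] c show ?thesis by blast
qed

lemma sq_of_nat_entry: "sq_entry (of_nat m ^ c * A) i j = of_nat m ^ c * sq_entry A i j"
  for A :: "('k, 'n::finite) sqmat"
proof -
  have "of_nat m * A = sq_scale (of_nat m) A" for m :: nat and A :: "('k, 'n) sqmat"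
    by (induction m) (auto intro!: sq_eqI simp: algebra_simps)
  then show ?thesis by (metis of_nat_power sq_entry_simps(4))
qed

text \<open>In positive characteristic the powers of \<open>p\<close> take only finitely many values, so that \<open>p\<^sup>d =
  1\<close> for some \<open>d > 0\<close>, and one is divisible by all powers of \<open>p\<close>.\<close>
lemma char_zero:
  assumes "r > 0" shows "of_nat r \<noteq> (0::'k)"
proof
  assume r: "of_nat r = (0::'k)"
  have "P ^ c \<in> of_nat ` {..<r}" for c
  proof -
    have "of_nat (p ^ c) = (of_nat r * of_nat (p ^ c div r) + of_nat (p ^ c mod r) :: 'k)"
      by (metis mult_div_mod_eq of_nat_add of_nat_mult)
    then have "P ^ c = of_nat (p ^ c mod r)" using r by simp
    then show ?thesis using assms by simp
  qed
  then have "range (\<lambda>c. P ^ c) \<subseteq> of_nat ` {..<r}" by blast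
  then have "finite (range (\<lambda>c. P ^ c))" by (rule finite_subset) simp
  then have "\<not> inj (\<lambda>c. P ^ c)" using finite_imageD infinite_UNIV_nat by blast
  then obtain i j where ij: "i < j" "P ^ i = P ^ j" by (metis injI nat_neq_iff)
  define d where "d = j - i"
  have d: "d > 0" "j = i + d" using ij by (auto simp: d_def)
  have "P ^ i * P ^ d = P ^ i * 1" using ij(2) d(2) by (simp add: power_add)
  then have 1: "P ^ d = 1" using p_nonzero by simp
  have "(1::'k) = 0"
  proof (rule O_separated)
    fix c
    have "c \<le> d * c" using d by simp
    then have "P ^ c * P ^ (d * c - c) = P ^ (d * c)" by (simp add: power_add[symmetric])
    then have "1 = P ^ c * P ^ (d * c - c)" using 1 by (simp add: power_mult)
    then show "\<exists>z\<in>\<O>. 1 = P ^ c * z" using P_in_O by blast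
  qed
  then show False by simp
qed

text \<open>The lattice consists of the matrices with entries in a lattice of the field.\<close>
theorem matrix_ring_lattice:
  assumes "ring.finite_dimension (ring_of_type_algebra :: 'k ring) F UNIV"
  shows "\<exists>(L :: ('k, 'n::finite) sqmat set) T ip. ring_lattice p L T ip"
proof -
  interpret A: ring "ring_of_type_algebra :: 'k ring" by (rule ring_from_type_algebra)
  obtain n where "A.dimension n F UNIV" using assms A.finite_dimension_def by blast
  then obtain R where R: "lattice_in UNIV R" using dimension_imp_lattice by blast
  have RO: "submodule \<O> R" and sep: "\<And>x. (\<And>c. \<exists>z\<in>R. x = P ^ c * z) \<Longrightarrow> x = 0"
    by (fact lattice_inD[OF R])+
  note RM = submoduleD[OF RO]
  have R_sum: "sum f I \<in> R" if "\<And>i. i \<in> I \<Longrightarrow> f i \<in> R" for f :: "'n \<Rightarrow> 'k" and I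
    using that by (induction I rule: infinite_finite_induct) (auto intro: RM)
  obtain T where T: "finite T" "\<And>x. x \<in> R \<Longrightarrow> \<exists>t\<in>T. \<exists>z\<in>R. x = t + P * z"
    using lattice_inD(5)[OF R] by blast
  define mk :: "('n \<Rightarrow> 'n \<Rightarrow> 'k) \<Rightarrow> ('k, 'n) sqmat" where "mk f = sqmat_of (\<chi> i j. f i j)" for f
  have mk: "sq_entry (mk f) i j = f i j" for f i j
    by (simp add: mk_def sq_entry.rep_eq sqmat_of_inverse)
  define L :: "('k, 'n) sqmat set" where "L = {A. \<forall>i j. sq_entry A i j \<in> R}"
  define TT :: "('k, 'n) sqmat set" where "TT = {A. \<forall>i j. sq_entry A i j \<in> T}"
  have "ring_lattice p L TT (sq_scale (inverse P) 1)"
  proof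
    show "sq_scale (inverse P) 1 * of_nat p = (1 :: ('k, 'n) sqmat)"
    proof (rule sq_eqI)
      fix i j :: 'n
      show "sq_entry (sq_scale (inverse P) 1 * of_nat p :: ('k, 'n) sqmat) i j = sq_entry 1 i j"
        using sq_of_nat_entry[of p 1 1 i j] p_nonzero by simp
    qed
    show "x - y \<in> L" if "x \<in> L" "y \<in> L" for x y using that RM(2) by (simp add: L_def)
    show "finite TT"
    proof (rule finite_subset)
      show "TT \<subseteq> (\<lambda>f. mk (\<lambda>i j. f (i, j))) ` (UNIV \<rightarrow>\<^sub>E T)"
      proof
        fix A assume A: "A \<in> TT"
        have "A = mk (\<lambda>i j. (\<lambda>(i, j). sq_entry A i j) (i, j))" by (rule sq_eqI) (simp add: mk)
        moreover have "(\<lambda>(i, j). sq_entry A i j) \<in> UNIV \<rightarrow>\<^sub>E T" using A by (auto simp: TT_def)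
        ultimately show "A \<in> (\<lambda>f. mk (\<lambda>i j. f (i, j))) ` (UNIV \<rightarrow>\<^sub>E T)" by blast
      qed
      show "finite ((\<lambda>f. mk (\<lambda>i j. f (i, j))) ` (UNIV \<rightarrow>\<^sub>E T))"
        using T(1) by (intro finite_imageI finite_PiE) auto
    qed
    show "\<exists>t\<in>TT. \<exists>z\<in>L. A = t + of_nat p * z" if "A \<in> L" for A
    proof -
      have "\<forall>i j. \<exists>t z. t \<in> T \<and> z \<in> R \<and> sq_entry A i j = t + P * z" using T(2) that by (auto simp: L_def Bex_def)
      then obtain t z where tz: "\<And>i j. t i j \<in> T \<and> z i j \<in> R \<and> sq_entry A i j = t i j + P * z i j"
        by metis
      have "A = mk t + of_nat p * mk z"
        by (rule sq_eqI) (use tz in \<open>simp add: mk sq_of_nat_entry[where c = 1 and m = p, simplified]\<close>)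
      moreover have "mk t \<in> TT" "mk z \<in> L" using tz by (simp_all add: TT_def L_def mk)
      ultimately show ?thesis by blast
    qed
    show "A = 0" if A: "\<And>c. \<exists>z\<in>L. A = of_nat p ^ c * z" for A
    proof (rule sq_eqI)
      fix i j
      have "sq_entry A i j = 0"
      proof (rule sep)
        fix c
        obtain z where "z \<in> L" "A = of_nat p ^ c * z" using A by blast
        then show "\<exists>z\<in>R. sq_entry A i j = P ^ c * z" by (auto simp: sq_of_nat_entry L_def)
      qed
      then show "sq_entry A i j = sq_entry 0 i j" by simp
    qed
    show "\<exists>c. \<forall>y\<in>L. of_nat p ^ c * (A * y) \<in> L" for A :: "('k, 'n) sqmat"
    proof -
      have "\<forall>ij. \<exists>c. \<forall>y\<in>R. P ^ c * (sq_entry A (fst ij) (snd ij) * y) \<in> R"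
        using lattice_multiplication_bounded[OF R] by blast
      then obtain c where c: "\<And>ij y. y \<in> R \<Longrightarrow> P ^ c ij * (sq_entry A (fst ij) (snd ij) * y) \<in> R"
        by metis
      define d where "d = (\<Sum>ij\<in>UNIV. c ij)"
      have "c ij \<le> d" for ij unfolding d_def by (rule member_le_sum) auto
      then have d: "P ^ d * (sq_entry A i k * y) \<in> R" if "y \<in> R" for i k y
        using P_power_submodule[OF RO c[OF that, of "(i, k)"], of "d - c (i, k)"]
        by (simp add: mult.assoc[symmetric] power_add[symmetric])
      have "of_nat p ^ d * (A * Y) \<in> L" if Y: "Y \<in> L" for Y
      proof -
        have "sq_entry (of_nat p ^ d * (A * Y)) i j = (\<Sum>k\<in>UNIV. P ^ d * (sq_entry A i k * sq_entry Y k j))" for i j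
          unfolding sq_of_nat_entry by (simp add: sq_entry_mult sum_distrib_left)
        then show ?thesis using Y d by (auto simp: L_def intro!: R_sum)
      qed
      then show ?thesis by blast
    qed
    show "\<exists>u\<in>L. \<exists>u'. u * u' = 1"
    proof -
      obtain c where c: "P ^ c * 1 \<in> R" using lattice_inD(3)[OF R] by blast
      have "sq_scale (P ^ c) 1 \<in> L" using c RM(1) by (simp add: L_def)
      moreover have "sq_scale (P ^ c) 1 * sq_scale (inverse (P ^ c)) 1 = (1 :: ('k, 'n) sqmat)"
        by (rule sq_eqI) (simp add: p_nonzero)
      ultimately show ?thesis by blast
    qed
  qed
  then show ?thesis by blast
qed

end

section \<open>The \<open>p\<close>-adic absolute value\<close>

text \<open>Frees the absolute value from reduced fractions: cross-multiplying two representations of a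
  number shows that they have the same difference of multiplicities.\<close>
lemma padic_abs_quotient:
  assumes p: "Factorial_Ring.prime p" and "a \<noteq> 0" "b \<noteq> 0"
  shows "padic_abs p (of_int a / of_int b) = real p powi (int (multiplicity (int p) b) - int (multiplicity (int p) a))"
proof -
  define x :: rat where "x = of_int a / of_int b"
  obtain n d where nd: "quotient_of x = (n, d)" by (metis surj_pair)
  have x0: "x \<noteq> 0" using assms by (simp add: x_def)
  have d: "d > 0" "x = of_int n / of_int d" using nd quotient_of_denom_pos quotient_of_div by auto
  have n: "n \<noteq> 0" using x0 d by auto
  have "(of_int (a * d) :: rat) = of_int (n * b)" using d assms unfolding x_def by (simp add: field_simps)
  then have eq: "a * d = n * b" by (simp only: of_int_eq_iff)
  have pe: "prime_elem (int p)" using p by (simp add: prime_imp_prime_elem)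
  have "multiplicity (int p) a + multiplicity (int p) d = multiplicity (int p) n + multiplicity (int p) b"
    using arg_cong[OF eq, of "multiplicity (int p)"] assms n d
    by (simp add: prime_elem_multiplicity_mult_distrib[OF pe])
  then have "int (multiplicity (int p) d) - int (multiplicity (int p) n)
      = int (multiplicity (int p) b) - int (multiplicity (int p) a)" by linarith
  then show ?thesis using x0 unfolding x_def[symmetric] by (simp add: padic_abs_def nd)
qed

lemma padic_abs_nonneg: "padic_abs p x \<ge> 0"
  by (simp add: padic_abs_def)

lemma padic_abs_zero [simp]: "padic_abs p 0 = 0"
  by (simp add: padic_abs_def)

lemma rat_quotient: "\<exists>a b. (x::rat) = of_int a / of_int b \<and> b \<noteq> 0"
  by (metis quotient_of_denom_pos quotient_of_div surj_pair less_irrefl)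

context
  fixes p :: nat
  assumes p: "Factorial_Ring.prime p"
begin

lemma p_gt_1: "real p > 1"
  using prime_gt_1_nat[OF p] by simp

lemma padic_abs_eq_0_iff: "padic_abs p x = 0 \<longleftrightarrow> x = 0"
  using p_gt_1 by (auto simp: padic_abs_def)

lemma padic_abs_mult: "padic_abs p (x * y) = padic_abs p x * padic_abs p y"
proof (cases "x = 0 \<or> y = 0")
  case False
  obtain a b where x: "x = of_int a / of_int b" "b \<noteq> 0" using rat_quotient by blast
  obtain c d where y: "y = of_int c / of_int d" "d \<noteq> 0" using rat_quotient by blast
  have ac: "a \<noteq> 0" "c \<noteq> 0" using False x y by auto
  have pe: "prime_elem (int p)" using p by (simp add: prime_imp_prime_elem)
  have xy: "x * y = of_int (a * c) / of_int (b * d)" by (simp add: x y)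
  have nz: "a * c \<noteq> 0" "b * d \<noteq> 0" using ac x(2) y(2) by auto
  show ?thesis
    unfolding xy padic_abs_quotient[OF p nz]
    unfolding x(1) y(1) padic_abs_quotient[OF p ac(1) x(2)] padic_abs_quotient[OF p ac(2) y(2)]
    using ac x(2) y(2) p_gt_1
    by (simp add: prime_elem_multiplicity_mult_distrib[OF pe] power_int_add[symmetric] algebra_simps)
qed auto

lemma padic_abs_one [simp]: "padic_abs p 1 = 1"
  using padic_abs_quotient[OF p, of 1 1] by simp

lemma padic_abs_minus: "padic_abs p (- x) = padic_abs p x"
proof -
  have "padic_abs p (- 1) = 1" using padic_abs_quotient[OF p, of "-1" 1] by simp
  then show ?thesis using padic_abs_mult[of "-1" x] by simp
qed

lemma padic_abs_p: "padic_abs p (of_nat p) = 1 / real p"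
  using padic_abs_quotient[OF p, of "int p" 1] p_gt_1 p
  by (simp add: power_int_minus field_simps)

lemma padic_abs_p_power: "padic_abs p (of_nat p ^ c * x) = padic_abs p x / real p ^ c"
  by (induction c) (simp_all add: padic_abs_mult padic_abs_p mult.assoc)

lemma padic_abs_add: "padic_abs p (x + y) \<le> max (padic_abs p x) (padic_abs p y)"
proof (cases "x = 0 \<or> y = 0 \<or> x + y = 0")
  case True
  then show ?thesis using padic_abs_nonneg by (auto simp: le_max_iff_disj)
next
  case False
  obtain a b where x: "x = of_int a / of_int b" "b \<noteq> 0" using rat_quotient by blast
  obtain c d where y: "y = of_int c / of_int d" "d \<noteq> 0" using rat_quotient by blast
  define m where "m = b * d"
  have m: "m \<noteq> 0" using x y by (simp add: m_def)
  have x': "x = of_int (a * d) / of_int m" and y': "y = of_int (c * b) / of_int m"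
    using x y by (simp_all add: m_def)
  have xy: "x + y = of_int (a * d + c * b) / of_int m"
    unfolding x' y' by (simp add: add_divide_distrib)
  have "a * d + c * b \<noteq> 0"
  proof
    assume "a * d + c * b = 0"
    then have "x + y = 0" unfolding xy by simp
    then show False using False by simp
  qed
  then have nz: "a * d \<noteq> 0" "c * b \<noteq> 0" "a * d + c * b \<noteq> 0"
    using False x y by auto
  let ?M = "multiplicity (int p)"
  define k where "k = min (?M (a * d)) (?M (c * b))"
  have "int p ^ k dvd a * d" "int p ^ k dvd c * b"
    by (rule multiplicity_dvd', simp add: k_def)+
  then have "int p ^ k dvd a * d + c * b" by simp
  moreover have "Factorial_Ring.prime (int p)" using p by simp
  then have "\<not> is_unit (int p)" using not_prime_unit by blast
  ultimately have "k \<le> ?M (a * d + c * b)" using nz(3) by (simp add: multiplicity_geI)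
  then have "real p powi (int (?M m) - int (?M (a * d + c * b))) \<le> real p powi (int (?M m) - int k)"
    using p_gt_1 by (intro power_int_increasing) auto
  also have "\<dots> \<le> max (real p powi (int (?M m) - int (?M (a * d)))) (real p powi (int (?M m) - int (?M (c * b))))"
    by (auto simp: k_def min_def)
  finally show ?thesis
    unfolding xy unfolding x' y' padic_abs_quotient[OF p nz(3) m] padic_abs_quotient[OF p nz(1) m]
      padic_abs_quotient[OF p nz(2) m] .
qed

lemma padic_abs_diff: "padic_abs p (x - y) \<le> max (padic_abs p x) (padic_abs p y)"
  using padic_abs_add[of x "- y"] by (simp add: padic_abs_minus)

lemma padic_abs_less_1_imp:
  assumes "padic_abs p x < 1" shows "padic_abs p x \<le> 1 / real p"
proof (cases "x = 0")
  case False
  then obtain k where k: "padic_abs p x = real p powi k" by (auto simp: padic_abs_def)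
  have "k < 0"
  proof (rule ccontr)
    assume "\<not> k < 0"
    then have "real p powi 0 \<le> real p powi k" using p_gt_1 by (intro power_int_increasing) auto
    then show False using assms k by simp
  qed
  then have "real p powi k \<le> real p powi (- 1)" using p_gt_1 by (intro power_int_increasing) auto
  then show ?thesis using k by (simp add: power_int_minus divide_inverse)
qed simp

text \<open>Write \<open>x = a / b\<close> in lowest terms. Then \<open>b\<close> is prime to \<open>p\<close>, and \<open>i\<close> is the residue of \<open>a\<close>
  times an inverse of \<open>b\<close> modulo \<open>p\<close>.\<close>
lemma padic_residue:
  assumes "padic_abs p x \<le> 1"
  shows "\<exists>i<p. padic_abs p (x - of_nat i) \<le> 1 / real p"
proof (cases "x = 0")
  case True
  then show ?thesis using prime_gt_0_nat[OF p] by (intro exI[of _ 0]) simp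
next
  case False
  obtain a b where ab: "quotient_of x = (a, b)" by (metis surj_pair)
  have b: "b > 0" "x = of_int a / of_int b" "coprime a b"
    using ab quotient_of_denom_pos quotient_of_div quotient_of_coprime by auto
  have a: "a \<noteq> 0" using b False by auto
  have pp: "Factorial_Ring.prime (int p)" using p by simp
  have nu: "\<not> is_unit (int p)" using pp not_prime_unit by blast
  have "\<not> int p dvd b"
  proof
    assume dvd: "int p dvd b"
    then have "multiplicity (int p) b > 0" using b nu by (simp add: multiplicity_gt_zero_iff)
    moreover have "\<not> int p dvd a" using dvd b(3) nu by (meson coprime_common_divisor)
    then have "multiplicity (int p) a = 0" by (rule not_dvd_imp_multiplicity_0)
    moreover have "padic_abs p x = real p powi (int (multiplicity (int p) b) - int (multiplicity (int p) a))"
      unfolding b(2) by (rule padic_abs_quotient[OF p a]) (use b in simp)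
    ultimately have "real p \<le> padic_abs p x"
      using p_gt_1 by (simp add: self_le_power)
    then show False using assms p_gt_1 by simp
  qed
  then have "coprime b (int p)" using pp prime_imp_coprime coprime_commute by blast
  then obtain v w where vw: "v * b + w * int p = 1" using bezout_int[of b "int p"] by auto
  define i where "i = nat ((a * v) mod int p)"
  have p0: "int p > 0" using prime_gt_0_nat[OF p] by simp
  have i: "int i = (a * v) mod int p" "i < p" unfolding i_def using p0 by (auto simp: nat_less_iff)
  have "int p dvd a * v - int i" unfolding i by (simp add: mod_eq_dvd_iff[symmetric])
  then have "int p dvd (a * v - int i) * b + a * w * int p" by simp
  also have "(a * v - int i) * b + a * w * int p = a * (v * b + w * int p) - int i * b" by (simp add: algebra_simps)
  finally have "int p dvd a - int i * b" using vw by simp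
  then obtain c where c: "a - int i * b = int p * c" by blast
  have "x - of_nat i = of_nat p * (of_int c / of_int b)"
  proof -
    have "x - of_nat i = of_int (a - int i * b) / of_int b" using b by (simp add: field_simps)
    then show ?thesis unfolding c by simp
  qed
  then have "padic_abs p (x - of_nat i) = padic_abs p (of_int c / of_int b) / real p"
    using padic_abs_p_power[of 1 "of_int c / of_int b"] by (simp only: power_one_right)
  moreover have "padic_abs p (of_int c / of_int b) \<le> 1"
  proof (cases "c = 0")
    case False
    have "multiplicity (int p) b = 0" using \<open>\<not> int p dvd b\<close> by (rule not_dvd_imp_multiplicity_0)
    then have "padic_abs p (of_int c / of_int b) = real p powi (- int (multiplicity (int p) c))"
      using padic_abs_quotient[OF p False, of b] b by simp
    also have "\<dots> \<le> real p powi 0" using p_gt_1 by (intro power_int_increasing) auto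
    finally show ?thesis by simp
  qed simp
  ultimately show ?thesis using i p_gt_1 by (intro exI[of _ i]) (simp add: divide_right_mono)
qed

lemma p_power_unbounded: "\<exists>c. B \<le> real p ^ c"
  using real_arch_pow[OF p_gt_1, of B] less_imp_le by blast

lemma padic_abs_small_imp_0:
  assumes "\<And>c. padic_abs p x \<le> 1 / real p ^ c"
  shows "x = 0"
proof (rule ccontr)
  assume "x \<noteq> 0"
  then have pos: "padic_abs p x > 0" using padic_abs_eq_0_iff padic_abs_nonneg by (metis less_eq_real_def)
  obtain c where "1 / padic_abs p x < real p ^ c" using real_arch_pow[OF p_gt_1] by blast
  then have "1 / real p ^ c < padic_abs p x" using pos p_gt_1 by (simp add: field_simps)
  then show False using assms[of c] by simp
qed

end

section \<open>The rational and the \<open>p\<close>-adic numbers as valued fields\<close>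

context
  fixes p :: nat
  assumes p: "Factorial_Ring.prime p"
begin

lemma padic_cauchy_const: "padic_cauchy p (\<lambda>n. x)"
  by (simp add: padic_cauchy_def)

lemma padic_cauchy_diff:
  assumes "padic_cauchy p s" "padic_cauchy p t"
  shows "padic_cauchy p (\<lambda>n. s n - t n)"
  unfolding padic_cauchy_def
proof (intro allI impI)
  fix e :: real assume "e > 0"
  then obtain M N where MN: "\<And>m n. m \<ge> M \<Longrightarrow> n \<ge> M \<Longrightarrow> padic_abs p (s m - s n) < e"
    "\<And>m n. m \<ge> N \<Longrightarrow> n \<ge> N \<Longrightarrow> padic_abs p (t m - t n) < e"
    using assms unfolding padic_cauchy_def by metis
  show "\<exists>N. \<forall>m\<ge>N. \<forall>n\<ge>N. padic_abs p (s m - t m - (s n - t n)) < e"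
  proof (intro exI allI impI)
    fix m n assume "max M N \<le> m" "max M N \<le> n"
    then have "padic_abs p (s m - s n) < e" "padic_abs p (t m - t n) < e" using MN by auto
    then show "padic_abs p (s m - t m - (s n - t n)) < e"
      using padic_abs_diff[OF p, of "s m - s n" "t m - t n"] by (simp add: algebra_simps)
  qed
qed

lemma padic_cauchy_bounded:
  assumes "padic_cauchy p s"
  shows "\<exists>B>0. \<forall>n. padic_abs p (s n) \<le> B"
proof -
  obtain N where N: "\<And>n. n \<ge> N \<Longrightarrow> padic_abs p (s n - s N) < 1"
    using assms unfolding padic_cauchy_def by (metis order_refl zero_less_one)
  define B where "B = Max (insert 1 ((\<lambda>n. padic_abs p (s n)) ` {..N}))"
  have B: "1 \<le> B" "\<And>n. n \<le> N \<Longrightarrow> padic_abs p (s n) \<le> B"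
    unfolding B_def by (rule Max_ge; simp)+
  have "padic_abs p (s n) \<le> B" for n
  proof (cases "n \<le> N")
    case False
    then show ?thesis using N[of n] padic_abs_add[OF p, of "s n - s N" "s N"] B(1) B(2)[of N] by simp
  qed (use B in auto)
  then show ?thesis using B(1) by (intro exI[of _ B]) auto
qed

lemma padic_cauchy_mult:
  assumes "padic_cauchy p s" "padic_cauchy p t"
  shows "padic_cauchy p (\<lambda>n. s n * t n)"
  unfolding padic_cauchy_def
proof (intro allI impI)
  fix e :: real assume e: "e > 0"
  obtain B where B: "B > 0" "\<And>n. padic_abs p (s n) \<le> B" using padic_cauchy_bounded[OF assms(1)] by blast
  obtain C where C: "C > 0" "\<And>n. padic_abs p (t n) \<le> C" using padic_cauchy_bounded[OF assms(2)] by blast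
  have "e / C > 0" "e / B > 0" using e B C by auto
  then obtain M N where MN: "\<And>m n. m \<ge> M \<Longrightarrow> n \<ge> M \<Longrightarrow> padic_abs p (s m - s n) < e / C"
    "\<And>m n. m \<ge> N \<Longrightarrow> n \<ge> N \<Longrightarrow> padic_abs p (t m - t n) < e / B"
    using assms unfolding padic_cauchy_def by metis
  show "\<exists>N. \<forall>m\<ge>N. \<forall>n\<ge>N. padic_abs p (s m * t m - s n * t n) < e"
  proof (intro exI allI impI)
    fix m n assume "max M N \<le> m" "max M N \<le> n"
    then have d: "padic_abs p (s m - s n) < e / C" "padic_abs p (t m - t n) < e / B" using MN by auto
    have "padic_abs p (s m - s n) * padic_abs p (t m) \<le> padic_abs p (s m - s n) * C"
      using C(2) padic_abs_nonneg by (intro mult_left_mono) auto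
    also have "\<dots> < e" using d C(1) by (simp add: field_simps)
    finally have 1: "padic_abs p ((s m - s n) * t m) < e" by (simp add: padic_abs_mult[OF p])
    have "padic_abs p (s n) * padic_abs p (t m - t n) \<le> B * padic_abs p (t m - t n)"
      using B(2) padic_abs_nonneg by (intro mult_right_mono) auto
    also have "\<dots> < e" using d B(1) by (simp add: field_simps)
    finally have 2: "padic_abs p (s n * (t m - t n)) < e" by (simp add: padic_abs_mult[OF p])
    have "s m * t m - s n * t n = (s m - s n) * t m + s n * (t m - t n)" by (simp add: algebra_simps)
    then show "padic_abs p (s m * t m - s n * t n) < e"
      using padic_abs_add[OF p, of "(s m - s n) * t m" "s n * (t m - t n)"] 1 2 by simp
  qed
qed

lemma padic_null_iff: "s \<in> padic_null p \<longleftrightarrow> (\<forall>e>0. \<exists>N. \<forall>n\<ge>N. padic_abs p (s n) < e)"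
  by (auto simp: padic_null_def LIMSEQ_iff padic_abs_nonneg abs_of_nonneg)

lemma padic_null_cauchy:
  assumes "s \<in> padic_null p" shows "padic_cauchy p s"
  unfolding padic_cauchy_def
proof (intro allI impI)
  fix e :: real assume "e > 0"
  then obtain N where N: "\<And>n. n \<ge> N \<Longrightarrow> padic_abs p (s n) < e" using assms padic_null_iff by blast
  have "padic_abs p (s m - s n) < e" if "N \<le> m" "N \<le> n" for m n
    using N[OF that(1)] N[OF that(2)] padic_abs_diff[OF p, of "s m" "s n"] by linarith
  then show "\<exists>N. \<forall>m\<ge>N. \<forall>n\<ge>N. padic_abs p (s m - s n) < e" by blast
qed

lemma padic_null_diff:
  assumes "s \<in> padic_null p" "t \<in> padic_null p"
  shows "(\<lambda>n. s n - t n) \<in> padic_null p"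
  unfolding padic_null_iff
proof (intro allI impI)
  fix e :: real assume "e > 0"
  then obtain M N where "\<And>n. n \<ge> M \<Longrightarrow> padic_abs p (s n) < e" "\<And>n. n \<ge> N \<Longrightarrow> padic_abs p (t n) < e"
    using assms padic_null_iff by meson
  then show "\<exists>N. \<forall>n\<ge>N. padic_abs p (s n - t n) < e"
    using padic_abs_diff[OF p] by (intro exI[of _ "max M N"]) (smt (verit) max.bounded_iff max_def)
qed

lemma padic_null_mult:
  assumes "s \<in> padic_null p" "padic_cauchy p t"
  shows "(\<lambda>n. t n * s n) \<in> padic_null p"
  unfolding padic_null_iff
proof (intro allI impI)
  fix e :: real assume e: "e > 0"
  obtain B where B: "B > 0" "\<And>n. padic_abs p (t n) \<le> B" using padic_cauchy_bounded[OF assms(2)] by blast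
  then have "e / B > 0" using e by simp
  then obtain N where N: "\<And>n. n \<ge> N \<Longrightarrow> padic_abs p (s n) < e / B" using assms(1) padic_null_iff by blast
  have "padic_abs p (t n * s n) < e" if "n \<ge> N" for n
  proof -
    have "padic_abs p (t n) * padic_abs p (s n) \<le> B * padic_abs p (s n)"
      using B(2) padic_abs_nonneg by (intro mult_right_mono) auto
    also have "\<dots> < e" using N[OF that] B(1) by (simp add: field_simps)
    finally show ?thesis by (simp add: padic_abs_mult[OF p])
  qed
  then show "\<exists>N. \<forall>n\<ge>N. padic_abs p (t n * s n) < e" by blast
qed

lemma padic_null_zero: "(\<lambda>n. 0) \<in> padic_null p"
  by (simp add: padic_null_iff)

lemma padic_null_eventually: "(\<And>n. n \<ge> N \<Longrightarrow> s n = 0) \<Longrightarrow> s \<in> padic_null p"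
  unfolding padic_null_iff by (metis padic_abs_zero)

lemma padic_cauchy_minus: "padic_cauchy p s \<Longrightarrow> padic_cauchy p (\<lambda>n. - s n)"
  using padic_cauchy_diff[OF padic_cauchy_const[of 0]] by simp

lemma padic_cauchy_add: "padic_cauchy p s \<Longrightarrow> padic_cauchy p t \<Longrightarrow> padic_cauchy p (\<lambda>n. s n + t n)"
  using padic_cauchy_diff[OF _ padic_cauchy_minus, of s t] by simp

lemma cring_padic_cauchy: "cring (padic_cauchy_ring p)"
proof (rule cringI)
  show "abelian_group (padic_cauchy_ring p)"
  proof (rule abelian_groupI)
    fix s assume "s \<in> carrier (padic_cauchy_ring p)"
    then show "\<exists>t\<in>carrier (padic_cauchy_ring p). t \<oplus>\<^bsub>padic_cauchy_ring p\<^esub> s = \<zero>\<^bsub>padic_cauchy_ring p\<^esub>"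
      using padic_cauchy_minus[of s] by (intro bexI[of _ "\<lambda>n. - s n"]) (auto simp: padic_cauchy_ring_def)
  qed (auto simp: padic_cauchy_ring_def padic_cauchy_add padic_cauchy_const add_ac)
  show "Group.comm_monoid (padic_cauchy_ring p)"
    by unfold_locales (auto simp: padic_cauchy_ring_def padic_cauchy_mult padic_cauchy_const mult_ac)
qed (auto simp: padic_cauchy_ring_def algebra_simps)

lemma ideal_padic_null: "ideal (padic_null p) (padic_cauchy_ring p)"
proof -
  interpret C: cring "padic_cauchy_ring p" by (rule cring_padic_cauchy)
  have minus: "(\<lambda>n. - s n) \<in> padic_null p" if "s \<in> padic_null p" for s
    using padic_null_diff[OF padic_null_zero that] by simp
  show ?thesis
  proof (rule idealI)
    show "ring (padic_cauchy_ring p)" by unfold_locales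
    show "subgroup (padic_null p) (add_monoid (padic_cauchy_ring p))"
    proof (rule group.subgroupI)
      show "Group.group (add_monoid (padic_cauchy_ring p))" by (rule C.a_group)
      show "padic_null p \<subseteq> carrier (add_monoid (padic_cauchy_ring p))"
        using padic_null_cauchy by (auto simp: padic_cauchy_ring_def)
      show "padic_null p \<noteq> {}" using padic_null_zero by blast
      fix s assume s: "s \<in> padic_null p"
      then have sc: "s \<in> carrier (padic_cauchy_ring p)" "(\<lambda>n. - s n) \<in> carrier (padic_cauchy_ring p)"
        using padic_null_cauchy minus by (auto simp: padic_cauchy_ring_def)
      have "\<ominus>\<^bsub>padic_cauchy_ring p\<^esub> s = (\<lambda>n. - s n)"
        by (rule C.minus_equality[OF _ sc(1) sc(2)]) (simp add: padic_cauchy_ring_def)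
      then show "inv\<^bsub>add_monoid (padic_cauchy_ring p)\<^esub> s \<in> padic_null p"
        using minus[OF s] by (simp add: a_inv_def)
      fix t assume "t \<in> padic_null p"
      then show "s \<otimes>\<^bsub>add_monoid (padic_cauchy_ring p)\<^esub> t \<in> padic_null p"
        using padic_null_diff[OF s minus, of t] by (simp add: padic_cauchy_ring_def)
    qed
  qed (auto simp: padic_cauchy_ring_def padic_null_mult mult.commute dest: padic_null_mult)
qed

text \<open>The terms of a Cauchy sequence that is not a null sequence are eventually bounded away from
  zero. The inverse sequence is set to zero before that point.\<close>
lemma padic_cauchy_inverse:
  assumes s: "padic_cauchy p s" "s \<notin> padic_null p"
  shows "\<exists>t. padic_cauchy p t \<and> (\<lambda>n. s n * t n - 1) \<in> padic_null p"
proof -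
  obtain e where e: "e > 0" "\<And>N. \<exists>n\<ge>N. padic_abs p (s n) \<ge> e"
    using s(2) unfolding padic_null_iff by (meson not_less)
  obtain N where N: "\<And>m n. m \<ge> N \<Longrightarrow> n \<ge> N \<Longrightarrow> padic_abs p (s m - s n) < e"
    using s(1) e(1) unfolding padic_cauchy_def by meson
  obtain n0 where n0: "n0 \<ge> N" "padic_abs p (s n0) \<ge> e" using e(2) by blast
  have big: "padic_abs p (s n) \<ge> e" if "n \<ge> N" for n
  proof (rule ccontr)
    assume "\<not> ?thesis"
    then have "padic_abs p (s n0 - s n + s n) < e"
      using N[OF n0(1) that] padic_abs_add[OF p, of "s n0 - s n" "s n"] by linarith
    then show False using n0 by simp
  qed
  have nz: "s n \<noteq> 0" if "n \<ge> N" for n using big[OF that] e(1) by auto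
  define t where "t n = (if n \<ge> N then 1 / s n else 0)" for n
  have "padic_cauchy p t"
    unfolding padic_cauchy_def
  proof (intro allI impI)
    fix d :: real assume "d > 0"
    then have "d * (e * e) > 0" using e by simp
    then obtain M where M: "\<And>m n. m \<ge> M \<Longrightarrow> n \<ge> M \<Longrightarrow> padic_abs p (s m - s n) < d * (e * e)"
      using s(1) unfolding padic_cauchy_def by meson
    have "padic_abs p (t m - t n) < d" if mn: "max M N \<le> m" "max M N \<le> n" for m n
    proof -
      have g: "m \<ge> N" "n \<ge> N" using mn by auto
      have "(t m - t n) * (s m * s n) = s n - s m" using g nz by (simp add: t_def field_simps)
      then have "padic_abs p (t m - t n) * (padic_abs p (s m) * padic_abs p (s n)) = padic_abs p (s n - s m)"
        by (metis padic_abs_mult[OF p])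
      also have "\<dots> < d * (e * e)" using M mn by simp
      finally have "padic_abs p (t m - t n) * (padic_abs p (s m) * padic_abs p (s n)) < d * (e * e)" .
      moreover have "padic_abs p (t m - t n) * (e * e) \<le> padic_abs p (t m - t n) * (padic_abs p (s m) * padic_abs p (s n))"
        using big[OF g(1)] big[OF g(2)] e padic_abs_nonneg by (intro mult_left_mono mult_mono) auto
      ultimately have "padic_abs p (t m - t n) * (e * e) < d * (e * e)" by linarith
      then show ?thesis using e by simp
    qed
    then show "\<exists>N. \<forall>m\<ge>N. \<forall>n\<ge>N. padic_abs p (t m - t n) < d" by blast
  qed
  moreover have "(\<lambda>n. s n * t n - 1) \<in> padic_null p"
    by (rule padic_null_eventually[of N]) (simp add: t_def nz)
  ultimately show ?thesis by blast
qed

text \<open>The valuation ring consists of the classes of Cauchy sequences of \<open>p\<close>-integral rational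
  numbers. Such a sequence is eventually constant modulo \<open>p\<close>; after subtraction of that
  residue it can be divided by \<open>p\<close> term by term.\<close>
lemma valued_subfield_Qp:
  fixes h :: "(nat \<Rightarrow> rat) set \<Rightarrow> 'k::field"
  assumes h: "h \<in> ring_hom (Qp p) ring_of_type_algebra"
  shows "\<exists>\<O>. valued_subfield p (h ` carrier (Qp p)) \<O>"
proof -
  let ?C = "padic_cauchy_ring p"
  interpret I: ideal "padic_null p" ?C by (rule ideal_padic_null)
  define g where "g s = h (padic_null p +>\<^bsub>?C\<^esub> s)" for s
  have cls: "(+>\<^bsub>?C\<^esub>) (padic_null p) \<in> ring_hom ?C (Qp p)"
    unfolding Qp_def by (rule I.rcos_ring_hom)
  have in_C: "padic_cauchy p s \<Longrightarrow> s \<in> carrier ?C" for s by (simp add: padic_cauchy_ring_def)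
  have clsC: "padic_cauchy p s \<Longrightarrow> padic_null p +>\<^bsub>?C\<^esub> s \<in> carrier (Qp p)" for s
    using ring_hom_closed[OF cls in_C] .
  have g_add: "g (\<lambda>n. s n + t n) = g s + g t" if "padic_cauchy p s" "padic_cauchy p t" for s t
    using ring_hom_add[OF cls in_C[OF that(1)] in_C[OF that(2)]] ring_hom_add[OF h clsC[OF that(1)] clsC[OF that(2)]]
    by (simp add: g_def padic_cauchy_ring_def ring_of_type_algebra_def)
  have g_mult: "g (\<lambda>n. s n * t n) = g s * g t" if "padic_cauchy p s" "padic_cauchy p t" for s t
    using ring_hom_mult[OF cls in_C[OF that(1)] in_C[OF that(2)]] ring_hom_mult[OF h clsC[OF that(1)] clsC[OF that(2)]]
    by (simp add: g_def padic_cauchy_ring_def ring_of_type_algebra_def)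
  have g_one: "g (\<lambda>n. 1) = 1"
    using ring_hom_one[OF cls] ring_hom_one[OF h]
    by (simp add: g_def padic_cauchy_ring_def ring_of_type_algebra_def)
  have g_zero: "g (\<lambda>n. 0) = 0"
    using g_add[OF padic_cauchy_const padic_cauchy_const, of 0 0] by (metis add.right_neutral add_left_cancel)
  have g_minus: "g (\<lambda>n. - s n) = - g s" if "padic_cauchy p s" for s
    using g_add[OF that padic_cauchy_minus[OF that]] g_zero by (simp add: eq_neg_iff_add_eq_0 add.commute)
  have g_diff: "g (\<lambda>n. s n - t n) = g s - g t" if "padic_cauchy p s" "padic_cauchy p t" for s t
    using g_add[OF that(1) padic_cauchy_minus[OF that(2)]] g_minus[OF that(2)] by simp
  have g_null: "g s = 0" if "s \<in> padic_null p" for s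
  proof -
    have "padic_null p +>\<^bsub>?C\<^esub> s = padic_null p +>\<^bsub>?C\<^esub> (\<lambda>n. 0)"
      by (simp only: I.a_rcos_const[OF that] I.a_rcos_const[OF padic_null_zero])
    then show ?thesis using g_zero by (simp add: g_def)
  qed
  have g_inv: "\<exists>t. padic_cauchy p t \<and> g s * g t = 1" if s: "padic_cauchy p s" "s \<notin> padic_null p" for s
  proof -
    obtain t where t: "padic_cauchy p t" "(\<lambda>n. s n * t n - 1) \<in> padic_null p"
      using padic_cauchy_inverse[OF s] by blast
    have "g (\<lambda>n. s n * t n) - g (\<lambda>n. 1) = 0"
      using g_null[OF t(2)] g_diff[OF padic_cauchy_mult[OF s(1) t(1)] padic_cauchy_const] by simp
    then show ?thesis using t g_one g_mult[OF s(1) t(1)] by auto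
  qed
  have g_inj: "s \<in> padic_null p" if "padic_cauchy p s" "g s = 0" for s
    using g_inv[OF that(1)] that(2) by fastforce
  have g_nat: "g (\<lambda>n. of_nat k) = of_nat k" for k
    using g_add[OF padic_cauchy_const padic_cauchy_const] g_zero g_one
    by (induction k) (auto simp: add.commute)
  have range: "h ` carrier (Qp p) = {g s | s. padic_cauchy p s}"
    unfolding Qp_def FactRing_def A_RCOSETS_def' g_def by (auto simp: padic_cauchy_ring_def)
  define \<O> where "\<O> = {g s | s. padic_cauchy p s \<and> (\<forall>n. padic_abs p (s n) \<le> 1)}"
  have gpow: "g (\<lambda>n. of_nat p ^ c * s n) = of_nat p ^ c * g s" if "padic_cauchy p s" for c s
    using g_mult[OF padic_cauchy_const[of "of_nat (p ^ c)"] that] g_nat[of "p ^ c"] by simp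
  have "valued_subfield p (h ` carrier (Qp p)) \<O>"
    unfolding range
  proof
    have "(\<lambda>n. of_nat p) \<notin> padic_null p"
    proof
      assume "(\<lambda>n. of_nat p) \<in> padic_null p"
      then have "padic_abs p (of_nat p) < 1 / real p"
        unfolding padic_null_iff using p_gt_1[OF p] by (metis order_refl zero_less_divide_1_iff less_trans zero_less_one)
      then show False by (simp add: padic_abs_p[OF p])
    qed
    then show "of_nat p \<noteq> (0::'k)" using g_inj[OF padic_cauchy_const] g_nat by metis
  next
    show "1 \<in> {g s | s. padic_cauchy p s}" using g_one padic_cauchy_const by force
  next
    fix x y assume "x \<in> {g s | s. padic_cauchy p s}" "y \<in> {g s | s. padic_cauchy p s}"
    then show "x - y \<in> {g s | s. padic_cauchy p s}" using g_diff padic_cauchy_diff by force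
  next
    fix x y assume "x \<in> {g s | s. padic_cauchy p s}" "y \<in> {g s | s. padic_cauchy p s}"
    then show "x * y \<in> {g s | s. padic_cauchy p s}" using g_mult padic_cauchy_mult by force
  next
    fix x assume "x \<in> {g s | s. padic_cauchy p s}"
    then obtain s where s: "padic_cauchy p s" "x = g s" by blast
    show "inverse x \<in> {g s | s. padic_cauchy p s}"
    proof (cases "s \<in> padic_null p")
      case True
      then show ?thesis using s g_null g_zero padic_cauchy_const[of 0] by force
    next
      case False
      then obtain t where "padic_cauchy p t" "g s * g t = 1" using g_inv s by blast
      then show ?thesis using s inverse_unique by blast
    qed
  next
    show "\<O> \<subseteq> {g s | s. padic_cauchy p s}" by (auto simp: \<O>_def)
  next
    show "1 \<in> \<O>" unfolding \<O>_def using g_one padic_cauchy_const padic_abs_one[OF p] by force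
  next
    fix x y assume "x \<in> \<O>" "y \<in> \<O>"
    then obtain s t where st: "padic_cauchy p s" "padic_cauchy p t" "x = g s" "y = g t"
      "\<And>n. padic_abs p (s n) \<le> 1" "\<And>n. padic_abs p (t n) \<le> 1" by (auto simp: \<O>_def)
    have "padic_abs p (s n - t n) \<le> 1" for n
      using padic_abs_diff[OF p, of "s n" "t n"] st(5,6)[of n] by linarith
    then show "x - y \<in> \<O>" unfolding \<O>_def using g_diff[OF st(1,2)] padic_cauchy_diff[OF st(1,2)] st by force
    have "padic_abs p (s n * t n) \<le> 1" for n
      using st(5,6)[of n] by (simp add: padic_abs_mult[OF p] mult_le_one padic_abs_nonneg)
    then show "x * y \<in> \<O>" unfolding \<O>_def using g_mult[OF st(1,2)] padic_cauchy_mult[OF st(1,2)] st by force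
  next
    fix x assume "x \<in> {g s | s. padic_cauchy p s}"
    then obtain s where s: "padic_cauchy p s" "x = g s" by blast
    obtain B where B: "\<And>n. padic_abs p (s n) \<le> B" using padic_cauchy_bounded[OF s(1)] by blast
    obtain c where c: "B \<le> real p ^ c" using p_power_unbounded[OF p] by blast
    have "padic_abs p (of_nat p ^ c * s n) \<le> 1" for n
      using order_trans[OF B c] p_gt_1[OF p] by (simp add: padic_abs_p_power[OF p])
    moreover have "padic_cauchy p (\<lambda>n. of_nat p ^ c * s n)" using padic_cauchy_mult[OF padic_cauchy_const s(1)] .
    ultimately have "of_nat p ^ c * x \<in> \<O>"
      unfolding \<O>_def using gpow[OF s(1), of c] s(2)
      by (intro CollectI exI[of _ "\<lambda>n. of_nat p ^ c * s n"]) simp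
    then show "\<exists>c. of_nat p ^ c * x \<in> \<O>" by blast
  next
    fix x assume "x \<in> \<O>"
    then obtain s where s: "padic_cauchy p s" "x = g s" "\<And>n. padic_abs p (s n) \<le> 1" by (auto simp: \<O>_def)
    obtain N where N: "\<And>m. m \<ge> N \<Longrightarrow> padic_abs p (s m - s N) < 1"
      using s(1) unfolding padic_cauchy_def by (metis order_refl zero_less_one)
    obtain i where i: "i < p" "padic_abs p (s N - of_nat i) \<le> 1 / real p"
      using padic_residue[OF p s(3)] by blast
    define u where "u n = (if n \<ge> N then s n - of_nat i else 0)" for n
    have u: "padic_abs p (u n) \<le> 1 / real p" for n
    proof (cases "n \<ge> N")
      case True
      then have "padic_abs p (s n - s N) \<le> 1 / real p" using padic_abs_less_1_imp[OF p N] by blast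
      then show ?thesis using i(2) True padic_abs_add[OF p, of "s n - s N" "s N - of_nat i"] by (simp add: u_def)
    qed (simp add: u_def)
    have un: "(\<lambda>n. (s n - of_nat i) - u n) \<in> padic_null p"
      by (rule padic_null_eventually[of N]) (simp add: u_def)
    have sc: "padic_cauchy p (\<lambda>n. s n - of_nat i)" by (rule padic_cauchy_diff[OF s(1) padic_cauchy_const])
    have uc: "padic_cauchy p u"
      using padic_cauchy_diff[OF sc padic_null_cauchy[OF un]] by simp
    define z where "z n = (1 / of_nat p) * u n" for n
    have zc: "padic_cauchy p z" unfolding z_def by (rule padic_cauchy_mult[OF padic_cauchy_const uc])
    have p0: "of_nat p \<noteq> (0::rat)" using p_gt_1[OF p] by simp
    have uz: "u = (\<lambda>n. of_nat p ^ 1 * z n)" using p0 by (simp add: z_def fun_eq_iff)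
    have "padic_abs p (z n) \<le> 1" for n
      using u[of n] p_gt_1[OF p] unfolding uz padic_abs_p_power[OF p] by (simp add: field_simps)
    then have "g z \<in> \<O>" using zc by (auto simp: \<O>_def)
    moreover have "x = of_nat i + of_nat p * g z"
    proof -
      have "g (\<lambda>n. s n - of_nat i) - g u = 0" using g_diff[OF sc uc] g_null[OF un] by simp
      moreover have "g (\<lambda>n. s n - of_nat i) = x - of_nat i"
        using g_diff[OF s(1) padic_cauchy_const] g_nat s(2) by simp
      moreover have "g u = of_nat p * g z" unfolding uz gpow[OF zc] by simp
      ultimately show ?thesis by (simp add: algebra_simps)
    qed
    ultimately show "\<exists>i<p. \<exists>z\<in>\<O>. x = of_nat i + of_nat p * z" using i(1) by blast
  next
    fix x assume x: "\<And>c. \<exists>z\<in>\<O>. x = of_nat p ^ c * z"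
    obtain s where s: "padic_cauchy p s" "x = g s" using x[of 0] by (auto simp: \<O>_def)
    have "s \<in> padic_null p"
      unfolding padic_null_iff
    proof (intro allI impI)
      fix e :: real assume e: "e > 0"
      obtain c where "1 / e < real p ^ c" using real_arch_pow[OF p_gt_1[OF p]] by blast
      then have c: "1 / real p ^ c < e" using e p_gt_1[OF p] by (simp add: field_simps)
      obtain z where z: "padic_cauchy p z" "x = of_nat p ^ c * g z" "\<And>n. padic_abs p (z n) \<le> 1"
        using x[of c] by (auto simp: \<O>_def)
      have pzc: "padic_cauchy p (\<lambda>n. of_nat p ^ c * z n)" using padic_cauchy_mult[OF padic_cauchy_const z(1)] .
      have "g (\<lambda>n. s n - of_nat p ^ c * z n) = 0"
        using g_diff[OF s(1) pzc] gpow[OF z(1)] s(2) z(2) by simp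
      then have "(\<lambda>n. s n - of_nat p ^ c * z n) \<in> padic_null p"
        using g_inj[OF padic_cauchy_diff[OF s(1) pzc]] by blast
      then have "\<exists>N. \<forall>n\<ge>N. padic_abs p (s n - of_nat p ^ c * z n) < e"
        unfolding padic_null_iff using e by simp
      then obtain N where N: "\<And>n. n \<ge> N \<Longrightarrow> padic_abs p (s n - of_nat p ^ c * z n) < e" by blast
      have "padic_abs p (s n) < e" if "n \<ge> N" for n
      proof -
        have "padic_abs p (of_nat p ^ c * z n) \<le> 1 / real p ^ c"
          using z(3)[of n] p_gt_1[OF p] by (simp add: padic_abs_p_power[OF p] divide_right_mono)
        then show ?thesis
          using N[OF that] c padic_abs_add[OF p, of "s n - of_nat p ^ c * z n" "of_nat p ^ c * z n"] by simp
      qed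
      then show "\<exists>N. \<forall>n\<ge>N. padic_abs p (s n) < e" by blast
    qed
    then show "x = 0" using g_null s(2) by simp
  qed
  then show ?thesis by blast
qed

text \<open>The valuation ring is the localisation of \<open>\<int>\<close> at \<open>p\<close>.\<close>
lemma valued_subfield_rat:
  fixes h :: "rat \<Rightarrow> 'k::field"
  assumes h: "h \<in> ring_hom ring_of_type_algebra ring_of_type_algebra"
  shows "\<exists>\<O>. valued_subfield p (h ` carrier ring_of_type_algebra) \<O>"
proof -
  have add: "h (x + y) = h x + h y" and mult: "h (x * y) = h x * h y" and one: "h 1 = 1" for x y
    using ring_hom_add[OF h, of x y] ring_hom_mult[OF h, of x y] ring_hom_one[OF h]
    by (simp_all add: ring_of_type_algebra_def)
  have zero: "h 0 = 0" using add[of 0 0] by (metis add.right_neutral add_left_cancel)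
  have diff: "h (x - y) = h x - h y" for x y using add[of "x - y" y] by simp
  have nat: "h (of_nat k) = of_nat k" for k by (induction k) (auto simp: add zero one)
  have inj: "x = 0" if "h x = 0" for x
    using mult[of x "1 / x"] that one by (cases "x = 0") auto
  have pow: "h (of_nat p ^ c * x) = of_nat p ^ c * h x" for c x
    using mult[of "of_nat (p ^ c)" x] nat[of "p ^ c"] by simp
  define \<O> where "\<O> = h ` {x. padic_abs p x \<le> 1}"
  have "valued_subfield p (range h) \<O>"
  proof
    show "of_nat p \<noteq> (0::'k)"
      using inj[of "of_nat p"] nat[of p] p_gt_1[OF p] by auto
    show "1 \<in> range h" using one by (metis rangeI)
    show "\<O> \<subseteq> range h" by (auto simp: \<O>_def)
    show "1 \<in> \<O>" unfolding \<O>_def using padic_abs_one[OF p] by (intro image_eqI[of _ h 1]) (simp_all add: one)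
  next
    fix x y assume "x \<in> range h" "y \<in> range h"
    then show "x - y \<in> range h" by (auto simp: diff[symmetric])
  next
    fix x y assume "x \<in> range h" "y \<in> range h"
    then show "x * y \<in> range h" by (auto simp: mult[symmetric])
  next
    fix x assume "x \<in> range h"
    then obtain r where r: "x = h r" by blast
    have "inverse x = h (1 / r)"
    proof (cases "r = 0")
      case False
      then have "h r * h (1 / r) = 1" using mult[of r "1 / r"] one by simp
      then show ?thesis using r inverse_unique by blast
    qed (simp add: r zero)
    then show "inverse x \<in> range h" by blast
  next
    fix x y assume "x \<in> \<O>" "y \<in> \<O>"
    then obtain r s where rs: "x = h r" "y = h s" "padic_abs p r \<le> 1" "padic_abs p s \<le> 1" by (auto simp: \<O>_def)
    have "padic_abs p (r - s) \<le> 1" using padic_abs_diff[OF p, of r s] rs by linarith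
    then show "x - y \<in> \<O>" unfolding \<O>_def using rs diff by (intro image_eqI[of _ _ "r - s"]) auto
    have "padic_abs p (r * s) \<le> 1" using rs by (simp add: padic_abs_mult[OF p] mult_le_one padic_abs_nonneg)
    then show "x * y \<in> \<O>" unfolding \<O>_def using rs mult by (intro image_eqI[of _ _ "r * s"]) auto
  next
    fix x assume "x \<in> range h"
    then obtain r where r: "x = h r" by blast
    obtain c where "padic_abs p r \<le> real p ^ c" using p_power_unbounded[OF p] by blast
    then have "padic_abs p (of_nat p ^ c * r) \<le> 1" using p_gt_1[OF p] by (simp add: padic_abs_p_power[OF p])
    then show "\<exists>c. of_nat p ^ c * x \<in> \<O>" unfolding r \<O>_def using pow by (metis (mono_tags, lifting) imageI mem_Collect_eq)
  next
    fix x assume "x \<in> \<O>"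
    then obtain r where r: "x = h r" "padic_abs p r \<le> 1" by (auto simp: \<O>_def)
    obtain i where i: "i < p" "padic_abs p (r - of_nat i) \<le> 1 / real p" using padic_residue[OF p r(2)] by blast
    define z where "z = (r - of_nat i) / of_nat p"
    have p0: "of_nat p \<noteq> (0::rat)" using p_gt_1[OF p] by simp
    have rz: "r - of_nat i = of_nat p ^ 1 * z" using p0 by (simp add: z_def)
    have "padic_abs p z \<le> 1"
      using i(2) p_gt_1[OF p] unfolding rz padic_abs_p_power[OF p] by (simp add: field_simps)
    then have "h z \<in> \<O>" by (simp add: \<O>_def)
    moreover have "r = of_nat i + of_nat p * z" using rz by simp
    then have "x = of_nat i + of_nat p * h z" by (simp add: r add mult nat)
    ultimately show "\<exists>i<p. \<exists>z\<in>\<O>. x = of_nat i + of_nat p * z" using i(1) by blast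
  next
    fix x assume x: "\<And>c. \<exists>z\<in>\<O>. x = of_nat p ^ c * z"
    obtain r where r: "x = h r" using x[of 0] by (auto simp: \<O>_def)
    have "padic_abs p r \<le> 1 / real p ^ c" for c
    proof -
      obtain z where z: "padic_abs p z \<le> 1" "x = of_nat p ^ c * h z" using x[of c] by (auto simp: \<O>_def)
      have "h (r - of_nat p ^ c * z) = 0" by (simp add: diff pow r[symmetric] z)
      then have "r = of_nat p ^ c * z" using inj by fastforce
      then show ?thesis using z(1) p_gt_1[OF p] by (simp add: padic_abs_p_power[OF p] divide_right_mono)
    qed
    then have "r = 0" by (rule padic_abs_small_imp_0[OF p])
    then show "x = 0" by (simp add: r zero)
  qed
  then show ?thesis by (auto simp: ring_of_type_algebra_def)
qed

lemma finite_extension_ring_lattice: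
  assumes "number_field TYPE('k::field) \<or> is_finite_extension_of TYPE('k) (Qp p)"
  shows "(\<exists>(L :: ('k, 'n::finite) sqmat set) T r. ring_lattice p L T r) \<and> (\<forall>r>0. of_nat r \<noteq> (0::'k))"
  using assms
proof
  assume "number_field TYPE('k)"
  then obtain h where h: "h \<in> ring_hom (ring_of_type_algebra :: rat ring) (ring_of_type_algebra :: 'k ring)"
    "ring.finite_dimension (ring_of_type_algebra :: 'k ring) (h ` carrier (ring_of_type_algebra :: rat ring)) UNIV"
    by (auto simp: number_field_def is_finite_extension_of_def)
  obtain \<O> where "valued_subfield p (h ` carrier ring_of_type_algebra) \<O>" using valued_subfield_rat[OF h(1)] by blast
  from valued_subfield.matrix_ring_lattice[OF this h(2)] valued_subfield.char_zero[OF this]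
  show ?thesis by blast
next
  assume "is_finite_extension_of TYPE('k) (Qp p)"
  then obtain h where h: "h \<in> ring_hom (Qp p) (ring_of_type_algebra :: 'k ring)"
    "ring.finite_dimension (ring_of_type_algebra :: 'k ring) (h ` carrier (Qp p)) UNIV"
    by (auto simp: is_finite_extension_of_def)
  obtain \<O> where "valued_subfield p (h ` carrier (Qp p)) \<O>" using valued_subfield_Qp[OF h(1)] by blast
  from valued_subfield.matrix_ring_lattice[OF this h(2)] valued_subfield.char_zero[OF this]
  show ?thesis by blast
qed

end

section \<open>Topological groups and charts around the identity\<close>

lemma has_derivative_eq_nhds:
  assumes "(f has_derivative f') (at x)" "\<forall>\<^sub>F y in nhds x. f y = g y"
  shows "(g has_derivative f') (at x)"
proof -
  obtain S where "open S" "x \<in> S" "\<And>y. y \<in> S \<Longrightarrow> f y = g y"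
    using assms(2) unfolding eventually_nhds by blast
  then show ?thesis using has_derivative_transform_within_open[OF assms(1)] by blast
qed

lemma smooth_on_imp_differentiable:
  assumes "smooth_on S f" "x \<in> S"
  shows "(f has_derivative frechet_derivative f (at x)) (at x)"
    and "(\<lambda>x. frechet_derivative f (at x) v) differentiable (at x)"
proof -
  have "Ck_on (Suc 0) S f" "Ck_on (Suc (Suc 0)) S f" using assms(1) by (auto simp: smooth_on_def)
  then show "(f has_derivative frechet_derivative f (at x)) (at x)"
    "(\<lambda>x. frechet_derivative f (at x) v) differentiable (at x)"
    using assms(2) by (auto simp: frechet_derivative_works[symmetric])
qed

locale topological_group = group H for H :: "('h, 'm) monoid_scheme" (structure) +
  fixes T :: "'h topology"
  assumes topspace_eq: "topspace T = carrier H"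
    and continuous_mult: "continuous_map (prod_topology T T) T (\<lambda>(x, y). x \<otimes> y)"
    and continuous_inv: "continuous_map T T (\<lambda>x. inv x)"
begin

lemma continuous_map_mult:
  "continuous_map Z T f \<Longrightarrow> continuous_map Z T g \<Longrightarrow> continuous_map Z T (\<lambda>z. f z \<otimes> g z)"
  using continuous_map_compose[OF continuous_map_pairedI continuous_mult, of Z f g] by (simp add: o_def)

lemma continuous_map_inv: "continuous_map Z T f \<Longrightarrow> continuous_map Z T (\<lambda>z. inv (f z))"
  using continuous_map_compose[OF _ continuous_inv, of Z f] by (simp add: o_def)

lemma continuous_map_constant: "a \<in> carrier H \<Longrightarrow> continuous_map Z T (\<lambda>z. a)"
  by (simp add: topspace_eq)

definition nbhds_one :: "'h set set" where
  "nbhds_one = {U. openin T U \<and> \<one> \<in> U}"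

lemma nbhds_one_subset: "U \<in> nbhds_one \<Longrightarrow> U \<subseteq> carrier H"
  using openin_subset topspace_eq by (auto simp: nbhds_one_def)

lemma nbhds_one_mult:
  assumes "U \<in> nbhds_one" shows "\<exists>V\<in>nbhds_one. \<forall>x\<in>V. \<forall>y\<in>V. x \<otimes> y \<in> U"
proof -
  define R where "R = {z \<in> topspace (prod_topology T T). (\<lambda>(x, y). x \<otimes> y) z \<in> U}"
  have opn: "openin (prod_topology T T) R"
    unfolding R_def by (rule openin_continuous_map_preimage[OF continuous_mult]) (use assms in \<open>simp add: nbhds_one_def\<close>)
  have mem: "(\<one>, \<one>) \<in> R"
    using assms by (simp add: R_def nbhds_one_def topspace_eq)
  obtain V W where VW: "openin T V" "openin T W" "\<one> \<in> V" "\<one> \<in> W" "V \<times> W \<subseteq> R"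
    using opn[unfolded openin_prod_topology_alt, rule_format, OF mem] by metis
  then have "V \<inter> W \<in> nbhds_one" by (auto simp: nbhds_one_def)
  moreover have "\<forall>x\<in>V \<inter> W. \<forall>y\<in>V \<inter> W. x \<otimes> y \<in> U" using VW(5) by (auto simp: R_def)
  ultimately show ?thesis by blast
qed

lemma nbhds_one_inv:
  assumes "U \<in> nbhds_one" shows "\<exists>V\<in>nbhds_one. \<forall>x\<in>V. inv x \<in> U"
proof (intro bexI ballI)
  show "{x \<in> topspace T. inv x \<in> U} \<in> nbhds_one"
    using openin_continuous_map_preimage[OF continuous_inv, of U] assms by (auto simp: nbhds_one_def topspace_eq)
qed simp

text \<open>The translates of \<open>U\<close> by elements of \<open>S\<close> lie in \<open>S\<close>, those by other elements in the
  complement. So \<open>S\<close> is open and closed.\<close>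
lemma nbhds_one_generate:
  assumes conn: "connected_space T" and U: "U \<in> nbhds_one" and S: "subgroup S H" "U \<subseteq> S"
  shows "S = carrier H"
proof -
  interpret S: subgroup S H by fact
  have trans: "openin T {y \<in> carrier H. inv x \<otimes> y \<in> U}" if "x \<in> carrier H" for x
    using openin_continuous_map_preimage[OF continuous_map_mult[OF continuous_map_constant continuous_map_id], of "inv x" U] U that
    by (simp add: nbhds_one_def topspace_eq id_def)
  have self: "x \<in> {y \<in> carrier H. inv x \<otimes> y \<in> U}" if "x \<in> carrier H" for x
    using U that by (simp add: nbhds_one_def)
  have "openin T S"
  proof (subst openin_subopen, intro ballI exI conjI)
    fix x assume x: "x \<in> S"
    then have xH: "x \<in> carrier H" using S.subset by blast
    show "openin T {y \<in> carrier H. inv x \<otimes> y \<in> U}" "x \<in> {y \<in> carrier H. inv x \<otimes> y \<in> U}"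
      using trans[OF xH] self[OF xH] by blast+
    show "{y \<in> carrier H. inv x \<otimes> y \<in> U} \<subseteq> S"
    proof clarify
      fix y assume y: "y \<in> carrier H" "inv x \<otimes> y \<in> U"
      then have "x \<otimes> (inv x \<otimes> y) \<in> S" using x S(2) by blast
      then show "y \<in> S" using xH y by (simp add: m_assoc[symmetric])
    qed
  qed
  moreover have "openin T (carrier H - S)"
  proof (subst openin_subopen, intro ballI exI conjI)
    fix x assume x: "x \<in> carrier H - S"
    then have xH: "x \<in> carrier H" by blast
    show "openin T {y \<in> carrier H. inv x \<otimes> y \<in> U}" "x \<in> {y \<in> carrier H. inv x \<otimes> y \<in> U}"
      using trans[OF xH] self[OF xH] by blast+
    show "{y \<in> carrier H. inv x \<otimes> y \<in> U} \<subseteq> carrier H - S"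
    proof clarify
      fix y assume y: "y \<in> carrier H" "inv x \<otimes> y \<in> U" "y \<in> S"
      then have "y \<otimes> inv (inv x \<otimes> y) \<in> S" using S(2) by blast
      then have "x \<in> S" using xH y(1) by (simp add: inv_mult_group m_assoc[symmetric])
      then show False using x by blast
    qed
  qed
  then have "closedin T S" using S.subset by (simp add: closedin_def topspace_eq)
  ultimately have "S = {} \<or> S = topspace T" using conn by (metis connected_space_clopen_in)
  then show ?thesis using S.one_closed unfolding topspace_eq by blast
qed

end

lemma lie_group_topological_group: "lie_group H T \<A> \<Longrightarrow> topological_group H T"
  by (simp add: lie_group_def topological_group_def topological_group_axioms_def)

locale lie_group_chart = topological_group H T for H :: "('h, 'm) monoid_scheme" (structure) and T +
  fixes \<A> :: "('h, 'e::euclidean_space) chart set" and c :: "('h, 'e) chart"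
  assumes lie: "lie_group H T \<A>" and c_atlas: "c \<in> \<A>" and c_one: "\<one> \<in> fst c"
begin

abbreviation U :: "'h set" where "U \<equiv> fst c"
abbreviation \<kappa> :: "'h \<Rightarrow> 'e" where "\<kappa> \<equiv> snd c"
abbreviation \<psi> :: "'e \<Rightarrow> 'h" where "\<psi> \<equiv> chart_inv c"
abbreviation D :: "'e set" where "D \<equiv> \<kappa> ` U"
abbreviation e0 :: 'e where "e0 \<equiv> \<kappa> \<one>"

lemma chart: "openin T U" "open D" "homeomorphic_map (subtopology T U) (top_of_set D) \<kappa>"
proof -
  have "smooth_manifold T \<A>" using lie by (simp add: lie_group_def)
  then have "smooth_atlas T \<A>" using c_atlas by (auto simp: smooth_manifold_def)
  then have "is_chart T c" using c_atlas by (simp add: smooth_atlas_def)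
  then show "openin T U" "open D" "homeomorphic_map (subtopology T U) (top_of_set D) \<kappa>"
    by (auto simp: is_chart_def)
qed

lemma U_subset: "U \<subseteq> carrier H"
  using chart(1) openin_subset topspace_eq by blast

lemma e0_in_D: "e0 \<in> D"
  using c_one by blast

lemma inj_chart: "inj_on \<kappa> U"
  using chart(3) U_subset topspace_eq by (auto simp: homeomorphic_eq_everything_map Int_absorb1)

lemma psi_kappa: "x \<in> U \<Longrightarrow> \<psi> (\<kappa> x) = x"
  using inj_chart by (simp add: chart_inv_def inv_into_f_f)

lemma kappa_psi: "y \<in> D \<Longrightarrow> \<kappa> (\<psi> y) = y"
  by (simp add: chart_inv_def f_inv_into_f)

lemma psi_in_U: "y \<in> D \<Longrightarrow> \<psi> y \<in> U"
  by (simp add: chart_inv_def inv_into_into)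

lemma psi_e0: "\<psi> e0 = \<one>"
  using psi_kappa c_one by blast

lemma psi_in_H: "y \<in> D \<Longrightarrow> \<psi> y \<in> carrier H"
  using psi_in_U U_subset by blast

lemma continuous_kappa: "continuous_map (subtopology T U) euclidean \<kappa>"
  using homeomorphic_imp_continuous_map[OF chart(3)] continuous_map_into_fulltopology by blast

lemma continuous_psi: "continuous_map (top_of_set D) T \<psi>"
proof -
  obtain g where g: "homeomorphic_maps (subtopology T U) (top_of_set D) \<kappa> g"
    using chart(3) by (auto simp: homeomorphic_map_maps)
  then have gc: "continuous_map (top_of_set D) (subtopology T U) g"
    and gk: "\<And>x. x \<in> U \<Longrightarrow> g (\<kappa> x) = x"
    using U_subset topspace_eq by (auto simp: homeomorphic_maps_def)
  have "continuous_map (top_of_set D) (subtopology T U) \<psi>"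
    by (rule continuous_map_eq[OF gc]) (use gk psi_kappa in auto)
  then show ?thesis by (rule continuous_map_into_fulltopology)
qed

definition mult_coord :: "'e \<times> 'e \<Rightarrow> 'e" where
  "mult_coord = (\<lambda>(x, y). \<kappa> (\<psi> x \<otimes> \<psi> y))"

definition mult_dom :: "('e \<times> 'e) set" where
  "mult_dom = {(x, y). x \<in> D \<and> y \<in> D \<and> \<psi> x \<otimes> \<psi> y \<in> U}"

definition inv_coord :: "'e \<Rightarrow> 'e" where
  "inv_coord = (\<lambda>x. \<kappa> (inv (\<psi> x)))"

lemma smooth_mult: "smooth_on mult_dom mult_coord"
  unfolding mult_dom_def mult_coord_def using lie c_atlas unfolding lie_group_def by blast

lemma smooth_inv: "smooth_on {x. x \<in> D \<and> inv (\<psi> x) \<in> U} inv_coord"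
  unfolding inv_coord_def using lie c_atlas unfolding lie_group_def by blast

text \<open>Continuity near \<open>v\<close> keeps the values in the domain of the chart, where the coordinates
  determine them.\<close>
definition germ :: "('v::real_normed_vector \<Rightarrow> 'h) \<Rightarrow> 'v \<Rightarrow> ('v \<Rightarrow> 'e) \<Rightarrow> bool" where
  "germ P v D' \<longleftrightarrow> P v = \<one> \<and> (\<exists>S. open S \<and> v \<in> S \<and> continuous_map (top_of_set S) T P)
     \<and> ((\<lambda>t. \<kappa> (P t)) has_derivative D') (at v)"

lemma continuous_map_eventually:
  assumes "continuous_map (top_of_set S) T P" "open S" "v \<in> S" "openin T V" "P v \<in> V"
  shows "\<forall>\<^sub>F t in nhds v. P t \<in> V"
proof -
  have "openin (top_of_set S) {t \<in> S. P t \<in> V}"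
    using openin_continuous_map_preimage[OF assms(1,4)] by simp
  then have "open {t \<in> S. P t \<in> V}" using assms(2) openin_open_eq by blast
  then show ?thesis unfolding eventually_nhds using assms by blast
qed

lemma germ_eventually:
  assumes "germ P v D'" "openin T V" "\<one> \<in> V"
  shows "\<forall>\<^sub>F t in nhds v. P t \<in> V"
  using assms continuous_map_eventually[of _ P v V] unfolding germ_def by auto

lemma mult_dom_e0: "x \<in> D \<Longrightarrow> (x, e0) \<in> mult_dom" "x \<in> D \<Longrightarrow> (e0, x) \<in> mult_dom"
  using c_one psi_in_U psi_in_H e0_in_D by (auto simp: mult_dom_def psi_e0)

lemma mult_coord_e0: "x \<in> D \<Longrightarrow> mult_coord (x, e0) = x" "x \<in> D \<Longrightarrow> mult_coord (e0, x) = x"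
  using psi_in_H by (auto simp: mult_coord_def psi_e0 kappa_psi)

lemma eventually_D: "x \<in> D \<Longrightarrow> \<forall>\<^sub>F y in nhds x. y \<in> D"
  using chart(2) eventually_nhds by blast

text \<open>Since the identity is neutral, both partial derivatives are the identity map.\<close>
lemma mult_coord_derivative: "(mult_coord has_derivative (\<lambda>(u, v). u + v)) (at (e0, e0))"
proof -
  let ?F = "frechet_derivative mult_coord (at (e0, e0))"
  have F: "(mult_coord has_derivative ?F) (at (e0, e0))"
    by (rule smooth_on_imp_differentiable(1)[OF smooth_mult mult_dom_e0(1)[OF e0_in_D]])
  have "((\<lambda>x. mult_coord (x, e0)) has_derivative (\<lambda>u. ?F (u, 0))) (at e0)"
    by (rule has_derivative_compose[where f = "\<lambda>x. (x, e0)", OF _ F]) (auto intro!: derivative_eq_intros)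
  then have "((\<lambda>x. x) has_derivative (\<lambda>u. ?F (u, 0))) (at e0)"
    by (rule has_derivative_eq_nhds) (use eventually_D[OF e0_in_D] mult_coord_e0 in \<open>auto elim: eventually_mono\<close>)
  then have 1: "?F (u, 0) = u" for u using has_derivative_unique[OF has_derivative_ident] by metis
  have "((\<lambda>x. mult_coord (e0, x)) has_derivative (\<lambda>u. ?F (0, u))) (at e0)"
    by (rule has_derivative_compose[where f = "\<lambda>x. (e0, x)", OF _ F]) (auto intro!: derivative_eq_intros)
  then have "((\<lambda>x. x) has_derivative (\<lambda>u. ?F (0, u))) (at e0)"
    by (rule has_derivative_eq_nhds) (use eventually_D[OF e0_in_D] mult_coord_e0 in \<open>auto elim: eventually_mono\<close>)
  then have 2: "?F (0, u) = u" for u using has_derivative_unique[OF has_derivative_ident] by metis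
  have "?F (u, v) = ?F (u, 0) + ?F (0, v)" for u v
    using linear_add[OF has_derivative_linear[OF F], of "(u, 0)" "(0, v)"] by simp
  then have "?F = (\<lambda>(u, v). u + v)" using 1 2 by auto
  then show ?thesis using F by simp
qed

lemma germ_mult:
  assumes P: "germ P v D1" and Q: "germ Q v D2"
  shows "germ (\<lambda>t. P t \<otimes> Q t) v (\<lambda>t. D1 t + D2 t)"
proof -
  obtain S1 S2 where S: "open S1" "v \<in> S1" "continuous_map (top_of_set S1) T P"
    "open S2" "v \<in> S2" "continuous_map (top_of_set S2) T Q" using assms by (auto simp: germ_def)
  have "continuous_map (top_of_set (S1 \<inter> S2)) T P" "continuous_map (top_of_set (S1 \<inter> S2)) T Q"
    using S continuous_map_from_subtopology_mono by (metis Int_lower1 Int_lower2)+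
  then have "continuous_map (top_of_set (S1 \<inter> S2)) T (\<lambda>t. P t \<otimes> Q t)"
    by (rule continuous_map_mult)
  moreover have "open (S1 \<inter> S2)" "v \<in> S1 \<inter> S2" using S by auto
  moreover have "((\<lambda>t. \<kappa> (P t \<otimes> Q t)) has_derivative (\<lambda>t. D1 t + D2 t)) (at v)"
  proof (rule has_derivative_eq_nhds)
    have pair: "((\<lambda>t. (\<kappa> (P t), \<kappa> (Q t))) has_derivative (\<lambda>t. (D1 t, D2 t))) (at v)"
      using P Q by (auto simp: germ_def intro: has_derivative_Pair)
    have at: "(\<kappa> (P v), \<kappa> (Q v)) = (e0, e0)" using P Q by (simp add: germ_def)
    from has_derivative_compose[OF pair, of mult_coord "\<lambda>(u, v). u + v"]
    show "((\<lambda>t. mult_coord (\<kappa> (P t), \<kappa> (Q t))) has_derivative (\<lambda>t. D1 t + D2 t)) (at v)"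
      unfolding at using mult_coord_derivative by simp
    have "\<forall>\<^sub>F t in nhds v. P t \<in> U" "\<forall>\<^sub>F t in nhds v. Q t \<in> U"
      using germ_eventually[OF P chart(1) c_one] germ_eventually[OF Q chart(1) c_one] by auto
    then show "\<forall>\<^sub>F t in nhds v. mult_coord (\<kappa> (P t), \<kappa> (Q t)) = \<kappa> (P t \<otimes> Q t)"
      by eventually_elim (simp add: mult_coord_def psi_kappa)
  qed
  ultimately show ?thesis using P Q unfolding germ_def by auto
qed

lemma germ_psi: "germ \<psi> e0 (\<lambda>u. u)"
  unfolding germ_def
proof (intro conjI exI)
  show "((\<lambda>t. \<kappa> (\<psi> t)) has_derivative (\<lambda>u. u)) (at e0)"
    by (rule has_derivative_eq_nhds[OF has_derivative_ident])
      (use eventually_D[OF e0_in_D] kappa_psi in \<open>auto elim: eventually_mono\<close>)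
qed (use psi_e0 chart(2) e0_in_D continuous_psi in auto)

lemma germ_one: "germ (\<lambda>t. \<one>) v (\<lambda>t. 0)"
  unfolding germ_def using continuous_map_constant[of "\<one>"] by (auto intro!: exI[of _ UNIV])

text \<open>Smoothness of the inversion provides a derivative, and the product \<open>P t \<otimes> inv (P t)\<close> being
  constant determines it.\<close>
lemma germ_inv:
  assumes P: "germ P v D1"
  shows "germ (\<lambda>t. inv (P t)) v (\<lambda>t. - D1 t)"
proof -
  obtain S where S: "open S" "v \<in> S" "continuous_map (top_of_set S) T P" using P by (auto simp: germ_def)
  let ?F = "frechet_derivative inv_coord (at e0)"
  have F: "(inv_coord has_derivative ?F) (at e0)"
    by (rule smooth_on_imp_differentiable(1)[OF smooth_inv]) (use e0_in_D c_one psi_e0 in auto)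
  have at: "\<kappa> (P v) = e0" using P by (simp add: germ_def)
  have "((\<lambda>t. inv_coord (\<kappa> (P t))) has_derivative (\<lambda>t. ?F (D1 t))) (at v)"
    using has_derivative_compose[of "\<lambda>t. \<kappa> (P t)" D1 v UNIV inv_coord ?F] P F at by (simp add: germ_def)
  moreover have "\<forall>\<^sub>F t in nhds v. inv_coord (\<kappa> (P t)) = \<kappa> (inv (P t))"
    using germ_eventually[OF P chart(1) c_one] by eventually_elim (simp add: inv_coord_def psi_kappa)
  ultimately have "((\<lambda>t. \<kappa> (inv (P t))) has_derivative (\<lambda>t. ?F (D1 t))) (at v)"
    by (rule has_derivative_eq_nhds)
  then have g: "germ (\<lambda>t. inv (P t)) v (\<lambda>t. ?F (D1 t))"
    unfolding germ_def using P S continuous_map_inv[OF S(3)] by (auto simp: germ_def)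
  from germ_mult[OF P g] have m: "germ (\<lambda>t. P t \<otimes> inv (P t)) v (\<lambda>t. D1 t + ?F (D1 t))" .
  have "((\<lambda>t. \<kappa> \<one>) has_derivative (\<lambda>t. D1 t + ?F (D1 t))) (at v)"
  proof (rule has_derivative_eq_nhds)
    show "((\<lambda>t. \<kappa> (P t \<otimes> inv (P t))) has_derivative (\<lambda>t. D1 t + ?F (D1 t))) (at v)"
      using m by (simp add: germ_def)
    show "\<forall>\<^sub>F t in nhds v. \<kappa> (P t \<otimes> inv (P t)) = \<kappa> \<one>"
      using germ_eventually[OF P chart(1) c_one] by eventually_elim (use U_subset in auto)
  qed
  then have "(\<lambda>t. D1 t + ?F (D1 t)) = (\<lambda>t. 0)"
    by (rule has_derivative_unique) (rule has_derivative_const)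
  then have "?F (D1 t) = - D1 t" for t by (metis add_eq_0_iff)
  then show ?thesis using g by simp
qed

lemma germ_compose:
  assumes P: "germ P v D1" and k: "(k has_derivative k') (at w)" "continuous_on UNIV k" "k w = v"
  shows "germ (\<lambda>t. P (k t)) w (\<lambda>t. D1 (k' t))"
proof -
  obtain S where S: "open S" "v \<in> S" "continuous_map (top_of_set S) T P" using P by (auto simp: germ_def)
  have "open (k -` S)" using k(2) S(1) by (simp add: continuous_open_vimage continuous_on_eq_continuous_at)
  moreover have "continuous_map (top_of_set (k -` S)) T (\<lambda>t. P (k t))"
  proof -
    have "continuous_on (k -` S) k" using continuous_on_subset[OF k(2)] by blast
    then have "continuous_map (top_of_set (k -` S)) (top_of_set S) k" by auto
    from continuous_map_compose[OF this S(3)] show ?thesis by (simp add: o_def)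
  qed
  moreover have "((\<lambda>t. \<kappa> (P (k t))) has_derivative (\<lambda>t. D1 (k' t))) (at w)"
    using has_derivative_compose[OF k(1), of "\<lambda>t. \<kappa> (P t)" D1] P k(3) by (simp add: germ_def)
  ultimately show ?thesis using P S(2) k(3) unfolding germ_def by auto
qed

lemma germ_power:
  assumes P: "germ P v D1"
  shows "germ (\<lambda>t. P t [^] (m::nat)) v (\<lambda>t. of_nat m *\<^sub>R D1 t)"
proof (induction m)
  case 0
  then show ?case using germ_one by simp
next
  case (Suc m)
  have "(\<lambda>t. of_nat (Suc m) *\<^sub>R D1 t) = (\<lambda>t. of_nat m *\<^sub>R D1 t + D1 t)"
    by (simp add: scaleR_add_left add.commute)
  then show ?case using germ_mult[OF Suc P] by simp
qed

lemma germ_continuous_kappa: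
  assumes P: "germ P v D1"
  obtains S where "open S" "v \<in> S" "continuous_map (top_of_set S) T P" "\<And>t. t \<in> S \<Longrightarrow> P t \<in> U"
    "continuous_on S (\<lambda>t. \<kappa> (P t))"
proof -
  obtain S where S: "open S" "v \<in> S" "continuous_map (top_of_set S) T P" using P by (auto simp: germ_def)
  obtain S' where S': "open S'" "v \<in> S'" "\<And>t. t \<in> S' \<Longrightarrow> P t \<in> U"
    using germ_eventually[OF P chart(1) c_one] unfolding eventually_nhds by blast
  have c: "continuous_map (top_of_set (S \<inter> S')) T P"
    using S continuous_map_from_subtopology_mono by (metis Int_lower1)
  then have "continuous_map (top_of_set (S \<inter> S')) (subtopology T U) P"
    using S'(3) by (auto simp: continuous_map_in_subtopology)
  from continuous_map_compose[OF this continuous_kappa]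
  have "continuous_on (S \<inter> S') (\<lambda>t. \<kappa> (P t))" by (simp add: o_def)
  then show ?thesis using that[of "S \<inter> S'"] S S' c by auto
qed

text \<open>Let \<open>f\<close> be the \<open>m\<close>-th power map in the coordinates. It has the derivative \<open>m\<close> at \<open>e0\<close>, so
  near \<open>e0\<close> it differs from its linearisation by at most \<open>norm (x - e0)\<close>. As \<open>2 / m \<le> 1\<close>,
  for \<open>y\<close> in a small ball the map \<open>x \<mapsto> x + (y - f x) / m\<close> sends this ball to itself. Its
  fixed point given by Brouwer's theorem is an \<open>m\<close>-th root of \<open>y\<close>. The root lies in the same
  ball, so the construction can be iterated.\<close>
theorem divisible_neighbourhood:
  fixes m :: nat
  assumes m: "m \<ge> 2"
  obtains B where "B \<in> nbhds_one"
    "\<And>x. x \<in> B \<Longrightarrow> \<exists>g. g 0 = x \<and> (\<forall>j. g j \<in> carrier H \<and> g (Suc j) [^] m = g j)"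
proof -
  let ?P = "\<lambda>t. \<psi> t [^] m"
  have germ: "germ ?P e0 (\<lambda>u. of_nat m *\<^sub>R u)" using germ_power[OF germ_psi] .
  obtain S where S: "open S" "e0 \<in> S" "\<And>t. t \<in> S \<Longrightarrow> ?P t \<in> U" "continuous_on S (\<lambda>t. \<kappa> (?P t))"
    using germ_continuous_kappa[OF germ] by metis
  have der: "((\<lambda>t. \<kappa> (?P t)) has_derivative (\<lambda>u. of_nat m *\<^sub>R u)) (at e0)" and val: "\<kappa> (?P e0) = e0"
    using germ by (auto simp: germ_def)
  obtain d where d: "d > 0" "\<And>y. norm (y - e0) < d \<Longrightarrow> norm (\<kappa> (?P y) - e0 - of_nat m *\<^sub>R (y - e0)) \<le> 1 * norm (y - e0)"
    using der val unfolding has_derivative_at_alt by (metis zero_less_one)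
  obtain r0 where r0: "r0 > 0" "cball e0 r0 \<subseteq> S \<inter> D"
    using open_contains_cball[of "S \<inter> D"] S(1,2) chart(2) e0_in_D by (metis Int_iff open_Int)
  define r where "r = min r0 (d / 2)"
  have r: "r > 0" "cball e0 r \<subseteq> S" "cball e0 r \<subseteq> D" "r < d" using r0 d(1) by (auto simp: r_def)
  have root: "\<exists>x\<in>cball e0 r. ?P x = \<psi> y" if y: "y \<in> cball e0 r" for y
  proof -
    let ?f = "\<lambda>x. x + (1 / of_nat m) *\<^sub>R (y - \<kappa> (?P x))"
    have cf: "continuous_on (cball e0 r) ?f"
      by (intro continuous_intros continuous_on_subset[OF S(4)]) (use r in auto)
    have maps: "?f \<in> cball e0 r \<rightarrow> cball e0 r"
    proof
      fix x assume x: "x \<in> cball e0 r"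
      have m0: "real m > 0" using m by simp
      have "?f x - e0 = (1 / of_nat m) *\<^sub>R ((y - e0) - (\<kappa> (?P x) - e0 - of_nat m *\<^sub>R (x - e0)))"
        using m0 by (simp add: algebra_simps)
      then have "norm (?f x - e0) = (1 / real m) * norm ((y - e0) - (\<kappa> (?P x) - e0 - of_nat m *\<^sub>R (x - e0)))"
        by simp
      also have "\<dots> \<le> (1 / real m) * (r + r)"
      proof (rule mult_left_mono)
        have "norm (\<kappa> (?P x) - e0 - of_nat m *\<^sub>R (x - e0)) \<le> r"
          using d(2)[of x] x r(4) by (simp add: dist_norm norm_minus_commute)
        moreover have "norm (y - e0) \<le> r" using y by (simp add: dist_norm norm_minus_commute)
        ultimately show "norm ((y - e0) - (\<kappa> (?P x) - e0 - of_nat m *\<^sub>R (x - e0))) \<le> r + r"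
          by (meson add_mono norm_triangle_ineq4 order_trans)
      qed simp
      also have "\<dots> \<le> r" using m r(1) by (simp add: field_simps)
      finally show "?f x \<in> cball e0 r" by (simp add: dist_norm norm_minus_commute)
    qed
    have ne: "cball e0 r \<noteq> {}" using r(1) by simp
    obtain x where x: "x \<in> cball e0 r" "?f x = x"
      by (rule brouwer[OF compact_cball convex_cball ne cf maps])
    then have "\<kappa> (?P x) = y" using m by simp
    then have "?P x = \<psi> y" using S(3)[of x] x(1) r(2) psi_kappa by (metis subsetD)
    then show ?thesis using x by blast
  qed
  define B where "B = {x \<in> U. \<kappa> x \<in> ball e0 r}"
  have "openin (subtopology T U) B"
    using openin_continuous_map_preimage[OF continuous_kappa, of "ball e0 r"] U_subset
    by (simp add: B_def topspace_eq Int_absorb1)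
  then have "openin T B" using chart(1) openin_trans_full by blast
  moreover have "\<one> \<in> B" using c_one r(1) by (simp add: B_def)
  ultimately have "B \<in> nbhds_one" by (simp add: nbhds_one_def)
  moreover have "\<exists>g. g 0 = x \<and> (\<forall>j. g j \<in> carrier H \<and> g (Suc j) [^] m = g j)" if x: "x \<in> B" for x
  proof -
    obtain rt where rt: "\<And>y. y \<in> cball e0 r \<Longrightarrow> rt y \<in> cball e0 r \<and> ?P (rt y) = \<psi> y"
      using root by metis
    define y where "y j = (rt ^^ j) (\<kappa> x)" for j
    have y: "y j \<in> cball e0 r" for j
      unfolding y_def by (induction j) (use x rt in \<open>auto simp: B_def less_imp_le\<close>)
    have "\<psi> (y 0) = x" using x by (simp add: y_def B_def psi_kappa)
    moreover have "\<psi> (y j) \<in> carrier H \<and> \<psi> (y (Suc j)) [^] m = \<psi> (y j)" for j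
      using rt[OF y, of j] psi_in_H[OF subsetD[OF r(3) y[of j]]] by (simp add: y_def)
    ultimately show ?thesis by (intro exI[of _ "\<lambda>j. \<psi> (y j)"]) auto
  qed
  ultimately show ?thesis using that by blast
qed

end

section \<open>The adjoint action and the bracket of a Lie group\<close>

context lie_group_chart
begin

definition Ad :: "'h \<Rightarrow> 'e \<Rightarrow> 'e" where "Ad = lie_Ad H c"

definition bracket :: "'e \<Rightarrow> 'e \<Rightarrow> 'e" where "bracket = lie_bracket H c"

text \<open>For \<open>a\<close> in this set, conjugation by \<open>a\<close> is a composition of two multiplications in the
  chart.\<close>
definition V :: "'h set" where "V = {a \<in> U. inv a \<in> U}"

lemma openin_V: "openin T V"
proof -
  have "V = U \<inter> {a \<in> topspace T. inv a \<in> U}" using U_subset by (auto simp: V_def topspace_eq)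
  then show ?thesis using openin_continuous_map_preimage[OF continuous_inv chart(1)] chart(1) by auto
qed

lemma one_in_V: "\<one> \<in> V"
  using c_one by (simp add: V_def)

lemma V_subset: "V \<subseteq> carrier H"
  using U_subset by (auto simp: V_def)

definition conj_coord :: "'h \<Rightarrow> 'e \<Rightarrow> 'e" where
  "conj_coord a = (\<lambda>x. \<kappa> (a \<otimes> \<psi> x \<otimes> inv a))"

lemma Ad_eq: "Ad a = frechet_derivative (conj_coord a) (at e0)"
  by (simp add: Ad_def lie_Ad_def conj_coord_def)

lemma eventually_psi:
  assumes "openin T W" "x \<in> D" "\<psi> x \<in> W"
  shows "\<forall>\<^sub>F y in nhds x. \<psi> y \<in> W"
  by (rule continuous_map_eventually[OF continuous_psi chart(2)]) (use assms in auto)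

text \<open>The chain rule for \<open>x \<mapsto> (a \<psi>(x)) a\<^sup>-\<^sup>1\<close>. The formula shows how the derivative depends on
  \<open>a\<close>, so that it can be differentiated once more.\<close>
lemma conj_coord_derivative:
  assumes a: "a \<in> V"
  shows "(conj_coord a has_derivative
      (\<lambda>v. frechet_derivative mult_coord (at (\<kappa> a, inv_coord (\<kappa> a)))
             (frechet_derivative mult_coord (at (\<kappa> a, e0)) (0, v), 0))) (at e0)"
proof -
  have aU: "a \<in> U" "inv a \<in> U" "a \<in> carrier H" using a V_subset by (auto simp: V_def)
  have aD: "\<kappa> a \<in> D" "\<kappa> (inv a) \<in> D" using aU by auto
  have ia: "inv_coord (\<kappa> a) = \<kappa> (inv a)" by (simp add: inv_coord_def psi_kappa aU)
  have d1: "(mult_coord has_derivative frechet_derivative mult_coord (at (\<kappa> a, e0))) (at (\<kappa> a, e0))"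
    by (rule smooth_on_imp_differentiable(1)[OF smooth_mult mult_dom_e0(1)[OF aD(1)]])
  have d1': "((\<lambda>x. mult_coord (\<kappa> a, x)) has_derivative (\<lambda>v. frechet_derivative mult_coord (at (\<kappa> a, e0)) (0, v))) (at e0)"
    by (rule has_derivative_compose[where f = "\<lambda>x. (\<kappa> a, x)", OF _ d1]) (auto intro!: derivative_eq_intros)
  have "(\<kappa> a, \<kappa> (inv a)) \<in> mult_dom" using aU c_one by (auto simp: mult_dom_def psi_kappa)
  then have d2: "(mult_coord has_derivative frechet_derivative mult_coord (at (\<kappa> a, \<kappa> (inv a)))) (at (\<kappa> a, \<kappa> (inv a)))"
    by (rule smooth_on_imp_differentiable(1)[OF smooth_mult])
  have ma: "mult_coord (\<kappa> a, e0) = \<kappa> a" using mult_coord_e0(1)[OF aD(1)] .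
  have d2': "((\<lambda>y. mult_coord (y, \<kappa> (inv a))) has_derivative (\<lambda>v. frechet_derivative mult_coord (at (\<kappa> a, \<kappa> (inv a))) (v, 0)))
      (at (mult_coord (\<kappa> a, e0)))"
    unfolding ma
    by (rule has_derivative_compose[where f = "\<lambda>y. (y, \<kappa> (inv a))", OF _ d2]) (auto intro!: derivative_eq_intros)
  have "((\<lambda>x. mult_coord (mult_coord (\<kappa> a, x), \<kappa> (inv a))) has_derivative
      (\<lambda>v. frechet_derivative mult_coord (at (\<kappa> a, \<kappa> (inv a))) (frechet_derivative mult_coord (at (\<kappa> a, e0)) (0, v), 0))) (at e0)"
    using has_derivative_compose[OF d1' d2'] by simp
  moreover have "\<forall>\<^sub>F x in nhds e0. mult_coord (mult_coord (\<kappa> a, x), \<kappa> (inv a)) = conj_coord a x"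
  proof -
    have "continuous_map (top_of_set D) T (\<lambda>x. a \<otimes> \<psi> x)"
      by (intro continuous_map_mult continuous_map_constant continuous_psi aU)
    then have "\<forall>\<^sub>F x in nhds e0. a \<otimes> \<psi> x \<in> U"
      by (rule continuous_map_eventually[OF _ chart(2) e0_in_D chart(1)]) (use aU psi_e0 in simp)
    then show ?thesis
      by eventually_elim (simp add: mult_coord_def conj_coord_def psi_kappa aU)
  qed
  ultimately show ?thesis unfolding ia by (rule has_derivative_eq_nhds)
qed

lemma Ad_formula:
  "a \<in> V \<Longrightarrow> Ad a v = frechet_derivative mult_coord (at (\<kappa> a, inv_coord (\<kappa> a)))
             (frechet_derivative mult_coord (at (\<kappa> a, e0)) (0, v), 0)"
  using frechet_derivative_at[OF conj_coord_derivative] by (metis Ad_eq)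

lemma Ad_derivative: "a \<in> V \<Longrightarrow> (conj_coord a has_derivative Ad a) (at e0)"
  using conj_coord_derivative frechet_derivative_at Ad_eq by metis

lemma linear_Ad: "a \<in> V \<Longrightarrow> linear (Ad a)"
  using Ad_derivative has_derivative_linear by blast

lemma conj_coord_e0: "a \<in> carrier H \<Longrightarrow> conj_coord a e0 = e0"
  by (simp add: conj_coord_def psi_e0)

lemma conj_eventually_U:
  assumes "a \<in> carrier H" "openin T W" "\<one> \<in> W"
  shows "\<forall>\<^sub>F x in nhds e0. a \<otimes> \<psi> x \<otimes> inv a \<in> W"
proof -
  have "continuous_map (top_of_set D) T (\<lambda>x. a \<otimes> \<psi> x \<otimes> inv a)"
    by (intro continuous_map_mult continuous_map_constant continuous_psi assms inv_closed)
  then show ?thesis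
    by (rule continuous_map_eventually[OF _ chart(2) e0_in_D assms(2)]) (use assms psi_e0 in simp)
qed

lemma Ad_mult:
  assumes "a \<in> V" "b \<in> V" "a \<otimes> b \<in> V"
  shows "Ad (a \<otimes> b) v = Ad a (Ad b v)"
proof -
  have H: "a \<in> carrier H" "b \<in> carrier H" using assms V_subset by auto
  have "((\<lambda>x. conj_coord a (conj_coord b x)) has_derivative (\<lambda>v. Ad a (Ad b v))) (at e0)"
    using has_derivative_compose[OF Ad_derivative[OF assms(2)], of "conj_coord a" "Ad a"]
      Ad_derivative[OF assms(1)] conj_coord_e0[OF H(2)] by simp
  then have "(conj_coord (a \<otimes> b) has_derivative (\<lambda>v. Ad a (Ad b v))) (at e0)"
  proof (rule has_derivative_eq_nhds)
    show "\<forall>\<^sub>F x in nhds e0. conj_coord a (conj_coord b x) = conj_coord (a \<otimes> b) x"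
      using conj_eventually_U[OF H(2) chart(1) c_one] eventually_D[OF e0_in_D]
      by eventually_elim (use H psi_in_H in \<open>simp add: conj_coord_def psi_kappa inv_mult_group m_assoc\<close>)
  qed
  then show ?thesis using has_derivative_unique[OF Ad_derivative[OF assms(3)]] by metis
qed

lemma Ad_one: "Ad \<one> v = v"
proof -
  have "(conj_coord \<one> has_derivative (\<lambda>v. v)) (at e0)"
    by (rule has_derivative_eq_nhds[OF has_derivative_ident])
       (use eventually_D[OF e0_in_D] in \<open>eventually_elim, simp add: conj_coord_def psi_in_H kappa_psi\<close>)
  then show ?thesis using has_derivative_unique[OF Ad_derivative[OF one_in_V]] by metis
qed

lemma eventually_psi_V: "\<forall>\<^sub>F x in nhds e0. x \<in> D \<and> \<psi> x \<in> V"
  using eventually_D[OF e0_in_D] eventually_psi[OF openin_V e0_in_D] one_in_V psi_e0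
  by (simp add: eventually_conj)

text \<open>In the formula for \<open>Ad\<close> a derivative of the multiplication is applied to a vector that
  itself depends on \<open>x\<close>. Expanding this vector in the basis separates the two dependences.\<close>
lemma Ad_differentiable: "(\<lambda>x. Ad (\<psi> x) v) differentiable (at e0)"
proof -
  let ?F = "\<lambda>z. frechet_derivative mult_coord (at z)"
  let ?w = "\<lambda>x. ?F (x, e0) (0, v)"
  have lin: "linear (?F z)" if "z \<in> mult_dom" for z
    by (rule has_derivative_linear[OF smooth_on_imp_differentiable(1)[OF smooth_mult that]])
  have w: "?w differentiable (at e0)"
    using differentiable_compose[of "\<lambda>z. ?F z (0, v)" "\<lambda>x. (x, e0)" e0 UNIV]
      smooth_on_imp_differentiable(2)[OF smooth_mult mult_dom_e0(1)[OF e0_in_D]]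
    by (auto intro!: derivative_intros)
  have i: "inv_coord differentiable (at e0)" "inv_coord e0 = e0"
    using smooth_on_imp_differentiable(1)[OF smooth_inv, of e0] e0_in_D c_one psi_e0
    by (auto simp: inv_coord_def differentiable_def)
  have b: "(\<lambda>x. ?F (x, inv_coord x) (b, 0)) differentiable (at e0)" for b
    using differentiable_compose[of "\<lambda>z. ?F z (b, 0)" "\<lambda>x. (x, inv_coord x)" e0 UNIV] i
      smooth_on_imp_differentiable(2)[OF smooth_mult mult_dom_e0(1)[OF e0_in_D]]
    by (auto intro!: derivative_intros)
  obtain w' where w': "(?w has_derivative w') (at e0)" using w by (auto simp: differentiable_def)
  obtain g where g: "\<And>b. ((\<lambda>x. ?F (x, inv_coord x) (b, 0)) has_derivative g b) (at e0)"
    using b unfolding differentiable_def by metis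
  have der: "((\<lambda>x. \<Sum>b\<in>Basis. (?w x \<bullet> b) *\<^sub>R ?F (x, inv_coord x) (b, 0)) has_derivative
      (\<lambda>h. \<Sum>b\<in>Basis. (?w e0 \<bullet> b) *\<^sub>R g b h + (w' h \<bullet> b) *\<^sub>R ?F (e0, inv_coord e0) (b, 0))) (at e0)"
    by (intro has_derivative_sum has_derivative_scaleR has_derivative_inner_left w' g)
  have ev: "\<forall>\<^sub>F x in nhds e0. (\<Sum>b\<in>Basis. (?w x \<bullet> b) *\<^sub>R ?F (x, inv_coord x) (b, 0)) = Ad (\<psi> x) v"
    using eventually_psi_V
  proof eventually_elim
    case (elim x)
    have "\<psi> x \<otimes> inv (\<psi> x) \<in> U" using elim psi_in_H c_one by simp
    then have dom: "(x, inv_coord x) \<in> mult_dom"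
      using elim by (auto simp: mult_dom_def inv_coord_def V_def psi_kappa)
    have "(\<Sum>b\<in>Basis. (?w x \<bullet> b) *\<^sub>R ?F (x, inv_coord x) (b, 0)) = ?F (x, inv_coord x) (\<Sum>b\<in>Basis. (?w x \<bullet> b) *\<^sub>R (b, 0))"
      by (simp only: linear_sum[OF lin[OF dom]] linear_scale[OF lin[OF dom]])
    also have "(\<Sum>b\<in>Basis. (?w x \<bullet> b) *\<^sub>R (b, 0::'e)) = (?w x, 0)"
      by (simp add: sum_prod[symmetric] prod_eq_iff fst_sum snd_sum euclidean_representation)
    also have "?F (x, inv_coord x) (?w x, 0) = Ad (\<psi> x) v"
      using Ad_formula[of "\<psi> x" v] elim by (simp add: kappa_psi)
    finally show ?case .
  qed
  show ?thesis unfolding differentiable_def by (rule exI, rule has_derivative_eq_nhds[OF der ev])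
qed

lemma bracket_derivative: "((\<lambda>x. Ad (\<psi> x) v) has_derivative (\<lambda>u. bracket u v)) (at e0)"
proof -
  have "(\<lambda>u. bracket u v) = frechet_derivative (\<lambda>x. Ad (\<psi> x) v) (at e0)"
    by (simp add: bracket_def lie_bracket_def Ad_def fun_eq_iff)
  then show ?thesis using Ad_differentiable by (simp add: frechet_derivative_works)
qed

lemma linear_bracket_left: "linear (\<lambda>u. bracket u v)"
  using bracket_derivative has_derivative_linear by blast

lemma linear_bracket_right: "linear (bracket u)"
proof (rule linearI)
  fix v w
  have "((\<lambda>x. Ad (\<psi> x) v + Ad (\<psi> x) w) has_derivative (\<lambda>u. bracket u v + bracket u w)) (at e0)"
    by (intro has_derivative_add bracket_derivative)
  then have "((\<lambda>x. Ad (\<psi> x) (v + w)) has_derivative (\<lambda>u. bracket u v + bracket u w)) (at e0)"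
    by (rule has_derivative_eq_nhds)
       (use eventually_psi_V in \<open>eventually_elim, simp add: linear_add[OF linear_Ad]\<close>)
  then show "bracket u (v + w) = bracket u v + bracket u w"
    using has_derivative_unique[OF bracket_derivative] by metis
next
  fix r v
  have "((\<lambda>x. r *\<^sub>R Ad (\<psi> x) v) has_derivative (\<lambda>u. r *\<^sub>R bracket u v)) (at e0)"
    by (intro has_derivative_scaleR_right bracket_derivative)
  then have "((\<lambda>x. Ad (\<psi> x) (r *\<^sub>R v)) has_derivative (\<lambda>u. r *\<^sub>R bracket u v)) (at e0)"
    by (rule has_derivative_eq_nhds)
       (use eventually_psi_V in \<open>eventually_elim, simp add: linear_scale[OF linear_Ad]\<close>)
  then show "bracket u (r *\<^sub>R v) = r *\<^sub>R bracket u v"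
    using has_derivative_unique[OF bracket_derivative] by metis
qed

text \<open>Both sides are derivatives at the identity of the same function of \<open>x\<close>, because \<open>a \<psi>(x) = (a
  \<psi>(x) a\<^sup>-\<^sup>1) a\<close>.\<close>
lemma Ad_bracket:
  assumes a: "a \<in> V"
  shows "Ad a (bracket w z) = bracket (Ad a w) (Ad a z)"
proof -
  have aH: "a \<in> carrier H" using a V_subset by blast
  have bl: "bounded_linear (Ad a)" using linear_Ad[OF a] linear_conv_bounded_linear by blast
  have "((\<lambda>x. Ad a (Ad (\<psi> x) z)) has_derivative (\<lambda>w. Ad a (bracket w z))) (at e0)"
    by (rule bounded_linear.has_derivative[OF bl bracket_derivative])
  moreover have "((\<lambda>x. Ad a (Ad (\<psi> x) z)) has_derivative (\<lambda>w. bracket (Ad a w) (Ad a z))) (at e0)"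
  proof (rule has_derivative_eq_nhds)
    show "((\<lambda>x. Ad (\<psi> (conj_coord a x)) (Ad a z)) has_derivative (\<lambda>w. bracket (Ad a w) (Ad a z))) (at e0)"
      using has_derivative_compose[OF Ad_derivative[OF a], of "\<lambda>x. Ad (\<psi> x) (Ad a z)" "\<lambda>u. bracket u (Ad a z)"]
        bracket_derivative conj_coord_e0[OF aH] by simp
    have "continuous_map (top_of_set D) T (\<lambda>x. a \<otimes> \<psi> x)"
      by (intro continuous_map_mult continuous_map_constant continuous_psi aH)
    then have "\<forall>\<^sub>F x in nhds e0. a \<otimes> \<psi> x \<in> V"
      by (rule continuous_map_eventually[OF _ chart(2) e0_in_D openin_V]) (use a aH psi_e0 in simp)
    with eventually_psi_V conj_eventually_U[OF aH openin_V one_in_V]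
    show "\<forall>\<^sub>F x in nhds e0. Ad (\<psi> (conj_coord a x)) (Ad a z) = Ad a (Ad (\<psi> x) z)"
    proof eventually_elim
      case (elim x)
      let ?b = "a \<otimes> \<psi> x \<otimes> inv a"
      have xH: "\<psi> x \<in> carrier H" using elim psi_in_H by blast
      have "\<psi> (conj_coord a x) = ?b" using elim by (simp add: conj_coord_def psi_kappa V_def)
      moreover have "?b \<otimes> a = a \<otimes> \<psi> x" using aH xH by (simp add: m_assoc)
      ultimately show ?case
        using Ad_mult[of ?b a z] Ad_mult[of a "\<psi> x" z] elim a by simp
    qed
  qed
  ultimately show ?thesis using has_derivative_unique by metis
qed

text \<open>The derivative of the invariance of the bracket under \<open>Ad a\<close>, with respect to \<open>a\<close> at the
  identity.\<close>
lemma bracket_leibniz: "bracket u (bracket w z) = bracket (bracket u w) z + bracket w (bracket u z)"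
proof -
  have "bounded_bilinear bracket"
    unfolding bilinear_conv_bounded_bilinear[symmetric] bilinear_def
    using linear_bracket_left linear_bracket_right by blast
  from bounded_bilinear.FDERIV[OF this bracket_derivative bracket_derivative]
  have "((\<lambda>x. bracket (Ad (\<psi> x) w) (Ad (\<psi> x) z)) has_derivative
      (\<lambda>u. bracket (Ad (\<psi> e0) w) (bracket u z) + bracket (bracket u w) (Ad (\<psi> e0) z))) (at e0)" .
  then have "((\<lambda>x. Ad (\<psi> x) (bracket w z)) has_derivative
      (\<lambda>u. bracket w (bracket u z) + bracket (bracket u w) z)) (at e0)"
    unfolding psi_e0 Ad_one
    by (rule has_derivative_eq_nhds) (use eventually_psi_V in \<open>eventually_elim, simp add: Ad_bracket\<close>)
  from fun_cong[OF has_derivative_unique[OF bracket_derivative this], of u]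
  show ?thesis by (simp only: add.commute)
qed

text \<open>The bracket is a limit of difference quotients of \<open>Ad\<close>, and linear subspaces are closed.\<close>
lemma bracket_in_Ad_span: "bracket u v \<in> span {Ad a w - w | a w. a \<in> V}"
proof -
  let ?S = "span {Ad a w - w | a w. a \<in> V}"
  have at0: "((\<lambda>t. e0 + t *\<^sub>R u) has_derivative (\<lambda>t. t *\<^sub>R u)) (at (0::real))"
    by (auto intro!: derivative_eq_intros)
  have der: "((\<lambda>t. Ad (\<psi> (e0 + t *\<^sub>R u)) v) has_derivative (\<lambda>t. bracket (t *\<^sub>R u) v)) (at 0)"
    using has_derivative_compose[OF at0, of "\<lambda>x. Ad (\<psi> x) v" "\<lambda>u. bracket u v"] bracket_derivative by simp
  let ?f = "\<lambda>t. Ad (\<psi> (e0 + t *\<^sub>R u)) v"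
  have "((\<lambda>t. norm (?f (0 + t) - ?f 0 - bracket (t *\<^sub>R u) v) / norm t) \<longlongrightarrow> 0) (at 0)"
    using der unfolding has_derivative_at by blast
  moreover have "\<forall>\<^sub>F t in at 0. norm (?f (0 + t) - ?f 0 - bracket (t *\<^sub>R u) v) / norm t
      = norm ((?f t - v) /\<^sub>R t - bracket u v)"
  proof (rule eventually_at_filter[THEN iffD2], rule always_eventually, intro allI impI)
    fix t :: real assume "t \<noteq> 0"
    then have "(?f t - v) /\<^sub>R t - bracket u v = (1 / t) *\<^sub>R (?f (0 + t) - ?f 0 - bracket (t *\<^sub>R u) v)"
      using linear_scale[OF linear_bracket_left, of t u v]
      by (simp add: psi_e0 Ad_one algebra_simps divide_inverse)
    then show "norm (?f (0 + t) - ?f 0 - bracket (t *\<^sub>R u) v) / norm t = norm ((?f t - v) /\<^sub>R t - bracket u v)"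
      by (simp add: divide_inverse mult.commute)
  qed
  ultimately have "((\<lambda>t. norm ((?f t - v) /\<^sub>R t - bracket u v)) \<longlongrightarrow> 0) (at 0)"
    by (rule Lim_transform_eventually)
  then have lim: "((\<lambda>t. (?f t - v) /\<^sub>R t) \<longlongrightarrow> bracket u v) (at 0)"
    by (rule LIM_zero_cancel[OF tendsto_norm_zero_cancel])
  have "((\<lambda>t. e0 + t *\<^sub>R u) \<longlongrightarrow> e0 + 0 *\<^sub>R u) (at 0)" by (intro tendsto_intros)
  then have "filterlim (\<lambda>t. e0 + t *\<^sub>R u) (nhds e0) (at 0)" by simp
  then have "\<forall>\<^sub>F t in at 0. \<psi> (e0 + t *\<^sub>R u) \<in> V"
    using eventually_psi_V eventually_compose_filterlim by (fastforce elim: eventually_mono)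
  then have "\<forall>\<^sub>F t in at 0. (Ad (\<psi> (e0 + t *\<^sub>R u)) v - v) /\<^sub>R t \<in> ?S"
    by eventually_elim (intro span_scale span_base, blast)
  then show ?thesis by (rule Lim_in_closed_set[OF closed_span _ _ lim]) simp
qed

text \<open>Choose a basis consisting of vectors \<open>\<beta> b = Ad (a b) (w b) - w b\<close>. The commutator of \<open>a b\<close>
  with the element whose coordinates are \<open>e0 + s *\<^sub>R w b\<close> has the velocity \<open>\<beta> b\<close> at \<open>s = 0\<close>.
  The product of these commutators over all \<open>b\<close>, each with its own parameter, has a
  surjective derivative, so that its values cover a neighbourhood of the identity.\<close>
theorem derived_eq_carrier:
  assumes conn: "connected_space T" and span: "span {bracket u v | u v. True} = UNIV"
  shows "derived H (carrier H) = carrier H"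
proof -
  let ?W = "{Ad a w - w | a w. a \<in> V}"
  have "span {bracket u v | u v. True} \<subseteq> span ?W"
    by (rule span_minimal) (use bracket_in_Ad_span in auto)
  then have spW: "span ?W = UNIV" using span by auto
  obtain B where B: "B \<subseteq> ?W" "independent B" "?W \<subseteq> span B"
    using maximal_independent_subset[of ?W] by blast
  have spB: "span B = UNIV" using B(3) spW span_minimal[OF B(3)] by auto
  have finB: "finite B" using B(2) independent_imp_finite by blast
  have "card B = DIM('e)" using dim_eq_card[OF _ B(2), of UNIV] spB by simp
  then obtain \<beta> where \<beta>: "bij_betw \<beta> (Basis :: 'e set) B"
    using finite_same_card_bij[OF finite_Basis finB] by metis
  have "\<forall>b\<in>Basis. \<exists>a w. a \<in> V \<and> \<beta> b = Ad a w - w" using \<beta> B(1) by (fastforce simp: bij_betw_def)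
  then obtain a w where aw: "\<And>b. b \<in> Basis \<Longrightarrow> a b \<in> V \<and> \<beta> b = Ad (a b) (w b) - w b" by metis
  define C where "C b t = a b \<otimes> \<psi> (e0 + (t \<bullet> b) *\<^sub>R w b) \<otimes> inv (a b) \<otimes> inv (\<psi> (e0 + (t \<bullet> b) *\<^sub>R w b))" for b t :: 'e
  have C: "germ (C b) 0 (\<lambda>t. (t \<bullet> b) *\<^sub>R \<beta> b)" if b: "b \<in> Basis" for b
  proof -
    have aV: "a b \<in> V" using aw b by blast
    then have aH: "a b \<in> carrier H" using V_subset by blast
    have g1: "germ (\<lambda>x. a b \<otimes> \<psi> x \<otimes> inv (a b)) e0 (Ad (a b))"
      unfolding germ_def
    proof (intro conjI exI)
      show "((\<lambda>t. \<kappa> (a b \<otimes> \<psi> t \<otimes> inv (a b))) has_derivative Ad (a b)) (at e0)"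
        using Ad_derivative[OF aV] by (simp add: conj_coord_def)
      show "continuous_map (top_of_set D) T (\<lambda>t. a b \<otimes> \<psi> t \<otimes> inv (a b))"
        by (intro continuous_map_mult continuous_map_constant continuous_psi aH inv_closed)
    qed (use psi_e0 aH chart(2) e0_in_D in auto)
    have k: "((\<lambda>t. e0 + (t \<bullet> b) *\<^sub>R w b) has_derivative (\<lambda>t. (t \<bullet> b) *\<^sub>R w b)) (at 0)"
      by (auto intro!: derivative_eq_intros)
    have kc: "continuous_on UNIV (\<lambda>t. e0 + (t \<bullet> b) *\<^sub>R w b)" by (intro continuous_intros)
    from germ_mult[OF germ_compose[OF g1 k kc] germ_compose[OF germ_inv[OF germ_psi] k kc]]
    have "germ (C b) 0 (\<lambda>t. Ad (a b) ((t \<bullet> b) *\<^sub>R w b) + - ((t \<bullet> b) *\<^sub>R w b))"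
      by (simp add: C_def[abs_def])
    moreover have "(\<lambda>t. Ad (a b) ((t \<bullet> b) *\<^sub>R w b) + - ((t \<bullet> b) *\<^sub>R w b)) = (\<lambda>t. (t \<bullet> b) *\<^sub>R \<beta> b)"
      using aw[OF b] linear_scale[OF linear_Ad[OF aV]] by (auto simp: scaleR_diff_right)
    ultimately show ?thesis by simp
  qed
  obtain bs where bs: "set bs = (Basis :: 'e set)" "distinct bs" using finite_distinct_list[OF finite_Basis] by blast
  define F where "F ys t = foldr (\<lambda>b x. C b t \<otimes> x) ys \<one>" for ys and t :: 'e
  have F: "germ (F ys) 0 (\<lambda>t. \<Sum>b\<leftarrow>ys. (t \<bullet> b) *\<^sub>R \<beta> b)" if "set ys \<subseteq> Basis" for ys
    using that
  proof (induction ys)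
    case Nil
    then show ?case using germ_one by (simp add: F_def)
  next
    case (Cons b ys)
    then have "germ (\<lambda>t. C b t \<otimes> F ys t) 0 (\<lambda>t. (t \<bullet> b) *\<^sub>R \<beta> b + (\<Sum>b\<leftarrow>ys. (t \<bullet> b) *\<^sub>R \<beta> b))"
      by (intro germ_mult C) auto
    then show ?case by (simp add: F_def)
  qed
  define L where "L t = (\<Sum>b\<in>Basis. (t \<bullet> b) *\<^sub>R \<beta> b)" for t :: 'e
  have "germ (F bs) 0 L"
    using F[of bs] bs by (simp add: L_def[abs_def] sum_list_distinct_conv_sum_set)
  then obtain S where S: "open S" "0 \<in> S" "continuous_map (top_of_set S) T (F bs)" "\<And>t. t \<in> S \<Longrightarrow> F bs t \<in> U"
    "continuous_on S (\<lambda>t. \<kappa> (F bs t))" using germ_continuous_kappa by metis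
  have linL: "linear L" unfolding L_def[abs_def] by (intro linear_compose_sum ballI linearI) (auto simp: inner_add_left scaleR_add_left)
  have "surj L"
  proof -
    have "B \<subseteq> range L"
    proof
      fix x assume "x \<in> B"
      then obtain b where b: "b \<in> Basis" "x = \<beta> b" using \<beta> by (auto simp: bij_betw_def)
      have "L b = (\<Sum>b'\<in>Basis. if b' = b then \<beta> b else 0)" unfolding L_def
        by (rule sum.cong) (auto simp: inner_Basis b)
      also have "\<dots> = x" using b by simp
      finally show "x \<in> range L" by (metis rangeI)
    qed
    then have "span B \<subseteq> range L" by (rule span_minimal) (rule linear_subspace_image[OF linL subspace_UNIV])
    then show ?thesis using spB by auto
  qed
  then obtain R where R: "linear R" "L \<circ> R = id" using linear_surjective_right_inverse[OF linL] by blast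
  have bR: "bounded_linear R" using R(1) linear_conv_bounded_linear by blast
  \<comment> \<open>On \<open>S'\<close> all points \<open>e0 + (t \<bullet> b) *\<^sub>R w b\<close> are coordinates of group elements, so that the
    \<open>C b t\<close> are commutators.\<close>
  define S' where "S' = S \<inter> (\<Inter>b\<in>Basis. (\<lambda>t. e0 + (t \<bullet> b) *\<^sub>R w b) -` D)"
  have "open ((\<lambda>t. e0 + (t \<bullet> b) *\<^sub>R w b) -` D)" for b
    by (rule open_vimage[OF chart(2)]) (intro continuous_intros)
  then have "open S'" unfolding S'_def using S(1) by (intro open_Int open_INT) auto
  have "0 \<in> S'" using S(2) e0_in_D by (simp add: S'_def)
  then have S': "S' \<subseteq> S" "0 \<in> interior S'"
    using interior_open[OF \<open>open S'\<close>] by (auto simp: S'_def)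
  have "((\<lambda>t. \<kappa> (F bs t)) has_derivative L) (at 0)"
    using \<open>germ (F bs) 0 L\<close> by (simp add: germ_def)
  from sussmann_open_mapping[OF S(1,5,2) this bR R(2) S']
  have "\<kappa> (F bs 0) \<in> interior ((\<lambda>t. \<kappa> (F bs t)) ` S')" .
  moreover have "\<kappa> (F bs 0) = e0" using \<open>germ (F bs) 0 L\<close> by (simp add: germ_def)
  ultimately obtain Q where Q: "open Q" "e0 \<in> Q" "Q \<subseteq> (\<lambda>t. \<kappa> (F bs t)) ` S'"
    unfolding interior_def by auto
  define N where "N = {x \<in> U. \<kappa> x \<in> Q}"
  have "openin (subtopology T U) N"
    using openin_continuous_map_preimage[OF continuous_kappa, of Q] U_subset Q(1)
    by (simp add: N_def topspace_eq Int_absorb1)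
  then have "openin T N" using chart(1) openin_trans_full by blast
  then have N: "N \<in> nbhds_one" using c_one Q(2) by (simp add: nbhds_one_def N_def)
  have sub: "subgroup (derived H (carrier H)) H" by (rule derived_is_subgroup) simp
  have "N \<subseteq> derived H (carrier H)"
  proof
    fix x assume x: "x \<in> N"
    then obtain t where t: "t \<in> S'" "\<kappa> x = \<kappa> (F bs t)" using Q(3) by (auto simp: N_def)
    then have "x = F bs t" using S(4)[of t] S'(1) x inj_chart by (auto simp: N_def inj_on_def)
    moreover have "F ys t \<in> derived H (carrier H)" if "set ys \<subseteq> Basis" for ys
      using that
    proof (induction ys)
      case Nil
      then show ?case using subgroup.one_closed[OF sub] by (simp add: F_def)
    next
      case (Cons b ys)
      have "e0 + (t \<bullet> b) *\<^sub>R w b \<in> D" using t(1) Cons.prems by (auto simp: S'_def)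
      then have "\<psi> (e0 + (t \<bullet> b) *\<^sub>R w b) \<in> carrier H" by (rule psi_in_H)
      moreover have "a b \<in> carrier H" using aw[of b] Cons.prems V_subset by auto
      ultimately have "C b t \<in> derived_set H (carrier H)" unfolding C_def by blast
      then have "C b t \<in> derived H (carrier H)" unfolding derived_def by (rule generate.incl)
      then show ?case using Cons subgroup.m_closed[OF sub] by (simp add: F_def)
    qed
    ultimately show "x \<in> derived H (carrier H)" using bs(1) by simp
  qed
  then show ?thesis by (rule nbhds_one_generate[OF conn N sub])
qed

end

section \<open>Spectral decomposition of complex matrices\<close>

definition sq_poly :: "'a::field poly \<Rightarrow> ('a, 'n::finite) sqmat \<Rightarrow> ('a, 'n) sqmat" where
  "sq_poly q A = (\<Sum>i\<le>Polynomial.degree q. sq_scale (poly.coeff q i) (A ^ i))"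

lemma sq_poly_bound: "Polynomial.degree q \<le> n \<Longrightarrow> sq_poly q A = (\<Sum>i\<le>n. sq_scale (poly.coeff q i) (A ^ i))"
  unfolding sq_poly_def by (rule sum.mono_neutral_left) (auto simp: coeff_eq_0)

lemma sq_poly_add: "sq_poly (q + r) A = sq_poly q A + sq_poly r A"
proof -
  let ?n = "max (Polynomial.degree q) (Polynomial.degree r)"
  have "Polynomial.degree (q + r) \<le> ?n" by (rule degree_add_le_max)
  then show ?thesis
    using sq_poly_bound[of q ?n A] sq_poly_bound[of r ?n A] sq_poly_bound[of "q + r" ?n A]
    by (simp add: sq.scale_left_distrib sum.distrib)
qed

lemma sq_poly_smult: "sq_poly (Polynomial.smult c q) A = sq_scale c (sq_poly q A)"
  using sq_poly_bound[of "Polynomial.smult c q" "Polynomial.degree q" A] degree_smult_le[of c q]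
  by (simp add: sq_poly_def sq.scale_sum_right)

lemma sq_poly_pCons: "sq_poly (pCons c q) A = sq_scale c 1 + A * sq_poly q A"
proof -
  have "sq_poly (pCons c q) A = (\<Sum>i\<le>Suc (Polynomial.degree q). sq_scale (poly.coeff (pCons c q) i) (A ^ i))"
    by (rule sq_poly_bound) (rule degree_pCons_le)
  also have "\<dots> = sq_scale c 1 + (\<Sum>i\<le>Polynomial.degree q. sq_scale (poly.coeff q i) (A ^ Suc i))"
    by (subst sum.atMost_Suc_shift) simp
  finally show ?thesis by (simp add: sq_poly_def sum_distrib_left)
qed

lemma sq_poly_0 [simp]: "sq_poly 0 A = 0" and sq_poly_1 [simp]: "sq_poly 1 A = 1"
  by (simp_all add: sq_poly_def)

lemma sq_poly_linear_mult: "sq_poly ([:- a, 1:] * q) A = (A - sq_scale a 1) * sq_poly q A"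
proof -
  have "[:- a, 1:] * q = pCons 0 q + Polynomial.smult (- a) q" by simp
  then show ?thesis
    by (simp only: sq_poly_add sq_poly_smult sq_poly_pCons) (simp add: left_diff_distrib)
qed

text \<open>The relation \<open>A\<^sup>a = A\<^bsup>a + 1\<^esup> w\<close> with \<open>w\<close> a polynomial in \<open>A\<close> says that a nonzero polynomial
  annihilates \<open>A\<close>, and over the complex numbers it splits into linear factors.\<close>
lemma sq_annihilated_by_linear_factors:
  fixes A :: "(complex, 'n::finite) sqmat"
  shows "\<exists>ls. (\<Prod>a\<leftarrow>ls. A - sq_scale a 1) = 0"
proof -
  obtain a w where aw: "A ^ a = A ^ Suc a * w" "w \<in> sq.span (range ((^) A))"
    using sq_power_eventually_divisible[of A] by blast
  have pow: "sq_poly (Polynomial.monom 1 k * q) A = A ^ k * sq_poly q A" for k q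
    by (induction k) (simp_all add: monom_Suc sq_poly_pCons mult.assoc del: mult_monom)
  from aw(2) have "\<exists>r. w = sq_poly r A"
  proof (induction rule: sq.span_induct_alt)
    case base
    show ?case by (rule exI[of _ 0]) simp
  next
    case (step c x y)
    then obtain k r where "x = A ^ k" "y = sq_poly r A" by blast
    then have "sq_scale c x + y = sq_poly (Polynomial.smult c (Polynomial.monom 1 k) + r) A"
      using pow[of k 1] by (simp add: sq_poly_add sq_poly_smult)
    then show ?case by blast
  qed
  then obtain r where r: "w = sq_poly r A" by blast
  define q where "q = Polynomial.monom 1 a * (1 - pCons 0 r)"
  have "1 - pCons 0 r \<noteq> 0"
  proof
    assume "1 - pCons 0 r = 0"
    then have "poly.coeff (1 - pCons 0 r) 0 = 0" by simp
    then show False by simp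
  qed
  then have q0: "q \<noteq> 0" by (simp add: q_def monom_eq_0_iff)
  have "sq_poly (1 - pCons 0 r) A = 1 - A * w"
  proof -
    have "1 - pCons 0 r = 1 + Polynomial.smult (- 1) (pCons 0 r)" by simp
    then show ?thesis by (simp only: sq_poly_add sq_poly_smult sq_poly_pCons sq_poly_1 r) simp
  qed
  then have "sq_poly q A = A ^ a - A ^ Suc a * w"
    unfolding q_def pow by (simp add: right_diff_distrib mult.assoc[symmetric] power_commutes)
  also have "\<dots> = 0" using aw(1) by (rule right_minus_eq[THEN iffD2])
  finally have 0: "sq_poly q A = 0" .
  obtain M where "q = Polynomial.smult (Polynomial.lead_coeff q) (\<Prod>a\<in>#M. [:- a, 1:])"
    using alg_closed_imp_factorization[OF q0] by blast
  moreover obtain ls where "M = mset ls" by (metis ex_mset)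
  ultimately have ls: "Polynomial.smult (Polynomial.lead_coeff q) (\<Prod>a\<leftarrow>ls. [:- a, 1:]) = q"
    by (simp flip: prod_mset_prod_list)
  have prod: "sq_poly (\<Prod>a\<leftarrow>ls. [:- a, 1:]) A = (\<Prod>a\<leftarrow>ls. A - sq_scale a 1)" for ls
    by (induction ls) (simp_all add: sq_poly_linear_mult del: mult_pCons_left)
  have "sq_scale (Polynomial.lead_coeff q) (\<Prod>a\<leftarrow>ls. A - sq_scale a 1) = 0"
    using 0 unfolding prod[symmetric] sq_poly_smult[symmetric] ls .
  then show ?thesis using q0 by auto
qed

text \<open>On the kernel of \<open>x\<close> the matrix \<open>x + c\<close> acts as the scalar \<open>c\<close>, which is not nilpotent.\<close>
lemma coprime_nilpotents_zero:
  fixes x v :: "('a::field, 'n::finite) sqmat"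
  assumes "c \<noteq> 0" and "x ^ i * v = 0" and "(x + sq_scale c 1) ^ j * v = 0"
  shows "v = 0"
  using assms(2,3)
proof (induction i arbitrary: v)
  case 0
  then show ?case by simp
next
  case (Suc i)
  have comm: "(x + sq_scale c 1) * x = x * (x + sq_scale c 1)" by (simp add: algebra_simps)
  have "x ^ i * (x * v) = 0" using Suc.prems(1) by (simp add: mult.assoc[symmetric] power_commutes)
  moreover have "(x + sq_scale c 1) ^ j * (x * v) = x * ((x + sq_scale c 1) ^ j * v)"
    by (simp add: mult.assoc[symmetric] power_commuting_commutes[OF comm])
  then have "(x + sq_scale c 1) ^ j * (x * v) = 0" using Suc.prems(2) by simp
  ultimately have xv: "x * v = 0" by (rule Suc.IH)
  have "(x + sq_scale c 1) ^ k * v = sq_scale (c ^ k) v" for k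
  proof (induction k)
    case (Suc k)
    have "(x + sq_scale c 1) ^ Suc k * v = (x + sq_scale c 1) * sq_scale (c ^ k) v"
      using Suc by (simp add: mult.assoc)
    also have "\<dots> = sq_scale (c ^ Suc k) v" using xv by (simp add: distrib_right)
    finally show ?case .
  qed simp
  then have "sq_scale (c ^ j) v = 0" using Suc.prems(2) by simp
  then show ?case using assms(1) by simp
qed

text \<open>The projection onto the part on which \<open>y\<close> is nilpotent, along the part on which \<open>y\<close> is
  invertible.\<close>
lemma fitting_idempotent:
  fixes y :: "('a::field, 'n::finite) sqmat"
  obtains e w' k where "e * e = e" "y ^ k * e = 0" "1 - e = w' * y" "\<And>z. y * z = z * y \<Longrightarrow> e * z = z * e"
proof -
  obtain a w where aw: "a > 0" "w \<in> sq.span (range ((^) y))"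
    "(y ^ a * w ^ a) * (y ^ a * w ^ a) = y ^ a * w ^ a" "(y ^ a * w ^ a) * y ^ a = y ^ a"
    using sq_power_idempotent[of y] by blast
  let ?f = "y ^ a * w ^ a"
  have comm: "?f * z = z * ?f" if z: "y * z = z * y" for z
  proof -
    have "y ^ a * z = z * y ^ a" by (rule power_commuting_commutes[OF z])
    moreover have "w ^ a * z = z * w ^ a" by (rule power_commuting_commutes[OF sq_span_powers_commute[OF aw(2) z]])
    ultimately show ?thesis by (metis mult.assoc)
  qed
  have fy: "?f * y ^ a = y ^ a * ?f" by (rule comm) (simp add: power_commutes)
  obtain b where b: "a = Suc b" using aw(1) gr0_implies_Suc by blast
  have wy: "w ^ a * y = y * w ^ a" by (rule power_commuting_commutes[OF sq_span_powers_commute[OF aw(2)]]) simp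
  have "?f = (y ^ b * w ^ a) * y" by (simp add: b mult.assoc wy[unfolded b] power_commutes[symmetric] del: power_Suc) (simp add: mult.assoc[symmetric] power_commutes)
  then show ?thesis
    using aw(3) aw(4) fy comm
    by (intro that[of "1 - ?f" a "y ^ b * w ^ a"]) (simp_all add: algebra_simps)
qed

text \<open>The projections onto the generalised eigenspaces. Let \<open>g\<close> be one minus their sum. Then \<open>A -
  l\<close> has a left inverse on the image of \<open>g\<close> for every \<open>l \<in> \<Lambda>\<close>. But some product of these
  factors is zero, so \<open>g = 0\<close>.\<close>
lemma spectral_idempotents:
  fixes A :: "(complex, 'n::finite) sqmat"
  obtains \<Lambda> e K where "finite \<Lambda>" "\<And>l. e l * e l = e l" "\<And>l. A * e l = e l * A"
    "\<And>l. l \<in> \<Lambda> \<Longrightarrow> (A - sq_scale l 1) ^ K * e l = 0"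
    "\<And>l m. l \<noteq> m \<Longrightarrow> e l * e m = 0" "(\<Sum>l\<in>\<Lambda>. e l) = 1"
proof -
  obtain ls where ls: "(\<Prod>a\<leftarrow>ls. A - sq_scale a 1) = 0" using sq_annihilated_by_linear_factors by blast
  let ?y = "\<lambda>l. A - sq_scale l 1"
  have "\<forall>l. \<exists>e w' k. e * e = e \<and> ?y l ^ k * e = 0 \<and> 1 - e = w' * ?y l \<and> (\<forall>z. ?y l * z = z * ?y l \<longrightarrow> e * z = z * e)"
  proof
    fix l
    show "\<exists>e w' k. e * e = e \<and> ?y l ^ k * e = 0 \<and> 1 - e = w' * ?y l \<and> (\<forall>z. ?y l * z = z * ?y l \<longrightarrow> e * z = z * e)"
      by (rule fitting_idempotent[of "?y l"]) blast
  qed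
  then obtain e w' k where e: "\<And>l. e l * e l = e l" "\<And>l. ?y l ^ k l * e l = 0" "\<And>l. 1 - e l = w' l * ?y l"
    "\<And>l z. ?y l * z = z * ?y l \<Longrightarrow> e l * z = z * e l" by metis
  have eA: "e l * z = z * e l" if "A * z = z * A" for l z
    by (rule e(4)) (simp add: that left_diff_distrib right_diff_distrib)
  have comm: "A * e l = e l * A" for l using eA[of A l] by simp
  have orth: "e l * e m = 0" if "l \<noteq> m" for l m
  proof (rule coprime_nilpotents_zero[of "l - m"])
    show "l - m \<noteq> 0" using that by simp
    have "?y l ^ k l * (e l * e m) = ?y l ^ k l * e l * e m" by (simp add: mult.assoc)
    then show "?y l ^ k l * (e l * e m) = 0" by (simp add: e(2))
    have eq: "?y l + sq_scale (l - m) 1 = ?y m" by (simp add: sq.scale_left_diff_distrib)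
    have "?y m ^ k m * (e l * e m) = ?y m ^ k m * e m * e l"
      using eA[OF comm, of m l] by (simp add: mult.assoc)
    then show "(?y l + sq_scale (l - m) 1) ^ k m * (e l * e m) = 0" unfolding eq by (simp add: e(2))
  qed
  define \<Lambda> where "\<Lambda> = set ls"
  define g where "g = 1 - (\<Sum>l\<in>\<Lambda>. e l)"
  have eg: "e l * g = 0" if "l \<in> \<Lambda>" for l
  proof -
    have "e l * (\<Sum>m\<in>\<Lambda>. e m) = (\<Sum>m\<in>\<Lambda>. if m = l then e l else 0)"
      unfolding sum_distrib_left by (rule sum.cong) (auto simp: orth e(1))
    also have "\<dots> = e l" using that by (simp add: \<Lambda>_def)
    finally show ?thesis by (simp add: g_def right_diff_distrib)
  qed
  have Ag: "A * g = g * A" by (simp add: g_def left_diff_distrib right_diff_distrib sum_distrib_left sum_distrib_right comm)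
  have "g = 0" if "(\<Prod>a\<leftarrow>l. ?y a) * g = 0" "set l \<subseteq> \<Lambda>" for l
    using that
  proof (induction l)
    case (Cons a l)
    let ?h = "(\<Prod>a\<leftarrow>l. ?y a) * g"
    have "(\<Prod>a\<leftarrow>l. ?y a) * A = A * (\<Prod>a\<leftarrow>l. ?y a)"
    proof (induction l)
      case (Cons b l)
      have "?y b * (A * r) = A * (?y b * r)" for r
        by (simp add: left_diff_distrib right_diff_distrib mult.assoc)
      then show ?case using Cons by (simp add: mult.assoc)
    qed simp
    then have "e a * (\<Prod>a\<leftarrow>l. ?y a) = (\<Prod>a\<leftarrow>l. ?y a) * e a" by (intro eA) simp
    then have "e a * ?h = (\<Prod>a\<leftarrow>l. ?y a) * (e a * g)" by (simp only: mult.assoc[symmetric])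
    also have "\<dots> = 0" using eg[of a] Cons.prems(2) by simp
    finally have "e a * ?h = 0" .
    moreover have "(1 - e a) * ?h = 0"
      using Cons.prems(1) by (simp add: e(3) mult.assoc)
    ultimately have "?h = 0" by (simp add: left_diff_distrib)
    then show ?case using Cons by simp
  qed simp
  from this[of ls] have "g = 0" using ls by (simp add: \<Lambda>_def)
  then have sum1: "(\<Sum>l\<in>\<Lambda>. e l) = 1" by (simp add: g_def)
  define K where "K = (\<Sum>l\<in>\<Lambda>. k l)"
  have "(A - sq_scale l 1) ^ K * e l = 0" if "l \<in> \<Lambda>" for l
  proof -
    have "k l \<le> K" unfolding K_def by (rule member_le_sum) (use that in \<open>auto simp: \<Lambda>_def\<close>)
    then have "?y l ^ K = ?y l ^ (K - k l) * ?y l ^ k l" by (simp add: power_add[symmetric])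
    then show ?thesis by (simp add: mult.assoc e(2))
  qed
  then show ?thesis using that[of \<Lambda> e K] e(1) comm orth sum1 by (simp add: \<Lambda>_def)
qed

text \<open>Every term in the expansion of the \<open>n\<close>-th iterate contains at least \<open>i\<close> factors \<open>x\<close> on the
  left or at least \<open>j\<close> factors \<open>y\<close> on the right.\<close>
lemma intertwiner_nilpotent:
  fixes x y C :: "('a::field, 'n::finite) sqmat"
  assumes "x ^ i * C = 0" "C * y ^ j = 0" "i + j \<le> n"
  shows "((\<lambda>C. x * C - C * y) ^^ n) C = 0"
  using assms
proof (induction n arbitrary: i j C)
  case 0
  then show ?case by simp
next
  case (Suc n)
  let ?M = "\<lambda>C. x * C - C * y"
  have diff: "(?M ^^ k) (C - C') = (?M ^^ k) C - (?M ^^ k) C'" for k C C'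
    by (induction k) (simp_all, simp add: algebra_simps)
  have zero: "(?M ^^ k) 0 = 0" for k by (induction k) simp_all
  show ?case
  proof (cases "i = 0 \<or> j = 0")
    case True
    then have "C = 0" using Suc.prems by auto
    then show ?thesis using zero by blast
  next
    case False
    then obtain i' j' where ij: "i = Suc i'" "j = Suc j'" by (metis not0_implies_Suc)
    have "(?M ^^ n) (x * C) = 0"
    proof (rule Suc.IH)
      show "x ^ i' * (x * C) = 0" using Suc.prems(1) by (simp add: ij mult.assoc[symmetric] power_commutes)
      show "x * C * y ^ j = 0" using Suc.prems(2) by (simp add: mult.assoc)
    qed (use Suc.prems ij in simp)
    moreover have "(?M ^^ n) (C * y) = 0"
    proof (rule Suc.IH)
      show "x ^ i * (C * y) = 0" using Suc.prems(1) by (simp add: mult.assoc[symmetric])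
      show "C * y * y ^ j' = 0" using Suc.prems(2) by (simp add: ij mult.assoc)
    qed (use Suc.prems ij in simp)
    ultimately show ?thesis by (simp add: diff funpow_Suc_right del: funpow.simps)
  qed
qed

text \<open>The operator \<open>(L - \<beta>)\<^sup>n\<close> removes the component at \<open>\<beta>\<close> from the sum, and on the other
  components \<open>L - \<beta>\<close> is invertible by polynomials in \<open>L\<close>, which preserve \<open>Z\<close>.\<close>
lemma generalised_components:
  fixes L :: "('a::field, 'n::finite) sqmat \<Rightarrow> ('a, 'n) sqmat"
  assumes L: "\<And>x y. L (x + y) = L x + L y" "\<And>c x. L (sq_scale c x) = sq_scale c (L x)"
    and Z: "sq.subspace Z" "\<And>x. x \<in> Z \<Longrightarrow> L x \<in> Z"
    and "finite F"
    and "\<And>\<alpha>. \<alpha> \<in> F \<Longrightarrow> ((\<lambda>x. L x - sq_scale \<alpha> x) ^^ n) (B \<alpha>) = 0"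
    and "(\<Sum>\<alpha>\<in>F. B \<alpha>) \<in> Z" and "\<alpha> \<in> F"
  shows "B \<alpha> \<in> Z"
proof -
  define S where "S \<beta> x = L x - sq_scale \<beta> x" for \<beta> x
  have L_diff: "L (x - y) = L x - L y" for x y using L(1)[of "x - y" y] by simp
  have L_zero: "L 0 = 0" using L_diff[of 0 0] by simp
  have S_add: "(S \<beta> ^^ k) (x + y) = (S \<beta> ^^ k) x + (S \<beta> ^^ k) y" for \<beta> k x y
    by (induction k) (simp_all add: S_def L algebra_simps)
  have S_zero: "(S \<beta> ^^ k) 0 = 0" for \<beta> k by (induction k) (simp_all add: S_def L_zero)
  have S_sum: "(S \<beta> ^^ k) (sum f I) = (\<Sum>i\<in>I. (S \<beta> ^^ k) (f i))" for \<beta> k and f :: "'a \<Rightarrow> _" and I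
    by (induction I rule: infinite_finite_induct) (simp_all add: S_zero S_add)
  have S_comm1: "S \<alpha> (S \<beta> x) = S \<beta> (S \<alpha> x)" for \<alpha> \<beta> x
    by (simp add: S_def L_diff L(2) sq.scale_right_diff_distrib mult.commute)
  have S_comm: "(S \<alpha> ^^ k) ((S \<beta> ^^ j) x) = (S \<beta> ^^ j) ((S \<alpha> ^^ k) x)" for \<alpha> \<beta> k j x
  proof -
    have 1: "S \<alpha> ((S \<beta> ^^ j) x) = (S \<beta> ^^ j) (S \<alpha> x)" for x
    proof (induction j)
      case (Suc j)
      have "S \<alpha> (S \<beta> ((S \<beta> ^^ j) x)) = S \<beta> (S \<alpha> ((S \<beta> ^^ j) x))" by (rule S_comm1)
      then show ?case using Suc by simp
    qed simp
    show ?thesis by (induction k) (simp_all add: 1)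
  qed
  have Z_S: "(S \<beta> ^^ k) x \<in> Z" if "x \<in> Z" for \<beta> k x
    using that by (induction k) (auto simp: S_def intro: sq.subspace_diff sq.subspace_scale Z)
  have single: "x \<in> Z" if "\<alpha> \<noteq> \<beta>" "(S \<alpha> ^^ k) x = 0" "S \<beta> x \<in> Z" for \<alpha> \<beta> k x
    using that(2,3)
  proof (induction k arbitrary: x)
    case 0
    then show ?case using sq.subspace_0[OF Z(1)] by simp
  next
    case (Suc k)
    have "S \<alpha> x \<in> Z"
    proof (rule Suc.IH)
      show "(S \<alpha> ^^ k) (S \<alpha> x) = 0" using Suc.prems(1) by (simp add: funpow_swap1)
      show "S \<beta> (S \<alpha> x) \<in> Z" using Z_S[OF Suc.prems(2), of 1 \<alpha>] by (simp add: S_comm1)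
    qed
    then have "S \<beta> x - S \<alpha> x \<in> Z" using Suc.prems(2) sq.subspace_diff[OF Z(1)] by blast
    also have "S \<beta> x - S \<alpha> x = sq_scale (\<alpha> - \<beta>) x" by (simp add: S_def sq.scale_left_diff_distrib)
    finally have "sq_scale (inverse (\<alpha> - \<beta>)) (sq_scale (\<alpha> - \<beta>) x) \<in> Z" by (rule sq.subspace_scale[OF Z(1)])
    then show ?case using that(1) by simp
  qed
  have many: "x \<in> Z" if "\<alpha> \<noteq> \<beta>" "(S \<alpha> ^^ k) x = 0" "(S \<beta> ^^ j) x \<in> Z" for \<alpha> \<beta> k j x
    using that(2,3)
  proof (induction j arbitrary: x)
    case (Suc j)
    have "S \<beta> x \<in> Z"
    proof (rule Suc.IH)
      show "(S \<alpha> ^^ k) (S \<beta> x) = 0" using S_comm[of k \<alpha> 1 \<beta> x] Suc.prems(1) S_zero[of 1 \<beta>] by simp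
      show "(S \<beta> ^^ j) (S \<beta> x) \<in> Z" using Suc.prems(2) by (simp add: funpow_swap1)
    qed
    then show ?case using single[OF that(1) Suc.prems(1)] by blast
  qed simp
  have "\<forall>\<alpha>\<in>F. (S \<alpha> ^^ n) (B \<alpha>) = 0" using assms(6) by (simp add: S_def[abs_def])
  with \<open>finite F\<close> show ?thesis using assms(7,8)
  proof (induction F arbitrary: B \<alpha> rule: finite_induct)
    case (insert \<beta> F)
    have 0: "(S \<beta> ^^ n) (B \<beta>) = 0" using insert.prems(1) by blast
    have "(S \<beta> ^^ n) (\<Sum>\<alpha>\<in>insert \<beta> F. B \<alpha>) \<in> Z" by (rule Z_S) (rule insert.prems(2))
    then have sumZ: "(\<Sum>\<alpha>\<in>F. (S \<beta> ^^ n) (B \<alpha>)) \<in> Z" using insert.hyps by (simp add: S_add S_sum 0)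
    have comp: "B \<gamma> \<in> Z" if \<gamma>: "\<gamma> \<in> F" for \<gamma>
    proof (rule many[of \<gamma> \<beta> n])
      show "\<gamma> \<noteq> \<beta>" using \<gamma> insert.hyps by blast
      show "(S \<gamma> ^^ n) (B \<gamma>) = 0" using insert.prems(1) \<gamma> by blast
      show "(S \<beta> ^^ n) (B \<gamma>) \<in> Z"
      proof (rule insert.IH[OF _ sumZ \<gamma>], intro ballI)
        fix \<delta> assume "\<delta> \<in> F"
        then have "(S \<delta> ^^ n) (B \<delta>) = 0" using insert.prems(1) by blast
        then show "(S \<delta> ^^ n) ((S \<beta> ^^ n) (B \<delta>)) = 0"
          using S_comm[of n \<delta> n \<beta> "B \<delta>"] S_zero[of n \<beta>] by simp
      qed
    qed
    then have "(\<Sum>\<alpha>\<in>F. B \<alpha>) \<in> Z" by (rule sq.subspace_sum[OF Z(1)])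
    then have "(\<Sum>\<alpha>\<in>insert \<beta> F. B \<alpha>) - (\<Sum>\<alpha>\<in>F. B \<alpha>) \<in> Z"
      using insert.prems(2) sq.subspace_diff[OF Z(1)] by blast
    then have "B \<beta> \<in> Z" using insert.hyps by simp
    then show ?case using comp insert.prems(3) by blast
  qed simp
qed

text \<open>The matrix \<open>D\<close> has the generalised eigenspaces of \<open>A\<close> as eigenspaces, with complex conjugate
  eigenvalues. On the generalised eigenspace of \<open>ad A\<close> for \<open>\<alpha>\<close>, commutation with \<open>D\<close> is
  multiplication by \<open>cnj \<alpha>\<close>. Therefore \<open>[b, D]\<close> is a combination of the components of \<open>b\<close> in
  these spaces, and they lie in every subspace that contains \<open>b\<close> and is invariant under \<open>ad
  A\<close>, such as the one defined by the vanishing of the traces. For the second part, the trace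
  of \<open>A D\<close> is the sum of the squared absolute values of the eigenvalues of \<open>A\<close> with their
  multiplicities.\<close>
theorem cartan_conjugate:
  fixes A :: "(complex, 'n::finite) sqmat"
  shows "\<exists>D. (\<forall>a b. (\<forall>k. sq_trace (a * ((\<lambda>C. A * C - C * A) ^^ k) b) = 0) \<longrightarrow>
      sq_trace ((a * b - b * a) * D) = 0) \<and> (sq_trace (A * D) = 0 \<longrightarrow> (\<exists>k. A ^ k = 0))"
proof -
  obtain \<Lambda> e K where e: "finite \<Lambda>" "\<And>l. e l * e l = e l" "\<And>l. A * e l = e l * A"
    "\<And>l. l \<in> \<Lambda> \<Longrightarrow> (A - sq_scale l 1) ^ K * e l = 0"
    "\<And>l m. l \<noteq> m \<Longrightarrow> e l * e m = 0" "(\<Sum>l\<in>\<Lambda>. e l) = 1"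
    using spectral_idempotents[of A] by metis
  define D where "D = (\<Sum>l\<in>\<Lambda>. sq_scale (cnj l) (e l))"
  let ?L = "\<lambda>C. A * C - C * A"
  have 1: "sq_trace ((a * b - b * a) * D) = 0" if tr: "\<And>k. sq_trace (a * (?L ^^ k) b) = 0" for a b
  proof -
    define Z where "Z = {C. \<forall>k. sq_trace (a * (?L ^^ k) C) = 0}"
    have L_add: "?L (x + y) = ?L x + ?L y" and L_scale: "?L (sq_scale c x) = sq_scale c (?L x)" for x y c
      by (simp_all add: algebra_simps sq.scale_right_diff_distrib)
    have Lk_add: "(?L ^^ k) (x + y) = (?L ^^ k) x + (?L ^^ k) y" for k x y
      by (induction k) (simp_all add: algebra_simps)
    have Lk_scale: "(?L ^^ k) (sq_scale c x) = sq_scale c ((?L ^^ k) x)" for k c x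
      by (induction k) (simp_all add: sq.scale_right_diff_distrib)
    have Lk_zero: "(?L ^^ k) 0 = 0" for k by (induction k) simp_all
    have Z: "sq.subspace Z" unfolding sq.subspace_def Z_def
      by (simp add: Lk_add Lk_scale Lk_zero distrib_left)
    have ZL: "?L x \<in> Z" if "x \<in> Z" for x
    proof -
      have "(?L ^^ k) (?L x) = (?L ^^ Suc k) x" for k by (simp only: funpow_Suc_right o_apply)
      then show ?thesis using that unfolding Z_def mem_Collect_eq by metis
    qed
    have bZ: "b \<in> Z" using tr by (simp add: Z_def)
    define F where "F = (\<lambda>(l, m). l - m) ` (\<Lambda> \<times> \<Lambda>)"
    \<comment> \<open>The component of \<open>b\<close> in the generalised eigenspace of \<open>ad A\<close> for \<open>\<alpha>\<close>.\<close>
    define B where "B \<alpha> = (\<Sum>(l, m)\<in>{(l, m) \<in> \<Lambda> \<times> \<Lambda>. l - m = \<alpha>}. e l * b * e m)" for \<alpha>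
    have finF: "finite F" by (simp add: F_def e(1))
    have group: "(\<Sum>\<alpha>\<in>F. \<Sum>(l, m)\<in>{(l, m) \<in> \<Lambda> \<times> \<Lambda>. l - m = \<alpha>}. h l m) = (\<Sum>l\<in>\<Lambda>. \<Sum>m\<in>\<Lambda>. h l m)"
      for h :: "complex \<Rightarrow> complex \<Rightarrow> (complex, 'n) sqmat"
    proof -
      have "(\<Sum>\<alpha>\<in>F. \<Sum>z\<in>{z \<in> \<Lambda> \<times> \<Lambda>. (\<lambda>(l, m). l - m) z = \<alpha>}. (\<lambda>(l, m). h l m) z) = (\<Sum>z\<in>\<Lambda> \<times> \<Lambda>. (\<lambda>(l, m). h l m) z)"
        unfolding F_def by (rule sum.image_gen[symmetric]) (simp add: e(1))
      then show ?thesis by (simp add: sum.cartesian_product case_prod_unfold mem_Times_iff conj_assoc)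
    qed
    have "(\<Sum>\<alpha>\<in>F. B \<alpha>) = (\<Sum>l\<in>\<Lambda>. e l) * b * (\<Sum>m\<in>\<Lambda>. e m)"
      unfolding B_def group by (simp add: sum_distrib_left sum_distrib_right) (rule sum.swap)
    then have sumB: "(\<Sum>\<alpha>\<in>F. B \<alpha>) = b" by (simp add: e(6))
    have nilB: "((\<lambda>x. ?L x - sq_scale \<alpha> x) ^^ (2 * K)) (B \<alpha>) = 0" for \<alpha>
    proof -
      let ?S = "\<lambda>x. ?L x - sq_scale \<alpha> x"
      have S_add: "(?S ^^ k) (x + y) = (?S ^^ k) x + (?S ^^ k) y" for k x y
        by (induction k) (simp_all add: algebra_simps sq.scale_right_distrib)
      have S_zero: "(?S ^^ k) 0 = 0" for k by (induction k) simp_all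
      have S_sum: "(?S ^^ k) (sum f I) = (\<Sum>i\<in>I. (?S ^^ k) (f i))" for k and f :: "complex \<times> complex \<Rightarrow> _" and I
        by (induction I rule: infinite_finite_induct) (simp_all add: S_zero S_add)
      have "(?S ^^ (2 * K)) (e l * b * e m) = 0" if lm: "l \<in> \<Lambda>" "m \<in> \<Lambda>" "l - m = \<alpha>" for l m
      proof -
        have "?S = (\<lambda>C. (A - sq_scale l 1) * C - C * (A - sq_scale m 1))"
          by (simp add: lm(3)[symmetric] fun_eq_iff algebra_simps sq.scale_left_diff_distrib)
        moreover have "((\<lambda>C. (A - sq_scale l 1) * C - C * (A - sq_scale m 1)) ^^ (2 * K)) (e l * b * e m) = 0"
        proof (rule intertwiner_nilpotent[of _ K _ _ K])
          show "(A - sq_scale l 1) ^ K * (e l * b * e m) = 0"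
            using e(4)[OF lm(1)] by (simp add: mult.assoc[symmetric])
          have "(A - sq_scale m 1) * e m = e m * (A - sq_scale m 1)"
            by (simp add: left_diff_distrib right_diff_distrib e(3))
          then have "(A - sq_scale m 1) ^ K * e m = e m * (A - sq_scale m 1) ^ K"
            by (rule power_commuting_commutes)
          then show "e l * b * e m * (A - sq_scale m 1) ^ K = 0"
            using e(4)[OF lm(2)] by (simp add: mult.assoc)
        qed simp
        ultimately show ?thesis by simp
      qed
      then show ?thesis unfolding B_def S_sum by (intro sum.neutral) auto
    qed
    have BZ: "B \<alpha> \<in> Z" if "\<alpha> \<in> F" for \<alpha>
      by (rule generalised_components[of ?L Z F "2 * K" B])
         (use L_add L_scale Z ZL finF nilB sumB bZ that in auto)
    then have trB: "sq_trace (a * B \<alpha>) = 0" if "\<alpha> \<in> F" for \<alpha>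
      using that unfolding Z_def by (metis (mono_tags, lifting) funpow_0 mem_Collect_eq)
    have De: "D * e l = sq_scale (cnj l) (e l) \<and> e l * D = sq_scale (cnj l) (e l)" if "l \<in> \<Lambda>" for l
    proof -
      have "D * e l = (\<Sum>m\<in>\<Lambda>. if m = l then sq_scale (cnj l) (e l) else 0)"
        unfolding D_def sum_distrib_right by (rule sum.cong) (auto simp: e(2,5))
      moreover have "e l * D = (\<Sum>m\<in>\<Lambda>. if m = l then sq_scale (cnj l) (e l) else 0)"
        unfolding D_def sum_distrib_left by (rule sum.cong) (auto simp: e(2,5))
      ultimately show ?thesis using e(1) that by simp
    qed
    have b_eq: "b = (\<Sum>l\<in>\<Lambda>. \<Sum>m\<in>\<Lambda>. e l * b * e m)" using sumB unfolding B_def group by simp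
    have "b * D - D * b = (\<Sum>l\<in>\<Lambda>. \<Sum>m\<in>\<Lambda>. sq_scale (- cnj (l - m)) (e l * b * e m))"
    proof -
      have "b * D - D * b = (\<Sum>l\<in>\<Lambda>. \<Sum>m\<in>\<Lambda>. e l * b * e m * D - D * (e l * b * e m))"
        by (subst (1 2) b_eq) (simp add: sum_distrib_left sum_distrib_right sum_subtractf)
      also have "\<dots> = (\<Sum>l\<in>\<Lambda>. \<Sum>m\<in>\<Lambda>. sq_scale (- cnj (l - m)) (e l * b * e m))"
      proof (intro sum.cong refl)
        fix l m assume lm: "l \<in> \<Lambda>" "m \<in> \<Lambda>"
        have "e l * b * e m * D = sq_scale (cnj m) (e l * b * e m)"
          using De[OF lm(2)] by (simp add: mult.assoc)
        moreover have "D * (e l * b * e m) = sq_scale (cnj l) (e l * b * e m)"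
          using De[OF lm(1)] by (simp add: mult.assoc[symmetric])
        ultimately show "e l * b * e m * D - D * (e l * b * e m) = sq_scale (- cnj (l - m)) (e l * b * e m)"
          by (simp add: sq.scale_left_diff_distrib)
      qed
      finally show ?thesis .
    qed
    also have "\<dots> = (\<Sum>\<alpha>\<in>F. sq_scale (- cnj \<alpha>) (B \<alpha>))"
      unfolding group[symmetric] B_def sq.scale_sum_right
      by (intro sum.cong refl) (auto simp: sq.scale_left_diff_distrib)
    finally have "sq_trace (a * (b * D - D * b)) = (\<Sum>\<alpha>\<in>F. - cnj \<alpha> * sq_trace (a * B \<alpha>))"
      by (simp only: sum_distrib_left sq_trace_sum sq_scale_mult sq_trace_simps)
    also have "\<dots> = 0" using trB by simp
    finally have "sq_trace (a * (b * D - D * b)) = 0" .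
    moreover have "sq_trace ((a * b - b * a) * D) = sq_trace (a * (b * D - D * b))"
      using sq_trace_commute[of b "a * D"] by (simp add: left_diff_distrib right_diff_distrib mult.assoc)
    ultimately show ?thesis by simp
  qed
  have 2: "\<exists>k. A ^ k = 0" if tr0: "sq_trace (A * D) = 0"
  proof -
    have "\<forall>l. \<exists>r::nat. sq_trace (e l) = of_nat r \<and> (e l \<noteq> 0 \<longrightarrow> r > 0)"
      using sq_idempotent_trace[OF e(2)] by blast
    then obtain r :: "complex \<Rightarrow> nat" where r: "\<And>l. sq_trace (e l) = of_nat (r l)" "\<And>l. e l \<noteq> 0 \<Longrightarrow> r l > 0" by metis
    have trA: "sq_trace (A * e l) = l * of_nat (r l)" if l: "l \<in> \<Lambda>" for l
    proof -
      let ?y = "A - sq_scale l 1"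
      have c: "e l * ?y = ?y * e l" by (simp add: left_diff_distrib right_diff_distrib e(3))
      have "(?y * e l) ^ Suc k = ?y ^ Suc k * e l" for k
      proof (induction k)
        case (Suc k)
        have "(?y * e l) ^ Suc (Suc k) = ?y * (e l * ?y ^ Suc k) * e l" using Suc by (simp add: mult.assoc)
        also have "e l * ?y ^ Suc k = ?y ^ Suc k * e l"
          using power_commuting_commutes[OF c[symmetric], of "Suc k"] by simp
        finally show ?case by (simp add: mult.assoc e(2))
      qed simp
      from this[of K] have "(?y * e l) ^ Suc K = 0" using e(4)[OF l] by (simp add: mult.assoc)
      then have "sq_trace (?y * e l) = 0" by (rule sq_nilpotent_trace)
      then show ?thesis by (simp add: left_diff_distrib r(1))
    qed
    have "sq_trace (A * D) = (\<Sum>l\<in>\<Lambda>. cnj l * (l * of_nat (r l)))"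
      by (simp add: D_def sum_distrib_left sq_trace_sum trA)
    also have "\<dots> = of_real (\<Sum>l\<in>\<Lambda>. (cmod l)\<^sup>2 * real (r l))"
    proof -
      have "cnj l * (l * of_nat (r l)) = of_real ((cmod l)\<^sup>2 * real (r l))" for l
        by (simp only: of_real_mult complex_norm_square of_real_of_nat_eq mult_ac)
      then show ?thesis by (simp only: of_real_sum)
    qed
    finally have "(\<Sum>l\<in>\<Lambda>. (cmod l)\<^sup>2 * real (r l)) = 0"
      using tr0 by (metis of_real_eq_0_iff)
    then have z: "(cmod l)\<^sup>2 * real (r l) = 0" if "l \<in> \<Lambda>" for l
      using that e(1) by (subst (asm) sum_nonneg_eq_0_iff) auto
    have "A ^ K * e l = 0" if l: "l \<in> \<Lambda>" for l
    proof (cases "l = 0")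
      case True
      then show ?thesis using e(4)[OF l] by simp
    next
      case False
      then have "e l = 0" using z[OF l] r(2)[of l] by auto
      then show ?thesis by simp
    qed
    then have "A ^ K * (\<Sum>l\<in>\<Lambda>. e l) = 0" by (simp add: sum_distrib_left)
    then show ?thesis using e(6) by auto
  qed
  show ?thesis
  proof (rule exI[of _ D], intro conjI allI impI)
    fix a b assume tr: "\<forall>k. sq_trace (a * (?L ^^ k) b) = 0"
    show "sq_trace ((a * b - b * a) * D) = 0" by (rule 1, rule spec[OF tr])
  next
    assume "sq_trace (A * D) = 0"
    then show "\<exists>k. A ^ k = 0" by (rule 2)
  qed
qed

section \<open>Semisimple Lie algebras are spanned by brackets\<close>

text \<open>A finite index type with one element for each coordinate of \<open>'e\<close>, so that endomorphisms of
  \<open>'e\<close> have complex matrices.\<close>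
typedef (overloaded) ('e::euclidean_space) basis_index = "Basis :: 'e set"
  morphisms basis_vector index_of_basis
  using nonempty_Basis by blast

instance basis_index :: (euclidean_space) finite
proof
  have "finite (range (basis_vector :: 'a basis_index \<Rightarrow> 'a))"
    by (rule finite_subset[OF _ finite_Basis]) (use basis_vector in auto)
  then show "finite (UNIV :: 'a basis_index set)"
    by (rule finite_imageD) (simp add: inj_on_def basis_vector_inject)
qed

lemma sum_basis_vector:
  "(\<Sum>i\<in>UNIV. f (basis_vector (i :: 'e::euclidean_space basis_index))) = (\<Sum>b\<in>Basis. f b)"
proof -
  have "bij_betw basis_vector UNIV (Basis :: 'e set)"
    using type_definition.Rep_range[OF type_definition_basis_index]
    by (auto simp: bij_betw_def inj_on_def basis_vector_inject)
  then show ?thesis by (rule sum.reindex_bij_betw)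
qed

definition complex_matrix :: "('e::euclidean_space \<Rightarrow> 'e) \<Rightarrow> (complex, 'e basis_index) sqmat" where
  "complex_matrix f = sqmat_of (\<chi> i j. of_real (f (basis_vector j) \<bullet> basis_vector i))"

lemma complex_matrix_entry:
  "sq_entry (complex_matrix f) i j = of_real (f (basis_vector j) \<bullet> basis_vector i)"
  by (simp add: complex_matrix_def sq_entry.rep_eq sqmat_of_inverse)

lemma complex_matrix_linear_combination:
  "complex_matrix (\<lambda>x. f x + g x) = complex_matrix f + complex_matrix g"
  "complex_matrix (\<lambda>x. f x - g x) = complex_matrix f - complex_matrix g"
  "complex_matrix (\<lambda>x. r *\<^sub>R f x) = sq_scale (of_real r) (complex_matrix f)"
  by (rule sq_eqI, simp add: complex_matrix_entry inner_add_left inner_diff_left)+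

lemma complex_matrix_compose:
  assumes "linear f"
  shows "complex_matrix (\<lambda>x. f (g x)) = complex_matrix f * complex_matrix g"
proof (rule sq_eqI)
  fix i j :: "'a basis_index"
  let ?x = "g (basis_vector j)"
  have "f ?x = (\<Sum>b\<in>Basis. (?x \<bullet> b) *\<^sub>R f b)"
    using linear_sum[OF assms, of "\<lambda>b. (?x \<bullet> b) *\<^sub>R b" Basis] linear_scale[OF assms]
    by (simp add: euclidean_representation)
  then have "f ?x \<bullet> basis_vector i = (\<Sum>b\<in>Basis. (?x \<bullet> b) * (f b \<bullet> basis_vector i))"
    by (simp add: inner_sum_left)
  also have "\<dots> = (\<Sum>k\<in>UNIV. (?x \<bullet> basis_vector k) * (f (basis_vector k) \<bullet> basis_vector i))"
    by (rule sum_basis_vector[symmetric])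
  finally show "sq_entry (complex_matrix (\<lambda>x. f (g x))) i j = sq_entry (complex_matrix f * complex_matrix g) i j"
    by (simp add: complex_matrix_entry sq_entry_mult mult.commute)
qed

lemma complex_matrix_id: "complex_matrix (\<lambda>x. x) = 1"
  by (rule sq_eqI) (auto simp: complex_matrix_entry inner_Basis basis_vector basis_vector_inject)

lemma complex_matrix_funpow: "linear f \<Longrightarrow> complex_matrix (f ^^ k) = complex_matrix f ^ k"
proof (induction k)
  case 0
  then show ?case using complex_matrix_id by (simp add: id_def)
next
  case (Suc k)
  then show ?case using complex_matrix_compose[of f "f ^^ k"] by (simp add: o_def)
qed

lemma complex_matrix_eq_0:
  assumes "linear f" "complex_matrix f = 0"
  shows "f x = 0"
proof -
  have "f b = 0" if b: "b \<in> Basis" for b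
  proof (rule euclidean_eqI)
    fix i :: 'a assume i: "i \<in> Basis"
    have "sq_entry (complex_matrix f) (index_of_basis i) (index_of_basis b) = 0" using assms(2) by simp
    then show "f b \<bullet> i = 0 \<bullet> i" using b i by (simp add: complex_matrix_entry index_of_basis_inverse)
  qed
  then show ?thesis
    using linear_sum[OF assms(1), of "\<lambda>b. (x \<bullet> b) *\<^sub>R b" Basis] linear_scale[OF assms(1)]
    by (simp add: euclidean_representation)
qed

locale leibniz_algebra =
  fixes br :: "'e::euclidean_space \<Rightarrow> 'e \<Rightarrow> 'e"
  assumes linear_left: "linear (\<lambda>u. br u v)" and linear_right: "linear (br u)"
    and leibniz: "br u (br v w) = br (br u v) w + br v (br u w)"
begin

lemmas br_add_left = linear_add[OF linear_left] and br_scale_left = linear_scale[OF linear_left]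
  and br_zero_left = linear_0[OF linear_left]
  and br_add_right = linear_add[OF linear_right] and br_scale_right = linear_scale[OF linear_right]
  and br_zero_right = linear_0[OF linear_right]

text \<open>The squares \<open>[u, u]\<close> span an ideal: with \<open>a = [x, u]\<close>, the bracket of \<open>x\<close> and \<open>[u, u]\<close> is
  \<open>[a, u] + [u, a] = [a + u, a + u] - [a, a] - [u, u]\<close>. The Leibniz rule for \<open>[u, [u, z]]\<close>
  shows that squares annihilate everything from the left, so this ideal is abelian.\<close>
lemma semisimple_imp_alternating:
  assumes "semisimple_lie_algebra br"
  shows "br u u = 0"
proof -
  let ?I = "span {br u u | u. True}"
  have "lie_ideal br ?I"
    unfolding lie_ideal_def
  proof (intro conjI allI ballI subspace_span)
    fix x y assume "y \<in> ?I"
    then show "br x y \<in> ?I"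
    proof (induction rule: span_induct_alt)
      case base
      then show ?case by (simp add: br_zero_right span_zero)
    next
      case (step r y z)
      then obtain u where u: "y = br u u" by blast
      let ?a = "br x u"
      have "br x y = br ?a u + br u ?a" unfolding u by (rule leibniz)
      also have "\<dots> = br (?a + u) (?a + u) - br ?a ?a - br u u"
        by (simp add: br_add_left br_add_right)
      finally have "br x y = br (?a + u) (?a + u) - br ?a ?a - br u u" .
      moreover have "br w w \<in> ?I" for w by (auto intro: span_base)
      ultimately have "br x y \<in> ?I" by (simp only: span_diff)
      then show ?case using step by (simp add: br_add_right br_scale_right span_add span_scale)
    qed
  qed
  moreover have kill: "br y z = 0" if "y \<in> ?I" for y z
    using that
  proof (induction rule: span_induct_alt)
    case (step r y w)
    then obtain u where "y = br u u" by blast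
    then have "br y z = 0" using leibniz[of u u z] by simp
    then show ?case using step by (simp add: br_add_left br_scale_left)
  qed (simp add: br_zero_left)
  have "lie_derived br ?I = {0}"
  proof -
    have "{br x y | x y. x \<in> ?I \<and> y \<in> ?I} = {0}" using kill span_zero by fastforce
    then show ?thesis by (simp add: lie_derived_def)
  qed
  then have "lie_solvable br ?I" unfolding lie_solvable_def by (intro exI[of _ 1]) simp
  ultimately have "?I = {0}" using assms unfolding semisimple_lie_algebra_def by blast
  moreover have "br u u \<in> ?I" by (auto intro: span_base)
  ultimately show ?thesis by blast
qed

end

locale lie_algebra = leibniz_algebra br for br :: "'e::euclidean_space \<Rightarrow> 'e \<Rightarrow> 'e" +
  assumes alternating: "br u u = 0"
begin

lemma antisym: "br u v = - br v u"
proof -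
  have "br (u + v) (u + v) = br u v + br v u"
    by (simp add: br_add_left br_add_right alternating[of u] alternating[of v])
  then show ?thesis using alternating[of "u + v"] by (simp add: eq_neg_iff_add_eq_0)
qed

lemma subspace_of_maximal_dim:
  fixes good :: "'e set \<Rightarrow> bool"
  assumes "good F0"
  obtains F where "good F" "\<forall>G. good G \<longrightarrow> dim G \<le> dim F"
proof -
  have "\<forall>G. good G \<longrightarrow> dim G < Suc DIM('e)" by (simp add: less_Suc_eq_le dim_subset_UNIV)
  then show ?thesis using ex_has_greatest_nat[of good F0 dim "Suc DIM('e)"] assms that by blast
qed

lemma span_insert_eq: "subspace M \<Longrightarrow> span (insert y M) = {m + r *\<^sub>R y | m r. m \<in> M}"
proof -
  assume M: "subspace M"
  have "span (insert y M) = {x. \<exists>k. x - k *\<^sub>R y \<in> M}"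
    using span_insert[of y M] span_eq_iff[THEN iffD2, OF M] by simp
  also have "\<dots> = {m + r *\<^sub>R y | m r. m \<in> M}"
  proof safe
    fix x k assume "x - k *\<^sub>R y \<in> M"
    then show "\<exists>m r. x = m + r *\<^sub>R y \<and> m \<in> M" by (intro exI[of _ "x - k *\<^sub>R y"] exI[of _ k]) simp
  next
    fix m r assume "m \<in> M"
    then show "\<exists>k. m + r *\<^sub>R y - k *\<^sub>R y \<in> M" by (intro exI[of _ r]) simp
  qed
  finally show ?thesis .
qed

text \<open>Engel's theorem for \<open>M\<close> acting on the quotient of \<open>B\<close> by \<open>A\<close>. Let \<open>N\<close> be a maximal proper
  subalgebra of \<open>M\<close>. By induction, applied to \<open>N\<close> acting on the quotient of \<open>M\<close> by \<open>N\<close>, some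
  \<open>y\<close> outside \<open>N\<close> normalises \<open>N\<close>, hence \<open>M\<close> is spanned by \<open>N\<close> and \<open>y\<close>. By induction again,
  \<open>N\<close> annihilates some vector \<open>v\<close> outside \<open>A\<close> modulo \<open>A\<close>. The vectors with this property are
  preserved by \<open>y\<close>, and the last iterate of \<open>v\<close> under \<open>y\<close> that is not in \<open>A\<close> is annihilated
  by \<open>N\<close> and by \<open>y\<close>.\<close>
theorem engel:
  assumes "subspace M" "\<And>x y. x \<in> M \<Longrightarrow> y \<in> M \<Longrightarrow> br x y \<in> M"
    and "\<And>x. x \<in> M \<Longrightarrow> \<exists>k. \<forall>v. (br x ^^ k) v = 0"
    and "subspace A" "subspace B" "A \<subset> B"
    and "\<And>x v. x \<in> M \<Longrightarrow> v \<in> A \<Longrightarrow> br x v \<in> A" "\<And>x v. x \<in> M \<Longrightarrow> v \<in> B \<Longrightarrow> br x v \<in> B"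
  shows "\<exists>v\<in>B - A. \<forall>x\<in>M. br x v \<in> A"
  using assms
proof (induction "dim M" arbitrary: M A B rule: less_induct)
  case less
  note M = less.prems(1,2) and nil = less.prems(3) and AB = less.prems(4-6) and inv = less.prems(7,8)
  show ?case
  proof (cases "M = {0}")
    case True
    then show ?thesis using AB subspace_0[OF AB(1)] by (auto simp: br_zero_left)
  next
    case False
    define good where "good N \<longleftrightarrow> subspace N \<and> N \<subset> M \<and> (\<forall>x\<in>N. \<forall>y\<in>N. br x y \<in> N)" for N
    have "good {0}" using False subspace_0[OF M(1)] by (auto simp: good_def br_zero_left)
    then obtain N where N: "good N" "\<forall>G. good G \<longrightarrow> dim G \<le> dim N" by (rule subspace_of_maximal_dim)
    have N': "subspace N" "N \<subset> M" "\<And>x y. x \<in> N \<Longrightarrow> y \<in> N \<Longrightarrow> br x y \<in> N" using N(1) by (auto simp: good_def)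
    have dimN: "dim N < dim M" using N'(1,2) M(1) by (metis dim_psubset span_eq_iff)
    have "\<exists>y\<in>M - N. \<forall>x\<in>N. br x y \<in> N"
      by (rule less.hyps[OF dimN N'(1) N'(3)]) (use nil N' M in auto)
    then obtain y where y: "y \<in> M" "y \<notin> N" "\<And>x. x \<in> N \<Longrightarrow> br x y \<in> N" by blast
    have Ny: "span (insert y N) = {m + r *\<^sub>R y | m r. m \<in> N}" by (rule span_insert_eq[OF N'(1)])
    have MN: "M = {m + r *\<^sub>R y | m r. m \<in> N}"
    proof (rule ccontr)
      assume ne: "M \<noteq> {m + r *\<^sub>R y | m r. m \<in> N}"
      have sub: "{m + r *\<^sub>R y | m r. m \<in> N} \<subseteq> M"
        using N'(2) y(1) M(1) by (auto intro!: subspace_add subspace_scale)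
      have closed: "br a b \<in> {m + r *\<^sub>R y | m r. m \<in> N}"
        if ab: "a \<in> {m + r *\<^sub>R y | m r. m \<in> N}" "b \<in> {m + r *\<^sub>R y | m r. m \<in> N}" for a b
      proof -
        obtain m r n s where *: "a = m + r *\<^sub>R y" "b = n + s *\<^sub>R y" "m \<in> N" "n \<in> N" using ab by blast
        have "br a b = br m n + s *\<^sub>R br m y - r *\<^sub>R br n y"
          using antisym[of y n] by (simp add: * br_add_left br_add_right br_scale_left br_scale_right alternating)
        also have "\<dots> \<in> N" using * N' y(3) by (intro subspace_diff subspace_add subspace_scale) auto
        finally show ?thesis by (force intro: exI[of _ 0])
      qed
      have "good (span (insert y N))"
        unfolding good_def Ny
      proof (intro conjI ballI psubsetI sub closed)
        show "subspace {m + r *\<^sub>R y | m r. m \<in> N}"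
          using subspace_span[of "insert y N"] unfolding Ny .
        show "{m + r *\<^sub>R y | m r. m \<in> N} \<noteq> M" using ne by (rule not_sym)
      qed
      then have "dim (span (insert y N)) \<le> dim N" by (rule N(2)[rule_format])
      then have "N = span (insert y N)"
        using subspace_dim_equal[OF N'(1) subspace_span] span_superset[of "insert y N"] by blast
      then show False using y(2) span_base[of y "insert y N"] by blast
    qed
    define Z where "Z = {v \<in> B. \<forall>x\<in>N. br x v \<in> A}"
    have "\<exists>v\<in>B - A. \<forall>x\<in>N. br x v \<in> A"
      by (rule less.hyps[OF dimN N'(1) N'(3) _ AB]) (use nil inv N'(2) in auto)
    then obtain v where v: "v \<in> Z" "v \<notin> A" by (auto simp: Z_def)
    have yZ: "br y v \<in> Z" if "v \<in> Z" for v
    proof -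
      have "br x (br y v) \<in> A" if "x \<in> N" for x
      proof -
        have "br x (br y v) = br (br x y) v + br y (br x v)" by (rule leibniz)
        then show ?thesis using \<open>v \<in> Z\<close> that y inv(1) subspace_add[OF AB(1)] by (simp add: Z_def)
      qed
      then show ?thesis using that inv(2)[OF y(1)] by (simp add: Z_def)
    qed
    then have yk: "(br y ^^ k) v \<in> Z" for k using v(1) by (induction k) auto
    obtain k where "(br y ^^ k) v = 0" using nil[OF y(1)] by blast
    then have ex: "\<exists>k. (br y ^^ k) v \<in> A" using subspace_0[OF AB(1)] by metis
    define k0 where "k0 = (LEAST k. (br y ^^ k) v \<in> A)"
    have k0: "(br y ^^ k0) v \<in> A" unfolding k0_def using ex by (rule LeastI_ex)
    have "k0 \<noteq> 0" using k0 v(2) by (metis funpow_0)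
    then obtain j where j: "k0 = Suc j" by (metis not0_implies_Suc)
    let ?w = "(br y ^^ j) v"
    have "?w \<notin> A" using not_less_Least[of j "\<lambda>k. (br y ^^ k) v \<in> A"] j unfolding k0_def by simp
    moreover have "br y ?w \<in> A" using k0 by (simp add: j)
    moreover have "?w \<in> Z" by (rule yk)
    ultimately have "?w \<in> B - A" "\<And>m r. m \<in> N \<Longrightarrow> br (m + r *\<^sub>R y) ?w \<in> A"
      using AB(1) by (auto simp: Z_def br_add_left br_scale_left intro: subspace_add subspace_scale)
    then show ?thesis using MN by blast
  qed
qed

definition killing :: "'e \<Rightarrow> 'e \<Rightarrow> real" where
  "killing x y = (\<Sum>b\<in>Basis. br x (br y b) \<bullet> b)"

abbreviation adm :: "'e \<Rightarrow> (complex, 'e basis_index) sqmat" where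
  "adm x \<equiv> complex_matrix (br x)"

lemma killing_trace: "of_real (killing x y) = sq_trace (adm x * adm y)"
proof -
  have "sq_trace (adm x * adm y) = sq_trace (complex_matrix (\<lambda>v. br x (br y v)))"
    by (simp only: complex_matrix_compose[OF linear_right[of x], of "br y"])
  also have "\<dots> = (\<Sum>i\<in>UNIV. of_real (br x (br y (basis_vector i)) \<bullet> basis_vector i))"
    by (simp add: sq_trace_entries complex_matrix_entry)
  also have "\<dots> = of_real (killing x y)"
    unfolding killing_def of_real_sum by (rule sum_basis_vector)
  finally show ?thesis by simp
qed

lemma adm_bracket: "adm (br x y) = adm x * adm y - adm y * adm x"
proof -
  have "br (br x y) = (\<lambda>v. br x (br y v) - br y (br x v))"
    by (rule ext, rule eq_diff_eq[THEN iffD2, OF leibniz[symmetric]])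
  then show ?thesis
    by (simp only: complex_matrix_linear_combination complex_matrix_compose[OF linear_right[of x], of "br y"]
        complex_matrix_compose[OF linear_right[of y], of "br x"])
qed

lemma adm_linear: "adm (x + y) = adm x + adm y" "adm (r *\<^sub>R x) = sq_scale (of_real r) (adm x)" "adm 0 = 0"
proof -
  have "br (x + y) = (\<lambda>v. br x v + br y v)" "br (r *\<^sub>R x) = (\<lambda>v. r *\<^sub>R br x v)"
    by (simp_all add: fun_eq_iff br_add_left br_scale_left)
  then show a: "adm (x + y) = adm x + adm y" "adm (r *\<^sub>R x) = sq_scale (of_real r) (adm x)"
    by (simp_all add: complex_matrix_linear_combination)
  have "br 0 = (\<lambda>v. 0 *\<^sub>R br 0 v)" by (simp add: fun_eq_iff br_zero_left)
  then show "adm 0 = 0" by (metis complex_matrix_linear_combination(3) of_real_0 sq.scale_zero_left)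
qed

lemma killing_eqI: "of_real (killing x y) = (of_real (killing z w) :: complex) \<Longrightarrow> killing x y = killing z w"
  by (simp only: of_real_eq_iff)

lemma killing_sym: "killing x y = killing y x"
  by (rule killing_eqI) (simp only: killing_trace sq_trace_commute)

lemma killing_invariant: "killing (br x y) z = killing x (br y z)"
proof (rule killing_eqI)
  have "sq_trace ((adm y * adm x) * adm z) = sq_trace (adm x * (adm z * adm y))"
    using sq_trace_commute[of "adm y" "adm x * adm z"] by (simp add: mult.assoc)
  then show "of_real (killing (br x y) z) = (of_real (killing x (br y z)) :: complex)"
    unfolding killing_trace adm_bracket by (simp add: left_diff_distrib right_diff_distrib mult.assoc)
qed

lemma killing_linear: "linear (killing x)"
  by (rule linearI) (simp_all add: killing_def br_add_left br_scale_left br_add_right br_scale_right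
      inner_add_left sum.distrib sum_distrib_left)

lemma killing_linear_left: "linear (\<lambda>x. killing x y)"
proof -
  have "(\<lambda>x. killing x y) = killing y" by (rule ext) (rule killing_sym)
  then show ?thesis using killing_linear by simp
qed

text \<open>For \<open>a\<close> and \<open>b\<close> in \<open>S\<close>, all iterates of \<open>b\<close> under \<open>ad x\<close> stay in \<open>S\<close> and are
  Killing-orthogonal to \<open>a\<close>. So \<open>ad [a, b]\<close> is orthogonal, for the trace form, to the matrix
  \<open>D\<close> that belongs to \<open>ad x\<close>. As \<open>S\<close> is spanned by such brackets, this applies to \<open>ad x\<close>
  itself.\<close>
lemma cartan_nilpotent:
  assumes S: "subspace S" and perfect: "S \<subseteq> lie_derived br S" and closed: "\<And>x y. x \<in> S \<Longrightarrow> y \<in> S \<Longrightarrow> br x y \<in> S"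
    and zero: "\<And>x y. x \<in> S \<Longrightarrow> y \<in> S \<Longrightarrow> killing x y = 0" and x: "x \<in> S"
  shows "\<exists>k. \<forall>v. (br x ^^ k) v = 0"
proof -
  let ?L = "\<lambda>C. adm x * C - C * adm x"
  obtain D where D:
    "\<forall>a b. (\<forall>k. sq_trace (a * (?L ^^ k) b) = 0) \<longrightarrow> sq_trace ((a * b - b * a) * D) = 0"
    "sq_trace (adm x * D) = 0 \<longrightarrow> (\<exists>k. adm x ^ k = 0)"
    using cartan_conjugate[of "adm x"] by (elim exE conjE)
  have br_zero: "sq_trace (adm (br a b) * D) = 0" if ab: "a \<in> S" "b \<in> S" for a b
    unfolding adm_bracket
  proof (rule D(1)[rule_format])
    fix k
    have "(?L ^^ k) (adm b) = adm ((br x ^^ k) b)" by (induction k) (simp_all add: adm_bracket)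
    moreover have "(br x ^^ k) b \<in> S" by (induction k) (use ab x closed in auto)
    ultimately show "sq_trace (adm a * (?L ^^ k) (adm b)) = 0"
      using zero[OF ab(1)] killing_trace[of a "(br x ^^ k) b"] by simp
  qed
  have "x \<in> span {br a b | a b. a \<in> S \<and> b \<in> S}" using perfect x by (auto simp: lie_derived_def)
  then have "sq_trace (adm x * D) = 0"
  proof (induction rule: span_induct_alt)
    case (step r a z)
    then show ?case using br_zero by (auto simp: adm_linear distrib_right)
  qed (simp add: adm_linear)
  then obtain k where "adm x ^ k = 0" using D(2) by blast
  then have z: "complex_matrix (br x ^^ k) = 0" by (simp add: complex_matrix_funpow[OF linear_right])
  have "linear (br x ^^ k)"
  proof (induction k)
    case 0
    show ?case using linear_id by (simp add: id_def)
  next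
    case (Suc k)
    show ?case using linear_compose[OF Suc linear_right[of x]] by (simp add: o_def)
  qed
  then have "(br x ^^ k) v = 0" for v by (rule complex_matrix_eq_0[OF _ z])
  then show ?thesis by blast
qed

text \<open>All elements of \<open>S\<close> act nilpotently. If \<open>S\<close> is not zero, then by Engel's theorem, a maximal
  proper subspace \<open>F\<close> of \<open>S\<close> that is invariant under \<open>S\<close> has codimension one, and \<open>S\<close> acts
  trivially on the quotient. So \<open>[S, S]\<close> lies in \<open>F\<close> and is not \<open>S\<close>.\<close>
lemma perfect_killing_zero:
  assumes S: "subspace S" and perfect: "lie_derived br S = S"
    and zero: "\<And>x y. x \<in> S \<Longrightarrow> y \<in> S \<Longrightarrow> killing x y = 0"
  shows "S = {0}"
proof (rule ccontr)
  assume "S \<noteq> {0}"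
  have closed: "br x y \<in> S" if "x \<in> S" "y \<in> S" for x y
    using that perfect unfolding lie_derived_def by (metis (mono_tags, lifting) mem_Collect_eq span_base)
  have nil: "\<exists>k. \<forall>v. (br x ^^ k) v = 0" if "x \<in> S" for x
    by (rule cartan_nilpotent[OF S _ closed zero that]) (use perfect in auto)
  define good where "good F \<longleftrightarrow> subspace F \<and> F \<subset> S \<and> (\<forall>x\<in>S. \<forall>y\<in>F. br x y \<in> F)" for F
  have "good {0}" using \<open>S \<noteq> {0}\<close> subspace_0[OF S] by (auto simp: good_def br_zero_right)
  then obtain F where F: "good F" "\<forall>G. good G \<longrightarrow> dim G \<le> dim F" by (rule subspace_of_maximal_dim)
  have F': "subspace F" "F \<subset> S" "\<And>x y. x \<in> S \<Longrightarrow> y \<in> F \<Longrightarrow> br x y \<in> F" using F(1) by (auto simp: good_def)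
  obtain v where v: "v \<in> S" "v \<notin> F" "\<And>x. x \<in> S \<Longrightarrow> br x v \<in> F"
    using engel[OF S closed nil F'(1) S F'(2) F'(3) closed] by blast
  have Fv: "span (insert v F) = {m + r *\<^sub>R v | m r. m \<in> F}" by (rule span_insert_eq[OF F'(1)])
  have into: "br x y \<in> F" if "x \<in> S" "y \<in> span (insert v F)" for x y
    using that F' v(3) unfolding Fv
    by (auto simp: br_add_right br_scale_right intro!: subspace_add subspace_scale)
  have "span (insert v F) = S"
  proof (rule ccontr)
    assume "span (insert v F) \<noteq> S"
    moreover have "span (insert v F) \<subseteq> S" using F'(2) v(1) by (intro span_minimal S) auto
    moreover have "F \<subseteq> span (insert v F)" using span_superset[of "insert v F"] by blast
    ultimately have "good (span (insert v F))" using into by (auto simp: good_def)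
    then have "dim (span (insert v F)) \<le> dim F" by (rule F(2)[rule_format])
    then have "F = span (insert v F)"
      using subspace_dim_equal[OF F'(1) subspace_span] span_superset[of "insert v F"] by blast
    then show False using v(2) span_base[of v "insert v F"] by blast
  qed
  then have "{br x y | x y. x \<in> S \<and> y \<in> S} \<subseteq> F" using into by auto
  then have "lie_derived br S \<subseteq> F" unfolding lie_derived_def by (rule span_minimal[OF _ F'(1)])
  then show False using perfect F'(2) by blast
qed

lemma lie_ideal_derived:
  assumes "lie_ideal br I"
  shows "lie_ideal br (lie_derived br I)" "lie_derived br I \<subseteq> I"
proof -
  have I: "subspace I" "\<And>x y. y \<in> I \<Longrightarrow> br x y \<in> I" using assms by (auto simp: lie_ideal_def)
  show "lie_derived br I \<subseteq> I" unfolding lie_derived_def by (rule span_minimal[OF _ I(1)]) (use I(2) in auto)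
  show "lie_ideal br (lie_derived br I)"
    unfolding lie_ideal_def
  proof (intro conjI allI ballI)
    show "subspace (lie_derived br I)" by (simp add: lie_derived_def)
    fix x y assume "y \<in> lie_derived br I"
    then have "y \<in> span {br x y | x y. x \<in> I \<and> y \<in> I}" by (simp add: lie_derived_def)
    then show "br x y \<in> lie_derived br I"
    proof (induction rule: span_induct_alt)
      case base
      then show ?case by (simp add: br_zero_right lie_derived_def span_zero)
    next
      case (step r a z)
      then obtain u v where uv: "a = br u v" "u \<in> I" "v \<in> I" by blast
      have "br (br x u) v \<in> lie_derived br I" "br u (br x v) \<in> lie_derived br I"
        unfolding lie_derived_def using uv I(2) by (blast intro: span_base)+
      then have "br x a \<in> lie_derived br I" unfolding uv(1) leibniz[of x u v]
        unfolding lie_derived_def by (rule span_add)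
      then show ?case using step by (simp add: br_add_right br_scale_right lie_derived_def span_add span_scale)
    qed
  qed
qed

text \<open>The derived series of the radical \<open>R\<close> of the Killing form ends in a perfect ideal on which
  this form vanishes, that is, in zero. So \<open>R\<close> is solvable and therefore zero. If the
  brackets lay in a hyperplane, its normal vector would represent the functional \<open>killing x\<close>
  for some \<open>x\<close>. By invariance of the form all \<open>[x, y]\<close> would be in \<open>R\<close>, so \<open>x\<close> would span an
  abelian ideal and be zero.\<close>
theorem semisimple_imp_perfect:
  assumes ss: "semisimple_lie_algebra br"
  shows "span {br u v | u v. True} = UNIV"
proof -
  define R where "R = {x. \<forall>y. killing x y = 0}"
  have idR: "lie_ideal br R"
    unfolding lie_ideal_def
  proof (intro conjI allI ballI)
    show "subspace R" unfolding R_def subspace_def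
      by (simp add: linear_add[OF killing_linear_left] linear_scale[OF killing_linear_left] linear_0[OF killing_linear_left])
    fix x y assume y: "y \<in> R"
    have "killing (br x y) z = 0" for z
    proof -
      have "killing (br x y) z = - killing (br y x) z"
        using antisym[of x y] killing_sym linear_neg[OF killing_linear] by metis
      then show ?thesis using y killing_invariant[of y x z] by (simp add: R_def)
    qed
    then show "br x y \<in> R" by (simp add: R_def)
  qed
  let ?d = "\<lambda>n. (lie_derived br ^^ n) R"
  have ideals: "lie_ideal br (?d n) \<and> ?d n \<subseteq> R" for n
    by (induction n) (use idR lie_ideal_derived in fastforce)+
  obtain n where n: "\<And>m. dim (?d n) \<le> dim (?d m)"
    using ex_has_least_nat[of "\<lambda>_. True" 0 "\<lambda>n. dim (?d n)"] by blast
  have dn: "subspace (?d n)" using ideals by (auto simp: lie_ideal_def)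
  have "lie_derived br (?d n) = ?d n"
  proof (rule subspace_dim_equal)
    show "subspace (lie_derived br (?d n))" by (simp add: lie_derived_def)
    show "lie_derived br (?d n) \<subseteq> ?d n" using lie_ideal_derived(2) ideals by blast
    show "dim (?d n) \<le> dim (lie_derived br (?d n))" using n[of "Suc n"] by simp
  qed (rule dn)
  then have "?d n = {0}"
    by (rule perfect_killing_zero[OF dn]) (use ideals[of n] in \<open>auto simp: R_def\<close>)
  then have "lie_solvable br R" unfolding lie_solvable_def by blast
  then have R0: "R = {0}" using ss idR unfolding semisimple_lie_algebra_def by blast
  \<comment> \<open>The vector that represents the functional \<open>killing x\<close> by the inner product.\<close>
  define k where "k x = (\<Sum>b\<in>Basis. killing x b *\<^sub>R b)" for x
  have k: "k x \<bullet> y = killing x y" for x y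
  proof -
    have "killing x y = (\<Sum>b\<in>Basis. (y \<bullet> b) * killing x b)"
      using linear_sum[OF killing_linear, of x "\<lambda>b. (y \<bullet> b) *\<^sub>R b" Basis] linear_scale[OF killing_linear]
      by (simp add: euclidean_representation)
    moreover have "k x \<bullet> y = (\<Sum>b\<in>Basis. killing x b * (b \<bullet> y))" by (simp add: k_def inner_sum_left)
    ultimately show ?thesis by (simp add: inner_commute mult.commute)
  qed
  have lin: "linear k"
    unfolding k_def
    by (rule linearI) (simp_all add: linear_add[OF killing_linear_left] linear_scale[OF killing_linear_left]
        scaleR_add_left sum.distrib scaleR_sum_right)
  have "inj k"
    unfolding linear_injective_0[OF lin]
  proof (intro allI impI)
    fix x assume "k x = 0"
    then have "killing x y = 0" for y using k[of x y] by simp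
    then show "x = 0" using R0 by (auto simp: R_def)
  qed
  then have surj: "surj k" by (rule linear_injective_imp_surjective[OF lin]) (rule refl)
  show ?thesis
  proof (rule ccontr)
    assume "span {br u v | u v. True} \<noteq> UNIV"
    then obtain a where a: "a \<noteq> 0" "\<And>x. x \<in> span {br u v | u v. True} \<Longrightarrow> a \<bullet> x = 0"
      using span_not_UNIV_orthogonal by blast
    obtain x where x: "k x = a" using surj by (metis surjD)
    have "killing x (br y z) = 0" for y z
      using a(2)[of "br y z"] k[of x "br y z"] x by (auto intro: span_base)
    then have "br x y \<in> R" for y by (simp add: R_def killing_invariant)
    then have central: "br x y = 0" for y using R0 by blast
    have left: "br y z = 0" if z: "z \<in> span {x}" for y z
    proof -
      obtain r where "z = r *\<^sub>R x" using z by (auto simp: span_singleton)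
      then show ?thesis using central[of y] antisym[of y x] by (simp add: br_scale_right)
    qed
    have "lie_ideal br (span {x})"
      unfolding lie_ideal_def by (intro conjI subspace_span allI ballI) (simp only: left span_zero)
    moreover have "lie_derived br (span {x}) = {0}"
    proof -
      have "{br u v | u v. u \<in> span {x} \<and> v \<in> span {x}} \<subseteq> {0}" using left by blast
      then have "lie_derived br (span {x}) \<subseteq> {0}"
        unfolding lie_derived_def by (rule span_minimal) (simp add: subspace_def)
      moreover have "0 \<in> lie_derived br (span {x})" unfolding lie_derived_def by (rule span_zero)
      ultimately show ?thesis by blast
    qed
    then have "lie_solvable br (span {x})" unfolding lie_solvable_def by (intro exI[of _ 1]) simp
    ultimately have "span {x} = {0}" using ss unfolding semisimple_lie_algebra_def by blast
    then have "x = 0" using span_base[of x "{x}"] by blast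
    then show False using x a(1) linear_0[OF lin] by simp
  qed
qed

end

section \<open>Representations of connected perfect Lie groups\<close>

lemma lie_group_chart_semisimple_perfect:
  assumes "lie_group_chart H T \<A> c" and "connected_space T"
    and ss: "semisimple_lie_algebra (lie_bracket H c)"
  shows "derived H (carrier H) = carrier H"
proof -
  interpret lie_group_chart H T \<A> c by fact
  interpret L: leibniz_algebra bracket
    by unfold_locales
      (simp_all add: linear_add[OF linear_bracket_left] linear_scale[OF linear_bracket_left]
        linear_add[OF linear_bracket_right] linear_scale[OF linear_bracket_right],
       rule bracket_leibniz)
  have ss': "semisimple_lie_algebra bracket" using ss by (simp add: bracket_def)
  interpret L: lie_algebra bracket
    by unfold_locales (rule L.semisimple_imp_alternating[OF ss'])
  show ?thesis using derived_eq_carrier[OF assms(2) L.semisimple_imp_perfect[OF ss']] .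
qed

text \<open>Small elements of \<open>H\<close> are divisible by \<open>m\<close> arbitrarily often, so their images are unipotent
  and have the same trace as the identity matrix.\<close>
lemma perfect_lie_group_representation_trivial:
  fixes \<phi> :: "'h \<Rightarrow> ('k::field, 'n::finite) sqmat" and H :: "('h, 'm) monoid_scheme"
    and c :: "('h, 'e::euclidean_space) chart"
  assumes chart: "lie_group_chart H T \<A> c" and conn: "connected_space T"
    and p: "Factorial_Ring.prime p"
    and K: "number_field TYPE('k) \<or> is_finite_extension_of TYPE('k) (Qp p)"
    and mult: "\<And>x y. x \<in> carrier H \<Longrightarrow> y \<in> carrier H \<Longrightarrow> \<phi> (x \<otimes>\<^bsub>H\<^esub> y) = \<phi> x * \<phi> y"
    and one: "\<phi> \<one>\<^bsub>H\<^esub> = 1"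
    and perfect: "derived H (carrier H) = carrier H" and h: "h \<in> carrier H"
  shows "\<phi> h = 1"
proof -
  interpret lie_group_chart H T \<A> c by fact
  obtain L :: "('k, 'n) sqmat set" and R r where lat: "ring_lattice p L R r"
    and char0: "\<And>r. r > 0 \<Longrightarrow> of_nat r \<noteq> (0::'k)"
    using finite_extension_ring_lattice[OF p K] by metis
  interpret rl: ring_lattice p L R r by (rule lat)
  have p2: "p > 1" using p by (rule prime_gt_1_nat)
  have "1 * 2 \<le> fact (card R) * p" using p2 by (intro mult_le_mono fact_ge_1) auto
  then have m2: "rl.m \<ge> 2" by (simp add: rl.m_def mult.commute)
  obtain B where B: "B \<in> nbhds_one"
    and div: "\<And>x. x \<in> B \<Longrightarrow> \<exists>g. g 0 = x \<and> (\<forall>j. g j \<in> carrier H \<and> g (Suc j) [^]\<^bsub>H\<^esub> rl.m = g j)"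
    by (rule divisible_neighbourhood[OF m2]) blast
  have pow: "\<phi> (x [^]\<^bsub>H\<^esub> k) = \<phi> x ^ k" if "x \<in> carrier H" for x and k :: nat
    using that by (induction k) (simp_all add: one mult power_commutes)
  have trace: "sq_trace (\<phi> u) = sq_trace (1 :: ('k, 'n) sqmat)" if u: "u \<in> B" for u
  proof -
    obtain g where g: "g 0 = u" "\<And>j. g j \<in> carrier H" "\<And>j. g (Suc j) [^]\<^bsub>H\<^esub> rl.m = g j" using div[OF u] by blast
    have "\<exists>a. (\<phi> (g 0) - 1) ^ a = 0"
    proof (rule rl.divisible_imp_unipotent[of "\<lambda>j. \<phi> (g j)"])
      show "\<phi> (g (Suc j)) ^ rl.m = \<phi> (g j)" for j using pow[OF g(2), of "Suc j" rl.m] g(3) by simp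
      show "\<phi> (g 0) * \<phi> (inv\<^bsub>H\<^esub> g 0) = 1" using mult[of "g 0" "inv\<^bsub>H\<^esub> g 0"] one g(2)[of 0] by simp
      show "\<exists>a w. y ^ a = y ^ Suc a * w \<and> w * y = y * w" for y :: "('k, 'n) sqmat"
      proof -
        obtain a w where "y ^ a = y ^ Suc a * w" "w \<in> sq.span (range ((^) y))"
          using sq_power_eventually_divisible[of y] by blast
        then show ?thesis using sq_span_powers_commute[of w y y] by blast
      qed
    qed (rule p2)
    then have "sq_trace (\<phi> u - 1) = 0" using sq_nilpotent_trace g(1) by blast
    then show ?thesis by simp
  qed
  interpret N: neighbourhood_representation H \<phi> nbhds_one
  proof unfold_locales
    show "U \<subseteq> carrier H" if "U \<in> nbhds_one" for U by (rule nbhds_one_subset[OF that])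
    show "\<exists>V\<in>nbhds_one. \<forall>x\<in>V. \<forall>y\<in>V. x \<otimes>\<^bsub>H\<^esub> y \<in> U" if "U \<in> nbhds_one" for U by (rule nbhds_one_mult[OF that])
    show "\<exists>V\<in>nbhds_one. \<forall>x\<in>V. inv\<^bsub>H\<^esub> x \<in> U" if "U \<in> nbhds_one" for U by (rule nbhds_one_inv[OF that])
    show "S = carrier H" if "U \<in> nbhds_one" "subgroup S H" "U \<subseteq> S" for U S
      by (rule nbhds_one_generate[OF conn that])
  qed (use mult one char0 in \<open>auto simp: nbhds_one_def\<close>)
  show ?thesis by (rule N.perfect_imp_trivial[OF B trace perfect h])
qed

theorem corollary1p7:
  fixes p :: nat
    and G :: "('k::field alg_closure ^ 'n ^ 'n) set"
    and H :: "('h, 'm) monoid_scheme"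
    and T :: "'h topology"
    and \<A> :: "('h, 'e::euclidean_space) chart set"
    and \<phi> :: "'h \<Rightarrow> 'k ^ 'n ^ 'n"
  assumes "Factorial_Ring.prime p"
    and "number_field TYPE('k) \<or> is_finite_extension_of TYPE('k) (Qp p)"
    and "linear_algebraic_group G"
    and "lie_group H T \<A>"
    and "connected_space T"
    and "\<phi> \<in> hom H (rational_points G)"
  shows "(perfect_group H \<longrightarrow> (\<forall>h\<in>carrier H. \<phi> h = \<one>\<^bsub>rational_points G\<^esub>)) \<and>
         (semisimple_lie_group H \<A> \<longrightarrow> (\<forall>h\<in>carrier H. \<phi> h = \<one>\<^bsub>rational_points G\<^esub>))"
proof -
  interpret topological_group H T by (rule lie_group_topological_group[OF assms(4)])
  have mult: "\<phi> (x \<otimes>\<^bsub>H\<^esub> y) = \<phi> x ** \<phi> y" if "x \<in> carrier H" "y \<in> carrier H" for x y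
    using hom_mult[OF assms(6) that] by (simp add: rational_points_def GL_def)
  have inv: "invertible (\<phi> x)" if "x \<in> carrier H" for x
    using hom_in_carrier[OF assms(6) that] by (simp add: rational_points_def GL_def)
  have one: "\<phi> \<one>\<^bsub>H\<^esub> = mat 1"
  proof -
    obtain B where B: "\<phi> \<one>\<^bsub>H\<^esub> ** B = mat 1" using inv[of "\<one>\<^bsub>H\<^esub>"] by (auto simp: invertible_def)
    have "\<phi> \<one>\<^bsub>H\<^esub> ** (\<phi> \<one>\<^bsub>H\<^esub> ** B) = \<phi> \<one>\<^bsub>H\<^esub> ** B"
      using mult[of "\<one>\<^bsub>H\<^esub>" "\<one>\<^bsub>H\<^esub>"] by (simp add: matrix_mul_assoc)
    then show ?thesis by (simp add: B)
  qed
  have trivial: "\<forall>h\<in>carrier H. \<phi> h = mat 1" if perfect: "derived H (carrier H) = carrier H"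
    and c: "lie_group_chart H T \<A> c" for c
  proof
    fix h assume h: "h \<in> carrier H"
    have "sqmat_of (\<phi> h) = 1"
      by (rule perfect_lie_group_representation_trivial[OF c assms(5,1,2) _ _ perfect h, of "\<lambda>x. sqmat_of (\<phi> x)"])
        (simp_all add: mult one times_sqmat.abs_eq one_sqmat.abs_eq)
    then show "\<phi> h = mat 1" by (simp add: one_sqmat.abs_eq sqmat_of_inject)
  qed
  have goal: "\<forall>h\<in>carrier H. \<phi> h = mat 1" if "perfect_group H \<or> semisimple_lie_group H \<A>"
  proof (cases "\<A> = {}")
    case True
    have "smooth_manifold T \<A>" using assms(4) by (simp add: lie_group_def)
    moreover have "topspace T \<noteq> {}" using topspace_eq by auto
    \<comment> \<open>A manifold with the empty atlas is discrete, and a connected discrete group is trivial.\<close>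
    ultimately have disc: "T = discrete_topology (topspace T)"
      using True by (auto simp: smooth_manifold_def smooth_atlas_def)
    have "topspace T = {\<one>\<^bsub>H\<^esub>}"
    proof -
      have "openin T {\<one>\<^bsub>H\<^esub>}" "closedin T {\<one>\<^bsub>H\<^esub>}"
        by (subst disc, simp add: topspace_eq)+
      then show ?thesis using assms(5) by (metis connected_space_clopen_in insert_not_empty)
    qed
    then show ?thesis using one topspace_eq by auto
  next
    case False
    have "smooth_manifold T \<A>" using assms(4) by (simp add: lie_group_def)
    then have "smooth_atlas T \<A>" using False by (auto simp: smooth_manifold_def)
    then have "(\<Union>c\<in>\<A>. fst c) = carrier H" by (simp add: smooth_atlas_def topspace_eq)
    then obtain c where c: "c \<in> \<A>" "\<one>\<^bsub>H\<^esub> \<in> fst c" using one_closed by blast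
    have chart: "lie_group_chart H T \<A> c"
      by unfold_locales (use assms(4) c in auto)
    have "derived H (carrier H) = carrier H"
      using that lie_group_chart_semisimple_perfect[OF chart assms(5)] c
      by (auto simp: perfect_group_def semisimple_lie_group_def)
    then show ?thesis using trivial chart by blast
  qed
  have "\<one>\<^bsub>rational_points G\<^esub> = mat 1" by (simp add: rational_points_def GL_def)
  then show ?thesis using goal by simp
qed

end
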